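(* Let $a\in\mathbb{R}$, $l>0$, let $\{f_n(t)\}_{n=0}^\infty$, $t\in[a,a+2l]$, be an $L_2$-orthogonal system on $[a,a+2l]$, and let $k\in\mathbb{N}$ ($k\ge1$) be fixed. For large $T$ and $p=1,\dots,k$ put $$u_p(t)=\frac{(T+2l)_p-T_p}{2l}(t-a)+T_p,\qquad t\in[a,a+2l],$$ where $T_p=\varphi_1^{-p}(T)$ and $(T+2l)_p=\varphi_1^{-p}(T+2l)$ are the $p$-th reverse iterates by the Jacob's ladder $\varphi_1$. Then for all sufficiently large $T>0$ and each $p=1,\dots,k$, the system $$\left\{f_n\left(\varphi_1^p(u_p(t))-T+a\right)\right\}_{n=0}^\infty,\qquad t\in[a,a+2l],$$ is $L_2$-orthogonal on $[a,a+2l]$ with the weight $$\prod_{r=0}^{p-1}\tilde Z^2\left(\varphi_1^r(u_p(t))\right),$$ and this weight satisfies $$\prod_{r=0}^{p-1}\tilde Z^2\left(\varphi_1^r(u_p(t))\right)\sim\frac{1}{\ln^pT}\prod_{r=0}^{p-1}\left|\zeta\left(\frac12+i\varphi_1^r(u_p(t))\right)\right|^2,\qquad T\to\infty .$$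
   Context: $L_2$-orthogonal system: a sequence of real-valued functions $f_n\in L_2([a,a+2l])$ with $\int_a^{a+2l}f_m(t)f_n(t)\,dt=0$ for all $m\neq n$. A system $\{g_n\}$ is $L_2$-orthogonal with weight $W\ge0$ on $[a,a+2l]$ if $\int_a^{a+2l}g_m(t)g_n(t)W(t)\,dt=0$ for all $m\ne n$. The relation $A\sim B$ means $A=(1+o(1))B$ (so both sides may vanish simultaneously). Hardy's function: $Z(t)=e^{i\vartheta(t)}\zeta\left(\frac12+it\right)$ with $\vartheta(t)=-\frac t2\ln\pi+\operatorname{Im}\ln\Gamma\left(\frac14+i\frac t2\right)$, where $\zeta$ is the Riemann zeta-function; thus $Z^2(t)=|\zeta(\frac12+it)|^2$. Jacob's ladder: fix $\mu(y)=\alpha\, y\ln y$ with some constant $\alpha\in[7,8]$. For all sufficiently large $T$, say $T\ge T_0$, let $\varphi(T)$ be the (known to be unique) solution $x(T)=\varphi(T)$, with $\varphi(T)\to\infty$ as $T\to\infty$, of the integral equation $$\int_0^{\mu[x(T)]}Z^2(t)e^{-\frac{2}{x(T)}t}\,dt=\int_0^TZ^2(t)\,dt .$$ The Jacob's ladder is $\varphi_1(T)=\frac12\varphi(T)$. It is a smooth, increasing function on $[T_0,+\infty)$, tending to $+\infty$. Function $\tilde Z^2$: $$\tilde Z^2(t)=\frac{d\varphi_1(t)}{dt}=\frac{1}{\omega(t)}\left|\zeta\left(\tfrac12+it\right)\right|^2,\qquad \omega(t)=\left\{1+\mathcal{O}\left(\frac{\ln\ln t}{\ln t}\right)\right\}\ln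 t,\quad t\to\infty ;$$ the second equality is a known property of $\varphi_1$. Direct iterates: $\varphi_1^0(t)=t$, $\varphi_1^1(t)=\varphi_1(t)$, $\varphi_1^r(t)=\varphi_1(\varphi_1^{r-1}(t))$. Reverse iterates: for large $S$, put $S_0=S$ and define $S_p$ by $\varphi_1(S_p)=S_{p-1}$, i.e. $S_p=\varphi_1^{-p}(S)$ is the $p$-fold application of the inverse function $\varphi_1^{-1}$ to $S$. *)

theory Defs
  imports "HOL-Complex_Analysis.Complex_Analysis"
begin

subsection \<open>The Riemann zeta-function\<close>

text \<open>
  The analytic continuation of the Dirichlet series to the punctured half-plane
  \<open>Re s > 0\<close>, \<open>s \<noteq> 1\<close>, which contains the critical line. Existence and uniqueness on this
  domain are proved below; values outside it are unspecified.
\<close>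

definition zeta_domain :: "complex set" where
  "zeta_domain = {s. Re s > 0} - {1}"

definition riemann_zeta :: "complex \<Rightarrow> complex" where
  "riemann_zeta = (SOME f. f holomorphic_on zeta_domain \<and>
     (\<forall>s. Re s > 1 \<longrightarrow> (\<lambda>n. of_nat (Suc n) powr (- s)) sums f s))"

lemma open_zeta_domain: "open zeta_domain"
  unfolding zeta_domain_def by (intro open_Diff open_halfspace_Re_gt) auto

lemma connected_zeta_domain: "connected zeta_domain"
  unfolding zeta_domain_def
  by (intro connected_open_delete convex_connected open_halfspace_Re_gt convex_halfspace_Re_gt) auto

context
begin

private definition zterm :: "nat \<Rightarrow> complex \<Rightarrow> complex" where
  "zterm n s = of_nat (Suc n) powr (- s)
     - (of_nat (Suc (Suc n)) powr (1 - s) - of_nat (Suc n) powr (1 - s)) / (1 - s)"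

private lemma zterm_bound:
  assumes s: "Re s > 0" "s \<noteq> 1"
  shows "norm (zterm n s) \<le> norm s * real (Suc n) powr (- Re s - 1)"
proof -
  define N where "N = real (Suc n)"
  define S where "S = complex_of_real ` {N..N+1}"
  define K where "K = norm s * N powr (- Re s - 1)"
  have N: "N > 0" by (simp add: N_def)
  have K0: "K \<ge> 0" by (simp add: K_def)
  have convex: "convex S"
    unfolding S_def by (intro convex_linear_image bounded_linear.linear[OF bounded_linear_of_real]) simp
  have NS: "of_real N \<in> S" "of_real (N + 1) \<in> S"
    unfolding S_def by (intro imageI, simp)+
  have S_pos: "z \<notin> \<real>\<^sub>\<le>\<^sub>0" "z \<noteq> 0" if "z \<in> S" for z
    using that N by (auto simp: S_def)
  have pow: "((\<lambda>z. z powr r) has_field_derivative r * z powr (r - 1)) (at z within S)"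
    if "z \<in> S" for z r
    using has_field_derivative_powr[OF S_pos(1)[OF that]] has_field_derivative_at_within by blast
  have D1: "norm (z powr (- s) - of_real N powr (- s)) \<le> K" if z: "z \<in> S" for z
  proof -
    have "norm (z powr (- s) - of_real N powr (- s)) \<le> K * norm (z - of_real N)"
    proof (rule field_differentiable_bound[OF convex _ _ z NS(1)])
      show "((\<lambda>z. z powr (- s)) has_field_derivative (- s) * y powr (- s - 1)) (at y within S)"
        if "y \<in> S" for y
        using pow[OF that] .
      show "norm ((- s) * y powr (- s - 1)) \<le> K" if y: "y \<in> S" for y
      proof -
        obtain x where x: "y = of_real x" "N \<le> x" using y by (auto simp: S_def)
        have "norm (y powr (- s - 1)) = x powr (- Re s - 1)"
          using x N by (subst norm_powr_real_powr) auto
        also have "\<dots> \<le> N powr (- Re s - 1)"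
          using x N s by (intro powr_mono2') auto
        finally show ?thesis unfolding K_def norm_mult norm_minus_cancel
          by (intro mult_left_mono) auto
      qed
    qed
    also have "norm (z - of_real N) \<le> 1"
    proof -
      obtain x where x: "z = of_real x" "N \<le> x" "x \<le> N + 1" using z by (auto simp: S_def)
      have "norm (z - of_real N) = \<bar>x - N\<bar>"
        unfolding x(1) of_real_diff[symmetric] norm_of_real ..
      then show ?thesis using x by simp
    qed
    finally show ?thesis using K0 by (simp add: mult_left_mono)
  qed
  define G where "G = (\<lambda>z. z powr (1 - s) / (1 - s) - z * of_real N powr (- s))"
  have "norm (G (of_real (N + 1)) - G (of_real N)) \<le> K * norm (complex_of_real (N + 1) - of_real N)"
  proof (rule field_differentiable_bound[OF convex _ D1 NS(2) NS(1)])
    show "(G has_field_derivative (z powr (- s) - of_real N powr (- s))) (at z within S)"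
      if "z \<in> S" for z
    proof -
      have "(G has_field_derivative ((1 - s) * z powr (1 - s - 1)) / (1 - s) - 1 * of_real N powr (- s))
          (at z within S)"
        unfolding G_def
        by (intro DERIV_diff DERIV_cdivide pow[OF that] DERIV_cmult_right DERIV_ident)
      then show ?thesis using s by simp
    qed
  qed
  also have "norm (complex_of_real (N + 1) - of_real N) = 1"
    by simp
  also have "G (of_real (N + 1)) - G (of_real N) = - zterm n s"
    by (simp add: G_def zterm_def N_def diff_divide_distrib algebra_simps)
  finally show ?thesis by (simp add: K_def N_def)
qed

private lemma zterm_summable_bound:
  assumes "\<sigma> > 0" shows "summable (\<lambda>n. C * real (Suc n) powr (- \<sigma> - 1))"
proof -
  have "summable (\<lambda>n. real n powr (- \<sigma> - 1))"
    using assms by (simp add: summable_real_powr_iff)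
  then show ?thesis by (intro summable_mult) (subst summable_Suc_iff)
qed

private lemma zterm_suminf_holomorphic: "(\<lambda>s. \<Sum>n. zterm n s) holomorphic_on zeta_domain"
proof (rule holomorphic_uniform_sequence[OF open_zeta_domain])
  show "(\<lambda>s. \<Sum>n<k. zterm n s) holomorphic_on zeta_domain" for k
    unfolding zterm_def zeta_domain_def by (intro holomorphic_intros) auto
  show "\<exists>d. 0 < d \<and> cball x d \<subseteq> zeta_domain \<and>
      uniform_limit (cball x d) (\<lambda>k s. \<Sum>n<k. zterm n s) (\<lambda>s. \<Sum>n. zterm n s) sequentially"
    if x: "x \<in> zeta_domain" for x
  proof -
    obtain d where d: "d > 0" "cball x d \<subseteq> zeta_domain"
      using open_contains_cball[THEN iffD1, OF open_zeta_domain, rule_format, OF x] by auto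
    have "x - of_real d \<in> cball x d" using d by (simp add: dist_norm)
    then have "x - of_real d \<in> zeta_domain" by (rule subsetD[OF d(2)])
    then have \<sigma>: "Re x - d > 0" by (simp add: zeta_domain_def)
    have "uniform_limit (cball x d) (\<lambda>k s. \<Sum>n<k. zterm n s) (\<lambda>s. \<Sum>n. zterm n s) sequentially"
    proof (rule Weierstrass_m_test)
      show "summable (\<lambda>n. (norm x + d) * real (Suc n) powr (- (Re x - d) - 1))"
        by (rule zterm_summable_bound[OF \<sigma>])
      show "norm (zterm n s) \<le> (norm x + d) * real (Suc n) powr (- (Re x - d) - 1)"
        if s: "s \<in> cball x d" for n s
      proof -
        have "norm (zterm n s) \<le> norm s * real (Suc n) powr (- Re s - 1)"
          using subsetD[OF d(2) s] by (intro zterm_bound) (simp_all add: zeta_domain_def)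
        also have "\<dots> \<le> (norm x + d) * real (Suc n) powr (- (Re x - d) - 1)"
        proof (intro mult_mono powr_mono)
          have "norm s \<le> norm x + norm (s - x)" by (metis add.commute diff_add_cancel norm_triangle_ineq)
          then show "norm s \<le> norm x + d"
            using s by (auto simp: dist_norm norm_minus_commute)
          have "\<bar>Re (x - s)\<bar> \<le> d" using s abs_Re_le_cmod[of "x - s"] by (auto simp: dist_norm)
          then show "- Re s - 1 \<le> - (Re x - d) - 1" by auto
        qed (use d in auto)
        finally show ?thesis .
      qed
    qed
    with d show ?thesis by (intro exI[of _ d] conjI)
  qed
qed

lemma riemann_zeta_exists:
  "\<exists>f. f holomorphic_on zeta_domain \<and>
     (\<forall>s. Re s > 1 \<longrightarrow> (\<lambda>n. of_nat (Suc n) powr (- s)) sums f s)"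
proof (intro exI[of _ "\<lambda>s. 1 / (s - 1) + (\<Sum>n. zterm n s)"] conjI allI impI)
  show "(\<lambda>s. 1 / (s - 1) + (\<Sum>n. zterm n s)) holomorphic_on zeta_domain"
    by (intro holomorphic_intros zterm_suminf_holomorphic) (auto simp: zeta_domain_def)
  fix s :: complex assume s: "Re s > 1"
  then have s1: "s \<noteq> 1" by auto
  have "summable (\<lambda>n. zterm n s)"
    by (rule summable_comparison_test'[OF zterm_summable_bound[of "Re s" "norm s"], of 0])
       (use s s1 zterm_bound[of s] in auto)
  then have A: "(\<lambda>n. zterm n s) sums (\<Sum>n. zterm n s)" by (rule summable_sums)
  have "(\<lambda>n. complex_of_nat (Suc n) powr (1 - s)) \<longlonglongrightarrow> 0"
  proof (rule Lim_null_comparison)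
    show "\<forall>\<^sub>F n in sequentially. norm (complex_of_nat (Suc n) powr (1 - s)) \<le> real (Suc n) powr (1 - Re s)"
    proof (rule always_eventually, rule allI)
      fix n
      show "norm (complex_of_nat (Suc n) powr (1 - s)) \<le> real (Suc n) powr (1 - Re s)"
        using norm_powr_real_powr[of "of_nat (Suc n)" "1 - s"] by simp
    qed
    have "((\<lambda>n. real n powr (1 - Re s)) \<longlongrightarrow> 0) sequentially"
      using s by (intro tendsto_neg_powr filterlim_real_sequentially) auto
    then show "(\<lambda>n. real (Suc n) powr (1 - Re s)) \<longlonglongrightarrow> 0" by (rule LIMSEQ_Suc)
  qed
  from telescope_sums[OF this]
  have "(\<lambda>n. complex_of_nat (Suc (Suc n)) powr (1 - s) - of_nat (Suc n) powr (1 - s)) sums (0 - 1)"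
    by simp
  from sums_divide[OF this, of "1 - s"]
  have "(\<lambda>n. (complex_of_nat (Suc (Suc n)) powr (1 - s) - of_nat (Suc n) powr (1 - s)) / (1 - s))
      sums ((0 - 1) / (1 - s))" .
  from sums_add[OF A this]
  have "(\<lambda>n. of_nat (Suc n) powr (- s)) sums ((\<Sum>n. zterm n s) + (0 - 1) / (1 - s))"
    by (simp add: zterm_def)
  moreover have "(0 - 1) / (1 - s) = 1 / (s - 1)"
    using s1 by (simp add: field_simps)
  ultimately show "(\<lambda>n. of_nat (Suc n) powr (- s)) sums (1 / (s - 1) + (\<Sum>n. zterm n s))"
    by (simp only: add.commute)
qed

end

lemma riemann_zeta_holomorphic: "riemann_zeta holomorphic_on zeta_domain"
  unfolding riemann_zeta_def by (rule someI_ex[OF riemann_zeta_exists, THEN conjunct1])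

lemma riemann_zeta_sums: "Re s > 1 \<Longrightarrow> (\<lambda>n. of_nat (Suc n) powr (- s)) sums riemann_zeta s"
  unfolding riemann_zeta_def
  by (rule someI_ex[OF riemann_zeta_exists, THEN conjunct2, rule_format])

lemma riemann_zeta_unique:
  assumes "f holomorphic_on zeta_domain"
    and "\<And>s. Re s > 1 \<Longrightarrow> (\<lambda>n. of_nat (Suc n) powr (- s)) sums f s"
    and "s \<in> zeta_domain"
  shows "f s = riemann_zeta s"
proof (rule analytic_continuation_open[of "{s. Re s > 1}" zeta_domain f riemann_zeta])
  show "{s. Re s > 1} \<noteq> {}"
    by (rule ex_in_conv[THEN iffD1, OF exI[of _ 2]]) simp
  show "f z = riemann_zeta z" if "z \<in> {s. Re s > 1}" for z
    by (rule sums_unique2[OF assms(2) riemann_zeta_sums]) (use that in auto)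
  show "{s. Re s > 1} \<subseteq> zeta_domain"
    by (auto simp: zeta_domain_def)
qed (fact assms open_zeta_domain connected_zeta_domain riemann_zeta_holomorphic open_halfspace_Re_gt)+


subsection \<open>Hardy's function and Jacob's ladder\<close>

definition riemann_siegel_theta :: "real \<Rightarrow> real" where
  "riemann_siegel_theta t = - (t / 2) * ln pi + Im (ln_Gamma (Complex (1/4) (t / 2)))"

text \<open>
  Hardy's function is real-valued on the real line, but stated with its complex formula; its
  square is therefore written \<open>(cmod (hardy_Z t))\<^sup>2\<close> below.
\<close>

definition hardy_Z :: "real \<Rightarrow> complex" where
  "hardy_Z t = exp (\<i> * of_real (riemann_siegel_theta t)) * riemann_zeta (Complex (1/2) t)"

definition ladder_mu :: "real \<Rightarrow> real \<Rightarrow> real" where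
  "ladder_mu \<alpha> y = \<alpha> * y * ln y"

text \<open>
  \<open>\<phi>\<close> solves the integral equation on \<open>[T\<^sub>0, \<infinity>)\<close> and tends to infinity. Any two such functions
  agree for large arguments, because the left-hand side is strictly increasing in \<open>\<phi> T \<ge> 1\<close>.
\<close>

definition solves_ladder_equation :: "real \<Rightarrow> real \<Rightarrow> (real \<Rightarrow> real) \<Rightarrow> bool" where
  "solves_ladder_equation \<alpha> T\<^sub>0 \<phi> \<longleftrightarrow>
     (\<forall>T\<ge>T\<^sub>0. integral {0..ladder_mu \<alpha> (\<phi> T)} (\<lambda>t. (cmod (hardy_Z t))\<^sup>2 * exp (- (2 / \<phi> T) * t))
            = integral {0..T} (\<lambda>t. (cmod (hardy_Z t))\<^sup>2)) \<and>
     filterlim \<phi> at_top at_top"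

definition jacob_ladder :: "(real \<Rightarrow> real) \<Rightarrow> real \<Rightarrow> real" where
  "jacob_ladder \<phi> T = \<phi> T / 2"

definition Z_tilde_sq :: "(real \<Rightarrow> real) \<Rightarrow> real \<Rightarrow> real" where
  "Z_tilde_sq \<phi> t = deriv (jacob_ladder \<phi>) t"

definition ladder_iter :: "(real \<Rightarrow> real) \<Rightarrow> nat \<Rightarrow> real \<Rightarrow> real" where
  "ladder_iter \<phi> r = jacob_ladder \<phi> ^^ r"

text \<open>
  The inverse is that of the ladder on \<open>[T\<^sub>0, \<infinity>)\<close>; every sufficiently large value has exactly one
  preimage there, so \<^const>\<open>inv_into\<close> involves no choice for large arguments.
\<close>

definition ladder_reverse :: "real \<Rightarrow> (real \<Rightarrow> real) \<Rightarrow> nat \<Rightarrow> real \<Rightarrow> real" where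
  "ladder_reverse T\<^sub>0 \<phi> p = inv_into {T\<^sub>0..} (jacob_ladder \<phi>) ^^ p"

definition ladder_u :: "real \<Rightarrow> (real \<Rightarrow> real) \<Rightarrow> real \<Rightarrow> real \<Rightarrow> nat \<Rightarrow> real \<Rightarrow> real \<Rightarrow> real" where
  "ladder_u T\<^sub>0 \<phi> a l p T t =
     (ladder_reverse T\<^sub>0 \<phi> p (T + 2 * l) - ladder_reverse T\<^sub>0 \<phi> p T) / (2 * l) * (t - a)
       + ladder_reverse T\<^sub>0 \<phi> p T"

definition ladder_weight :: "real \<Rightarrow> (real \<Rightarrow> real) \<Rightarrow> real \<Rightarrow> real \<Rightarrow> nat \<Rightarrow> real \<Rightarrow> real \<Rightarrow> real" where
  "ladder_weight T\<^sub>0 \<phi> a l p T t =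
     (\<Prod>r<p. Z_tilde_sq \<phi> (ladder_iter \<phi> r (ladder_u T\<^sub>0 \<phi> a l p T t)))"


subsection \<open>Orthogonal systems\<close>

definition L2_orthogonal :: "(nat \<Rightarrow> real \<Rightarrow> real) \<Rightarrow> real set \<Rightarrow> bool" where
  "L2_orthogonal f S \<longleftrightarrow>
     (\<forall>n. f n \<in> borel_measurable (lebesgue_on S) \<and> integrable (lebesgue_on S) (\<lambda>t. (f n t)\<^sup>2)) \<and>
     (\<forall>m n. m \<noteq> n \<longrightarrow> (LINT t|lebesgue_on S. f m t * f n t) = 0)"

text \<open>
  Integrability is required of all products, the squares (\<open>m = n\<close>) included, since the Bochner
  integral of a non-integrable function is 0 by convention.
\<close>

definition L2_orthogonal_weight :: "(nat \<Rightarrow> real \<Rightarrow> real) \<Rightarrow> (real \<Rightarrow> real) \<Rightarrow> real set \<Rightarrow> bool" where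
  "L2_orthogonal_weight g W S \<longleftrightarrow>
     (\<forall>t\<in>S. W t \<ge> 0) \<and>
     (\<forall>m n. integrable (lebesgue_on S) (\<lambda>t. g m t * g n t * W t)) \<and>
     (\<forall>m n. m \<noteq> n \<longrightarrow> (LINT t|lebesgue_on S. g m t * g n t * W t) = 0)"


subsection \<open>Asymptotic equality with a parameter\<close>

text \<open>
  \<open>A = (1 + o(1)) B\<close> as \<open>T \<rightarrow> \<infinity>\<close>, with the \<open>o(1)\<close> uniform in the parameter \<open>t \<in> S\<close>. Both sides may
  vanish at the same points, which the ratio-based \<open>asymp_equiv\<close> does not express uniformly in \<open>t\<close>.
\<close>

definition asymp_eq_uniform ::
    "'a set \<Rightarrow> (real \<Rightarrow> 'a \<Rightarrow> real) \<Rightarrow> (real \<Rightarrow> 'a \<Rightarrow> real) \<Rightarrow> bool" where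
  "asymp_eq_uniform S A B \<longleftrightarrow>
     (\<exists>h. uniform_limit S h (\<lambda>_. 0) at_top \<and>
          (\<forall>\<^sub>F T in at_top. \<forall>t\<in>S. A T t = (1 + h T t) * B T t))"

end

theory Submission
  imports Defs "HOL-Real_Asymp.Real_Asymp"
begin

text \<open>
  Write \<open>w(t) = |zeta(1/2 + it)|^2\<close> and \<open>\<phi>\<^sub>1 = \<phi> / 2\<close>.

  Orthogonality is a change of variables. By the chain rule, the weight is the derivative of
  \<open>\<phi>\<^sub>1\<close> iterated \<open>p\<close> times along the affine map \<open>u\<^sub>p\<close>, up to the constant slope of \<open>u\<^sub>p\<close>. The composed map
  carries \<open>[a, a + 2l]\<close> increasingly onto \<open>[T, T + 2l]\<close>, so the weighted integral of a product is
  the unweighted one divided by that slope (\<open>L2_orthogonal_change_of_variables\<close>,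
  \<open>ladder_system_orthogonal\<close>). What this needs from analysis is that \<open>\<phi>\<^sub>1\<close> is eventually
  differentiable, strictly increasing and onto a half-line.

  Both this and the size of the weight come from the integral equation \<open>F(\<phi>(T)) = G(T)\<close>, where
  \<open>G(T)\<close> is the integral of \<open>w\<close> over \<open>[0, T]\<close> and \<open>F(y)\<close> the integral of \<open>w(t) exp(-2t/y)\<close> up to
  \<open>\<alpha> y ln y\<close>. Differentiating it gives \<open>\<phi>\<^sub>1' = w / \<omega>\<close> with \<open>\<omega>(T) = 2 F'(\<phi>(T))\<close>, so everything
  reduces to \<open>F'(y) ~ (1/2) ln y\<close> and \<open>ln \<phi>(T) ~ ln T\<close>. Both
  follow from the mean value theorem of Hardy and Littlewood, \<open>G(T) ~ T ln T\<close>
  (\<open>zeta_primitive_asymp\<close>): the first by an integration by parts, the second from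
  \<open>e^(-2) G(y) \<le> F(y) \<le> G(\<alpha> y ln y)\<close>.

  The mean value theorem is obtained from an approximation of zeta on the critical line by the
  Dirichlet polynomial of length \<open>N\<close>, valid for \<open>0 \<le> t \<le> N\<close> with error \<open>O(N^(-1/2))\<close> apart from
  the term \<open>N^(1-s) / (s-1)\<close> (\<open>zeta_approx_error\<close>). A polynomial of length about \<open>T\<close> has as many
  terms as the interval is long, so with a sharp cutoff the termwise bound of the off-diagonal
  terms is only of the order \<open>T ln T\<close> of the main term. With the weight \<open>T - t\<close> the off-diagonal terms
  decay quadratically in the frequency difference and contribute \<open>O(T^2)\<close> against a main term
  \<open>(T^2 / 2) ln T\<close> (\<open>fejer_dirichlet\<close>). Because \<open>w \<ge> 0\<close>, the weight can be removed afterwards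
  by taking difference quotients.

  The logarithms of all points \<open>\<phi>\<^sub>1^r(u\<^sub>p(t))\<close> are asymptotically \<open>ln T\<close>, uniformly in \<open>t\<close>, since
  they lie between reverse iterates of \<open>T\<close> and \<open>T + 2l\<close>. Replacing each factor \<open>\<omega>\<close> of the weight by \<open>ln T\<close> is
  therefore a uniform \<open>1 + o(1)\<close> (\<open>ladder_weight_asymp\<close>).
\<close>

section \<open>Partial sums of the Dirichlet series with their main correction\<close>

text \<open>
  The sum over \<open>n < N\<close> together with the integral of \<open>x^(-s)\<close> over \<open>[N, \<infinity>)\<close>, the latter continued
  analytically to \<open>N^(1-s) / (s-1)\<close>.
\<close>

definition zeta_approx :: "nat \<Rightarrow> complex \<Rightarrow> complex" where
  "zeta_approx N s = (\<Sum>n=1..<N. of_nat n powr (- s)) + of_nat N powr (1 - s) / (s - 1)"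

lemma has_vector_derivative_shift_powr:
  fixes x u :: real and z :: complex
  assumes "x + u > 0"
  shows "((\<lambda>u. of_real (x + u) powr z) has_vector_derivative z * of_real (x + u) powr (z - 1))
           (at u within S)"
proof -
  have "((\<lambda>y. y powr z) has_field_derivative z * of_real (x + u) powr (z - 1)) (at (complex_of_real (x + u)))"
    by (rule has_field_derivative_powr) (use assms in \<open>simp only: complex_nonpos_Reals_iff Re_complex_of_real, simp\<close>)
  moreover have "((\<lambda>u. complex_of_real (x + u)) has_vector_derivative 1) (at u within S)"
    by (auto intro!: derivative_eq_intros)
  ultimately show ?thesis
    using field_vector_diff_chain_within[of "\<lambda>u. complex_of_real (x + u)" 1 u S "\<lambda>y. y powr z"]
      has_field_derivative_at_within by (fastforce simp: o_def)
qed

lemma norm_of_real_powr: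
  assumes "x > 0" shows "norm (complex_of_real x powr z) = x powr Re z"
  using assms by (subst norm_powr_real_powr) auto

text \<open>
  Passing from \<open>N = n\<close> to \<open>n + 1\<close> adds the term \<open>n^(-s)\<close> and removes the integral of \<open>x^(-s)\<close> over
  \<open>[n, n + 1]\<close>. Written as one integral, the cancellation that gives a further power of \<open>n\<close> becomes visible.
\<close>

lemma zeta_approx_step_has_integral:
  assumes n: "n \<ge> 1" and s: "s \<noteq> 1"
  shows "((\<lambda>u. of_nat n powr (- s) - of_real (real n + u) powr (- s))
            has_integral (zeta_approx (Suc n) s - zeta_approx n s)) {0..1}"
proof -
  have "((\<lambda>u. of_real (real n + u) powr (- s)) has_integral
        (of_real (real n + 1) powr (1 - s) / (1 - s) - of_real (real n + 0) powr (1 - s) / (1 - s))) {0..1}"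
  proof (rule fundamental_theorem_of_calculus)
    fix u :: real assume u: "u \<in> {0..1}"
    have "((\<lambda>u. of_real (real n + u) powr (1 - s) / (1 - s)) has_vector_derivative
        ((1 - s) * of_real (real n + u) powr (1 - s - 1)) / (1 - s)) (at u within {0..1})"
      by (intro has_vector_derivative_divide has_vector_derivative_shift_powr) (use n u in auto)
    then show "((\<lambda>u. of_real (real n + u) powr (1 - s) / (1 - s)) has_vector_derivative
        of_real (real n + u) powr (- s)) (at u within {0..1})"
      using s by simp
  qed simp
  from has_integral_diff[OF has_integral_const_real[of "of_nat n powr (- s)" 0 1] this]
  have I: "((\<lambda>u. of_nat n powr (- s) - of_real (real n + u) powr (- s)) has_integral
     (of_nat n powr (- s) - (of_real (real n + 1) powr (1 - s) / (1 - s) - of_nat n powr (1 - s) / (1 - s)))) {0..1}"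
    by simp
  have "zeta_approx (Suc n) s - zeta_approx n s =
      of_nat n powr (- s) + (of_nat (Suc n) powr (1 - s) / (s - 1) - of_nat n powr (1 - s) / (s - 1))"
    using n by (simp add: zeta_approx_def)
  also have "\<dots> = of_nat n powr (- s) - (of_real (real n + 1) powr (1 - s) / (1 - s) - of_nat n powr (1 - s) / (1 - s))"
  proof -
    have "x / (s - 1) = - (x / (1 - s))" for x
      by (metis minus_diff_eq divide_minus_right)
    then show ?thesis by (simp add: add.commute)
  qed
  finally show ?thesis using I by simp
qed

lemma zeta_approx_step_bound:
  assumes n: "n \<ge> 1" and s: "s \<noteq> 1" "Re s > 0"
  shows "norm (zeta_approx (Suc n) s - zeta_approx n s) \<le> norm s * real n powr (- Re s - 1)"
proof -
  define B where "B = norm s * real n powr (- Re s - 1)"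
  have B: "B \<ge> 0" by (simp add: B_def)
  have bd: "norm (of_nat n powr (- s) - complex_of_real (real n + u) powr (- s)) \<le> B"
    if u: "u \<in> {0..1}" for u
  proof -
    have "((\<lambda>v. (- s) * of_real (real n + v) powr (- s - 1)) has_integral
          (of_real (real n + u) powr (- s) - of_real (real n + 0) powr (- s))) {0..u}"
      by (intro fundamental_theorem_of_calculus has_vector_derivative_shift_powr) (use n u in auto)
    then have "norm (complex_of_real (real n + u) powr (- s) - of_real (real n + 0) powr (- s))
        \<le> B * measure lborel (cbox 0 u)"
    proof (intro has_integral_bound[OF B], unfold cbox_interval)
      fix v assume v: "v \<in> {0..u}"
      have "(real n + v) powr (- Re s - 1) \<le> real n powr (- Re s - 1)"
        using n v s by (intro powr_mono2') auto
      moreover have "norm (complex_of_real (real n + v) powr (- s - 1)) = (real n + v) powr (- Re s - 1)"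
        using n v by (subst norm_of_real_powr) auto
      ultimately show "norm ((- s) * complex_of_real (real n + v) powr (- s - 1)) \<le> B"
        unfolding B_def norm_mult by (intro mult_mono) auto
    qed
    also have "\<dots> \<le> B * 1" using u B by (intro mult_left_mono) auto
    finally show ?thesis by (simp add: norm_minus_commute)
  qed
  have "norm (zeta_approx (Suc n) s - zeta_approx n s) \<le> B * measure lborel (cbox 0 (1::real))"
    using zeta_approx_step_has_integral[OF n s(1)] bd
    by (intro has_integral_bound[OF B]) (auto simp: cbox_interval)
  then show ?thesis by (simp add: B_def)
qed

lemma zeta_approx_holomorphic: "N \<ge> 1 \<Longrightarrow> zeta_approx N holomorphic_on zeta_domain"
  unfolding zeta_approx_def zeta_domain_def by (intro holomorphic_intros) auto

text \<open>
  The steps are \<open>O(|s| n^(-\<sigma>-1))\<close> locally uniformly on \<open>Re s > 0\<close>, so the limit is holomorphic there.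
  For \<open>Re s > 1\<close> the correction term tends to 0 and the limit is the Dirichlet series; uniqueness of
  the continuation does the rest.
\<close>

lemma zeta_approx_tendsto:
  assumes s: "s \<in> zeta_domain"
  shows "(\<lambda>N. zeta_approx N s) \<longlonglongrightarrow> riemann_zeta s"
proof -
  define d where "d n s = zeta_approx (Suc (Suc n)) s - zeta_approx (Suc n) s" for n s
  define f where "f s = zeta_approx 1 s + (\<Sum>n. d n s)" for s
  have sum_d: "(\<Sum>n<k. d n s) = zeta_approx (Suc k) s - zeta_approx 1 s" for k s
    by (induction k) (auto simp: d_def)
  have d_bound: "norm (d n s) \<le> norm s * real (Suc n) powr (- Re s - 1)" if "s \<in> zeta_domain" for n s
    using zeta_approx_step_bound[of "Suc n" s] that by (simp add: d_def zeta_domain_def)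
  have summable_bound: "summable (\<lambda>n. C * real (Suc n) powr (- \<sigma> - 1))" if "\<sigma> > 0" for \<sigma> C
  proof -
    have "summable (\<lambda>n. real n powr (- \<sigma> - 1))" using that by (simp add: summable_real_powr_iff)
    then show ?thesis by (intro summable_mult) (subst summable_Suc_iff)
  qed
  have tendsto_f: "(\<lambda>N. zeta_approx N s) \<longlonglongrightarrow> f s" if "s \<in> zeta_domain" for s
  proof -
    have "summable (\<lambda>n. d n s)"
      by (rule summable_comparison_test'[OF summable_bound[of "Re s" "norm s"]])
         (use that d_bound in \<open>auto simp: zeta_domain_def\<close>)
    then have "(\<lambda>k. zeta_approx 1 s + (\<Sum>n<k. d n s)) \<longlonglongrightarrow> f s"
      unfolding f_def by (intro tendsto_intros summable_LIMSEQ)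
    then have "(\<lambda>k. zeta_approx (Suc k) s) \<longlonglongrightarrow> f s" by (simp add: sum_d)
    then show ?thesis by (rule LIMSEQ_imp_Suc)
  qed
  have hol: "(\<lambda>s. \<Sum>n. d n s) holomorphic_on zeta_domain"
  proof (rule holomorphic_uniform_sequence[OF open_zeta_domain])
    show "(\<lambda>s. \<Sum>n<k. d n s) holomorphic_on zeta_domain" for k
      unfolding d_def by (intro holomorphic_intros zeta_approx_holomorphic) auto
    fix x assume x: "x \<in> zeta_domain"
    obtain r where r: "r > 0" "cball x r \<subseteq> zeta_domain"
      using open_contains_cball[THEN iffD1, OF open_zeta_domain, rule_format, OF x] by auto
    have "x - of_real r \<in> cball x r" using r by (simp add: dist_norm)
    then have "x - of_real r \<in> zeta_domain" using r(2) by blast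
    then have pos: "Re x - r > 0" by (simp add: zeta_domain_def)
    have "uniform_limit (cball x r) (\<lambda>k s. \<Sum>n<k. d n s) (\<lambda>s. \<Sum>n. d n s) sequentially"
    proof (rule Weierstrass_m_test[OF _ summable_bound[OF pos, of "norm x + r"]])
      fix n s assume s: "s \<in> cball x r"
      have "norm (d n s) \<le> norm s * real (Suc n) powr (- Re s - 1)"
        using s r by (intro d_bound) auto
      also have "\<dots> \<le> (norm x + r) * real (Suc n) powr (- (Re x - r) - 1)"
      proof (intro mult_mono powr_mono)
        show "norm s \<le> norm x + r"
          using s norm_triangle_sub[of s x] by (auto simp: dist_norm norm_minus_commute)
        show "- Re s - 1 \<le> - (Re x - r) - 1"
          using s abs_Re_le_cmod[of "x - s"] by (auto simp: dist_norm)
      qed (use r in auto)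
      finally show "norm (d n s) \<le> (norm x + r) * real (Suc n) powr (- (Re x - r) - 1)" .
    qed
    with r show "\<exists>d'>0. cball x d' \<subseteq> zeta_domain \<and>
        uniform_limit (cball x d') (\<lambda>k s. \<Sum>n<k. d n s) (\<lambda>s. \<Sum>n. d n s) sequentially"
      by blast
  qed
  have "f s = riemann_zeta s"
  proof (rule riemann_zeta_unique[OF _ _ s])
    show "f holomorphic_on zeta_domain"
      unfolding f_def by (intro holomorphic_intros hol zeta_approx_holomorphic) auto
    fix z :: complex assume z: "Re z > 1"
    then have "z \<in> zeta_domain" by (auto simp: zeta_domain_def)
    from tendsto_f[OF this] have A: "(\<lambda>N. zeta_approx (Suc N) z) \<longlonglongrightarrow> f z"
      by (rule LIMSEQ_Suc)
    have "(\<lambda>N. norm (complex_of_nat (Suc N) powr (1 - z))) \<longlonglongrightarrow> 0"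
    proof -
      have "(\<lambda>n. real n powr (1 - Re z)) \<longlonglongrightarrow> 0"
        using z by (intro tendsto_neg_powr filterlim_real_sequentially) auto
      from LIMSEQ_Suc[OF this] show ?thesis
        using norm_of_real_powr[of "real (Suc _)" "1 - z"] by (simp del: of_nat_Suc)
    qed
    then have "(\<lambda>N. complex_of_nat (Suc N) powr (1 - z) / (z - 1)) \<longlonglongrightarrow> 0 / (z - 1)"
      using z by (intro tendsto_divide tendsto_norm_zero_cancel[of "\<lambda>N. complex_of_nat (Suc N) powr (1 - z)"]) auto
    from tendsto_diff[OF A this]
    have "(\<lambda>N. \<Sum>n=1..<Suc N. of_nat n powr (- z)) \<longlonglongrightarrow> f z"
      by (simp add: zeta_approx_def del: sum.op_ivl_Suc)
    moreover have "(\<Sum>n=1..<Suc N. of_nat n powr (- z)) = (\<Sum>n<N. of_nat (Suc n) powr (- z))" for N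
      by (simp only: One_nat_def sum.shift_bounds_Suc_ivl lessThan_atLeast0)
    ultimately show "(\<lambda>n. of_nat (Suc n) powr (- z)) sums f z"
      unfolding sums_def by simp
  qed
  with tendsto_f[OF s] show ?thesis by simp
qed

section \<open>The remainder on the critical line\<close>

lemma sin_lower_bounds:
  fixes x :: real
  assumes "0 < x" "x \<le> 1"
  shows "x - sin x \<le> x ^ 3 / 6" "sin x \<ge> x / 2" "sin x > 0"
proof -
  have "\<bar>sin x - (\<Sum>m<3. sin_coeff m * x ^ m)\<bar> \<le> inverse (fact 3) * \<bar>x\<bar> ^ 3"
    by (rule Maclaurin_sin_bound)
  then show 1: "x - sin x \<le> x ^ 3 / 6"
    using assms by (auto simp: numeral_3_eq_3 sin_coeff_def abs_if split: if_splits)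
  have "x ^ 2 \<le> 1" using assms by (intro power_le_one) auto
  then have "x ^ 3 \<le> x" using assms mult_left_mono[of "x^2" 1 x] by (simp add: power2_eq_square power3_eq_cube)
  with 1 show "sin x \<ge> x / 2" using assms by linarith
  then show "sin x > 0" using assms by linarith
qed

text \<open>
  The bounded function \<open>k\<close> with \<open>k(x) (1 - e^(-ix)) = 1 - (1 - e^(-ix)) / (ix)\<close>. A sequence in \<open>n\<close> that
  behaves locally like \<open>e^(-ixn)\<close>, multiplied by the right-hand side, thus becomes a difference of consecutive terms.
  The poles of the two summands at 0 cancel, so \<open>k\<close> is bounded on \<open>(0, 1]\<close>.
\<close>

definition euler_kernel :: "real \<Rightarrow> complex" where
  "euler_kernel x = 1 / (1 - cis (- x)) - 1 / (\<i> * of_real x)"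

lemma euler_kernel_eq_cot:
  assumes "0 < x" "x \<le> 1"
  shows "euler_kernel x = Complex (1/2) (- (cos (x/2) / sin (x/2) - 1 / (x/2)) / 2)"
    and "1 - cis (- x) \<noteq> 0"
proof -
  define y where "y = x / 2"
  have y: "0 < y" "y \<le> 1" "x = 2 * y" using assms by (auto simp: y_def)
  have s: "sin y > 0" using sin_lower_bounds[OF y(1,2)] by simp
  have e: "1 - cis (- x) = 2 * \<i> * sin y * cis (- y)"
    unfolding y(3) by (auto simp: complex_eq_iff cos_double_sin sin_double power2_eq_square)
  have "cmod (1 - cis (- x)) = 2 * \<bar>sin y\<bar>" unfolding e by (simp add: norm_mult)
  then show ne: "1 - cis (- x) \<noteq> 0" using s by auto
  have "1 / (\<i> * complex_of_real x) = Complex 0 (- 1 / x)"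
    using assms by (simp add: complex_eq_iff Re_divide Im_divide power2_eq_square)
  moreover have "1 / (1 - cis (- x)) = cis y / (2 * \<i> * sin y)"
    unfolding e using s by (simp add: field_simps cis_mult)
  moreover have "\<dots> = Complex (1/2) (- (cos y / sin y) / 2)"
    using s by (simp add: complex_eq_iff Re_divide Im_divide power2_eq_square)
  ultimately show "euler_kernel x = Complex (1/2) (- (cos (x/2) / sin (x/2) - 1 / (x/2)) / 2)"
    unfolding euler_kernel_def by (simp add: y_def complex_eq_iff diff_divide_distrib)
qed

text \<open>
  Up to an additive constant the kernel is a multiple of \<open>cot y - 1/y\<close> with \<open>y = x/2\<close>, whose derivative \<open>1/y^2 - 1/sin^2 y\<close>
  stays bounded because the two poles cancel.
\<close>

lemma euler_kernel_Lipschitz: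
  assumes "x \<in> {0<..1}" "y \<in> {0<..1}"
  shows "norm (euler_kernel x - euler_kernel y) \<le> \<bar>x - y\<bar>"
proof -
  define c where "c x = cos x / sin x - 1 / x" for x :: real
  have 1: "norm (c (x/2) - c (y/2)) \<le> 4/3 * norm (x/2 - y/2)"
  proof (rule field_differentiable_bound[of "{0<..1}"])
    fix z :: real assume z: "z \<in> {0<..1}"
    note sin = sin_lower_bounds[of z]
    have s: "sin z > 0" "z > 0" "sin z \<noteq> 0" "sin z \<le> z" "sin z \<ge> z / 2"
      using z sin sin_x_le_x[of z] by auto
    show "(c has_field_derivative (1 / z^2 - 1 / (sin z)^2)) (at z within {0<..1})"
      unfolding c_def
      by (rule derivative_eq_intros refl | use s in \<open>simp; fail\<close>)+
         (use s sin_cos_squared_add[of z] in \<open>simp add: field_simps power2_eq_square; algebra\<close>)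
    have "\<bar>1 / z^2 - 1 / (sin z)^2\<bar> = ((z - sin z) * (z + sin z)) / (z^2 * (sin z)^2)"
    proof -
      have "(sin z)^2 \<le> z^2" using s by (intro power_mono) auto
      then have "1 / z^2 \<le> 1 / (sin z)^2" using s by (intro divide_left_mono) auto
      then have "\<bar>1 / z^2 - 1 / (sin z)^2\<bar> = 1 / (sin z)^2 - 1 / z^2" by simp
      also have "\<dots> = (z^2 - (sin z)^2) / (z^2 * (sin z)^2)" using s by (simp add: field_simps)
      finally show ?thesis by (simp add: power2_eq_square algebra_simps)
    qed
    also have "\<dots> \<le> ((z^3 / 6) * (2 * z)) / (z^2 * (z/2)^2)"
      using s z sin by (intro frac_le mult_mono power_mono mult_pos_pos) auto
    also have "\<dots> = 4 / 3" using s by (simp add: field_simps power2_eq_square power3_eq_cube)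
    finally show "norm (1 / z^2 - 1 / (sin z)^2) \<le> 4/3" by simp
  qed (use assms in auto)
  have "euler_kernel x - euler_kernel y = Complex 0 (- (c (x/2) - c (y/2)) / 2)"
    using assms by (simp add: euler_kernel_eq_cot c_def complex_eq_iff field_simps)
  then have "norm (euler_kernel x - euler_kernel y) = norm (c (x/2) - c (y/2)) / 2"
    by (simp add: cmod_def)
  also have "\<dots> \<le> (4/3 * norm (x/2 - y/2)) / 2" by (intro divide_right_mono 1) simp
  also have "norm (x/2 - y/2) = \<bar>x - y\<bar> / 2"
    by (metis abs_divide abs_numeral diff_divide_distrib real_norm_def)
  finally show ?thesis by simp
qed

lemma euler_kernel_bound:
  assumes "x \<in> {0<..1}" shows "norm (euler_kernel x) \<le> norm (euler_kernel 1) + 1"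
  using euler_kernel_Lipschitz[OF assms, of 1] norm_triangle_sub[of "euler_kernel x" "euler_kernel 1"] assms by auto

lemma norm_cis_diff_le: "norm (cis x - cis y) \<le> \<bar>x - y\<bar>"
proof -
  have "cis x - cis y = cis y * (exp (\<i> * of_real (x - y)) - 1)"
    by (simp add: cis_conv_exp algebra_simps flip: exp_add)
  then have "norm (cis x - cis y) = 2 * \<bar>sin ((x - y) / 2)\<bar>"
    by (simp only: norm_mult norm_cis dist_exp_i_1 mult_1)
  also have "\<dots> \<le> 2 * \<bar>(x - y) / 2\<bar>" by (intro mult_left_mono abs_sin_x_le_abs_x) auto
  finally show ?thesis by simp
qed

lemma critical_powr:
  assumes "x > 0"
  shows "of_real x powr (- Complex (1/2) t) = of_real (1 / sqrt x) * cis (- t * ln x)"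
proof -
  have "- Complex (1/2) t * of_real (ln x) = of_real (- ln x / 2) + \<i> * of_real (- t * ln x)"
    by (simp add: complex_eq_iff)
  then have "of_real x powr (- Complex (1/2) t) = exp (of_real (- ln x / 2) + \<i> * of_real (- t * ln x))"
    using assms by (simp add: powr_def Ln_of_real)
  also have "\<dots> = of_real (exp (- ln x / 2)) * cis (- t * ln x)"
    by (simp only: exp_add cis_conv_exp exp_of_real)
  also have "exp (- ln x / 2) = 1 / sqrt x"
    using assms by (simp add: exp_minus ln_sqrt[symmetric] inverse_eq_divide)
  finally show ?thesis .
qed

text \<open>
  For \<open>n \<ge> t\<close> the function \<open>x^(-1/2-it)\<close> is on \<open>[n, n + 1]\<close> a pure oscillation of frequency \<open>t/n\<close> up to a relative
  error \<open>O(1/n)\<close>: the modulus varies by \<open>O(1/n)\<close>, and the quadratic term of the phase is at most \<open>t/n^2\<close>.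
\<close>

lemma critical_powr_shift:
  assumes n: "n \<ge> 1" and t: "0 \<le> t" "t \<le> real n" and u: "0 \<le> u" "u \<le> 1"
  defines "s \<equiv> Complex (1/2) t"
  shows "norm (of_real (real n + u) powr (- s) - of_nat n powr (- s) * cis (- (t / n) * u))
           \<le> 2 / (real n * sqrt n)"
proof -
  define v where "v = u / n"
  have v: "0 \<le> v" "v \<le> 1" "v \<le> 1 / n" "real n + u = n * (1 + v)"
    using n u by (auto simp: v_def field_simps)
  have lnv: "ln (real n + u) = ln n + ln (1 + v)"
    unfolding v(4) using n v by (simp add: ln_mult)
  define A where "A = 1 / sqrt (real n + u)"
  define B where "B = 1 / sqrt (real n)"
  have sqrt1: "1 \<le> sqrt (1 + v)" "sqrt (1 + v) \<le> 1 + v"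
    using v by (auto intro: real_le_lsqrt simp: power2_eq_square algebra_simps)
  have AB: "A = B / sqrt (1 + v)" unfolding A_def B_def v(4) by (simp add: real_sqrt_mult)
  have B0: "B > 0" using n by (simp add: B_def)
  have "\<bar>A - B\<bar> \<le> B * v"
  proof -
    have "B - A = B * ((sqrt (1 + v) - 1) / sqrt (1 + v))"
      unfolding AB using sqrt1 by (simp add: field_simps)
    moreover have "0 \<le> (sqrt (1 + v) - 1) / sqrt (1 + v)"
      using sqrt1 by (intro divide_nonneg_nonneg) auto
    moreover have "(sqrt (1 + v) - 1) / sqrt (1 + v) \<le> v / 1"
      using sqrt1 v by (intro frac_le) auto
    then have "B * ((sqrt (1 + v) - 1) / sqrt (1 + v)) \<le> B * v"
      using B0 by (intro mult_left_mono) auto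
    ultimately show ?thesis
      using B0 mult_nonneg_nonneg[of B "(sqrt (1 + v) - 1) / sqrt (1 + v)"] by linarith
  qed
  also have "\<dots> \<le> B * (1 / n)" using v B0 by (intro mult_left_mono) auto
  finally have 1: "\<bar>A - B\<bar> \<le> B / n" by simp
  have "\<bar>- t * ln (real n + u) - (- t * ln n - t / n * u)\<bar> = t * \<bar>ln (1 + v) - v\<bar>"
  proof -
    have "- t * ln (real n + u) - (- t * ln n - t / n * u) = - (t * (ln (1 + v) - v))"
      unfolding lnv v_def by (simp add: algebra_simps)
    then show ?thesis using t by (simp add: abs_mult)
  qed
  also have "\<dots> \<le> n * v^2"
    using abs_ln_one_plus_x_minus_x_bound_nonneg[OF v(1,2)] t by (intro mult_mono) auto
  also have "\<dots> \<le> n * (1 / n)^2" using v by (intro mult_left_mono power_mono) auto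
  also have "\<dots> = 1 / n" using n by (simp add: power2_eq_square)
  finally have 2: "\<bar>- t * ln (real n + u) - (- t * ln n - t / n * u)\<bar> \<le> 1 / n" .
  have "of_real (real n + u) powr (- s) - of_nat n powr (- s) * cis (- (t / n) * u)
      = of_real A * cis (- t * ln (real n + u)) - of_real B * cis (- t * ln n - t / n * u)"
    using critical_powr[of "real n + u" t] critical_powr[of n t] n u
    by (simp add: s_def A_def B_def cis_mult)
  also have "\<dots> = of_real (A - B) * cis (- t * ln (real n + u))
      + of_real B * (cis (- t * ln (real n + u)) - cis (- t * ln n - t / n * u))"
    by (simp add: algebra_simps)
  also have "norm \<dots> \<le> norm (complex_of_real (A - B) * cis (- t * ln (real n + u)))
      + norm (complex_of_real B * (cis (- t * ln (real n + u)) - cis (- t * ln n - t / n * u)))"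
    by (rule norm_triangle_ineq)
  also have "\<dots> = \<bar>A - B\<bar> + B * norm (cis (- t * ln (real n + u)) - cis (- t * ln n - t / n * u))"
    unfolding norm_mult norm_cis norm_of_real using B0 by simp
  also have "\<dots> \<le> B / n + B * (1 / n)"
    using 1 B0 order.trans[OF norm_cis_diff_le 2] by (intro add_mono mult_left_mono) auto
  also have "\<dots> = 2 / (real n * sqrt n)" by (simp add: B_def)
  finally show ?thesis .
qed

lemma norm_critical_powr: "n \<ge> 1 \<Longrightarrow> norm (of_nat n powr (- Complex (1/2) t)) = 1 / sqrt n"
  using critical_powr[of "real n" t] by (simp add: norm_mult norm_divide)

text \<open>
  The steps of \<open>zeta_approx\<close> are only \<open>O(n^(-1/2))\<close> when \<open>n\<close> is comparable to \<open>t\<close>, too large to be summed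
  absolutely. Replacing \<open>x^(-s)\<close> by the oscillation of frequency \<open>\<theta> = t/n\<close> turns the step into
  \<open>n^(-s) k(\<theta>) (1 - e^(-i\<theta>))\<close>, which is the difference of consecutive values of \<open>n^(-s) k(t/n)\<close>
  up to \<open>O(n^(-3/2))\<close>.
\<close>

lemma critical_step_telescopes:
  assumes n: "n \<ge> 1" and t: "0 < t" "t \<le> real n"
  defines "s \<equiv> Complex (1/2) t" and "K \<equiv> norm (euler_kernel 1) + 1"
  defines "b \<equiv> \<lambda>n. of_nat n powr (- s) * euler_kernel (t / real n)"
  shows "norm (zeta_approx (Suc n) s - zeta_approx n s - (b n - b (Suc n))) \<le> (2 * K + 3) / (real n * sqrt n)"
proof -
  define e where "e = 1 / (real n * sqrt n)"
  define \<theta> where "\<theta> = t / n"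
  define \<theta>' where "\<theta>' = t / Suc n"
  have \<theta>: "\<theta> \<in> {0<..1}" "\<theta>' \<in> {0<..1}" using n t by (auto simp: \<theta>_def \<theta>'_def field_simps)
  define a where "a n = of_nat n powr (- s)" for n :: nat
  define k where "k = euler_kernel \<theta>"
  define k' where "k' = euler_kernel \<theta>'"
  define I where "I = zeta_approx (Suc n) s - zeta_approx n s"
  have e: "e \<ge> 0" by (simp add: e_def)
  have s1: "s \<noteq> 1" using t by (auto simp: s_def complex_eq_iff)
  have cis: "((\<lambda>u. cis (- \<theta> * u)) has_integral (1 - cis (- \<theta>)) / (\<i> * \<theta>)) {0..1}"
  proof -
    have "((\<lambda>u. cis (- \<theta> * u)) has_integral
        (cis (- \<theta> * 1) / (- \<i> * \<theta>) - cis (- \<theta> * 0) / (- \<i> * \<theta>))) {0..1}"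
    proof (rule fundamental_theorem_of_calculus)
      fix u :: real
      have "((\<lambda>z. exp (- \<i> * \<theta> * z) / (- \<i> * \<theta>)) has_field_derivative exp (- \<i> * \<theta> * u)) (at (of_real u))"
        using \<theta> by (auto intro!: derivative_eq_intros)
      from has_vector_derivative_real_field[OF this]
      show "((\<lambda>u. cis (- \<theta> * u) / (- \<i> * \<theta>)) has_vector_derivative cis (- \<theta> * u)) (at u within {0..1})"
        by (simp add: cis_conv_exp mult_ac)
    qed simp
    then show ?thesis by (simp add: diff_divide_distrib)
  qed
  have "((\<lambda>u. a n - a n * cis (- \<theta> * u)) has_integral (a n - a n * ((1 - cis (- \<theta>)) / (\<i> * \<theta>)))) {0..1}"
    using has_integral_diff[OF has_integral_const_real[of "a n" 0 1] has_integral_mult_right[OF cis, of "a n"]]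
    by simp
  also have "a n - a n * ((1 - cis (- \<theta>)) / (\<i> * \<theta>)) = a n * k * (1 - cis (- \<theta>))"
    using euler_kernel_eq_cot(2)[of \<theta>] \<theta> by (simp add: k_def euler_kernel_def field_simps)
  finally have main: "((\<lambda>u. a n - a n * cis (- \<theta> * u)) has_integral (a n * k * (1 - cis (- \<theta>)))) {0..1}" .
  have "((\<lambda>u. a n - of_real (real n + u) powr (- s)) has_integral I) {0..1}"
    using zeta_approx_step_has_integral[OF n s1] by (simp add: a_def I_def)
  from has_integral_diff[OF this main]
  have "((\<lambda>u. a n * cis (- \<theta> * u) - of_real (real n + u) powr (- s)) has_integral
      (I - a n * k * (1 - cis (- \<theta>)))) (cbox 0 (1::real))"
    by (simp add: cbox_interval)
  then have "norm (I - a n * k * (1 - cis (- \<theta>))) \<le> (2 * e) * measure lborel (cbox 0 (1::real))"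
  proof (rule has_integral_bound[rotated])
    fix u :: real assume "u \<in> cbox 0 1"
    then show "norm (a n * cis (- \<theta> * u) - of_real (real n + u) powr (- s)) \<le> 2 * e"
      using critical_powr_shift[OF n, of t u] t
      by (auto simp: a_def \<theta>_def e_def s_def norm_minus_commute)
  qed (use e in auto)
  then have 1: "norm (I - a n * k * (1 - cis (- \<theta>))) \<le> 2 * e" by simp
  have "norm (a (Suc n) - a n * cis (- \<theta>)) \<le> 2 * e"
    using critical_powr_shift[OF n, of t 1] t by (simp add: a_def \<theta>_def e_def s_def add.commute)
  moreover have K: "norm k \<le> K" unfolding k_def K_def by (rule euler_kernel_bound[OF \<theta>(1)])
  ultimately have 2: "norm (k * (a (Suc n) - a n * cis (- \<theta>))) \<le> K * (2 * e)"
    unfolding norm_mult by (intro mult_mono) (auto simp: K_def)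
  have 3: "norm (a (Suc n) * (k' - k)) \<le> e"
  proof -
    have "\<bar>\<theta>' - \<theta>\<bar> = t / (real n * (real n + 1))"
      using n t by (subst abs_minus_commute, subst abs_of_nonneg) (simp_all add: \<theta>_def \<theta>'_def field_simps)
    also have "\<dots> \<le> real n / (real n * real n)"
      using n t by (intro frac_le) auto
    finally have "norm (k' - k) \<le> 1 / n"
      unfolding k_def k'_def using order.trans[OF euler_kernel_Lipschitz[OF \<theta>(2,1)]] n by simp
    moreover have "norm (a (Suc n)) \<le> 1 / sqrt n"
      unfolding a_def s_def using n by (subst norm_critical_powr) (auto intro!: frac_le)
    ultimately have "norm (a (Suc n) * (k' - k)) \<le> (1 / sqrt n) * (1 / n)"
      unfolding norm_mult by (intro mult_mono) auto
    then show ?thesis by (simp add: e_def mult.commute)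
  qed
  have "I - (b n - b (Suc n)) = (I - a n * k * (1 - cis (- \<theta>))) + k * (a (Suc n) - a n * cis (- \<theta>))
      + a (Suc n) * (k' - k)"
    by (simp add: b_def a_def k_def k'_def \<theta>_def \<theta>'_def algebra_simps)
  also have "norm \<dots> \<le> 2 * e + K * (2 * e) + e"
    by (intro norm_triangle_mono 1 2 3)
  also have "\<dots> = (2 * K + 3) * e" by (simp add: algebra_simps)
  also have "\<dots> = (2 * K + 3) / (real n * sqrt n)" by (simp add: e_def)
  finally show ?thesis by (simp add: I_def)
qed

lemma inverse_sqrt_step:
  assumes "n \<ge> 1" shows "1 / (real n * sqrt n) \<le> 4 * (1 / sqrt n - 1 / sqrt (Suc n))"
proof -
  define x where "x = sqrt n"
  define y where "y = sqrt (Suc n)"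
  have x: "x \<ge> 1" "y > 0" "real n = x * x" using assms by (simp_all add: x_def y_def)
  have yy: "y * y = x * x + 1" using x(3) by (simp add: y_def)
  have "1 * 1 \<le> x * x" using x by (intro mult_mono) auto
  have "y \<le> 3/2 * x"
  proof (rule power2_le_imp_le)
    show "y\<^sup>2 \<le> (3/2 * x)\<^sup>2"
      using \<open>1 * 1 \<le> x * x\<close> yy unfolding power2_eq_square by linarith
  qed (use x in auto)
  then have "x * y * (x + y) \<le> x * (3/2 * x) * (x + 3/2 * x)"
    using x by (intro mult_mono add_mono) auto
  also have "\<dots> = 15/4 * (x * x * x)" by simp
  also have "\<dots> \<le> 4 * (x * x * x)" using x by (intro mult_right_mono) auto
  finally have le: "x * y * (x + y) \<le> 4 * (x * x * x)" .
  have pos: "x * y * (x + y) > 0" using x by (intro mult_pos_pos) auto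
  have "1 / x - 1 / y = (y - x) / (x * y)"
    using x by (simp add: field_simps)
  also have "\<dots> = ((y - x) * (x + y)) / (x * y * (x + y))"
    using x by simp
  also have "(y - x) * (x + y) = 1" using yy by (simp add: algebra_simps)
  finally have "1 / x - 1 / y = 1 / (x * y * (x + y))" .
  moreover have "1 / (x * x * x) \<le> 4 / (x * y * (x + y))"
  proof -
    have "4 / (4 * (x * x * x)) \<le> 4 / (x * y * (x + y))"
      by (rule divide_left_mono[OF le]) (use pos x in auto)
    then show ?thesis by simp
  qed
  ultimately show ?thesis using x(3) unfolding x_def[symmetric] y_def[symmetric] by simp
qed

lemma zeta_approx_error_of_telescope:
  assumes N: "N \<ge> 1" and s: "s \<in> zeta_domain" and C: "C \<ge> 0" and K: "K \<ge> 0"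
    and b: "\<And>n. n \<ge> N \<Longrightarrow> norm (b n) \<le> K / sqrt n"
    and step: "\<And>n. n \<ge> N \<Longrightarrow>
      norm (zeta_approx (Suc n) s - zeta_approx n s - (b n - b (Suc n))) \<le> C / (real n * sqrt n)"
  shows "norm (riemann_zeta s - zeta_approx N s) \<le> (4 * C + 2 * K) / sqrt N"
proof -
  have tele: "norm (zeta_approx M s - zeta_approx N s - (b N - b M)) \<le> 4 * C * (1 / sqrt N - 1 / sqrt M)"
    if "M \<ge> N" for M
    using that
  proof (induction M rule: dec_induct)
    case (step n)
    have "C * (1 / (real n * sqrt n)) \<le> C * (4 * (1 / sqrt n - 1 / sqrt (Suc n)))"
      using step.hyps N C by (intro mult_left_mono inverse_sqrt_step) auto
    then have "norm (zeta_approx (Suc n) s - zeta_approx n s - (b n - b (Suc n)))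
        \<le> C * (4 * (1 / sqrt n - 1 / sqrt (Suc n)))"
      using assms(6)[OF step.hyps(1)] by simp
    with step.IH have "norm ((zeta_approx n s - zeta_approx N s - (b N - b n))
        + (zeta_approx (Suc n) s - zeta_approx n s - (b n - b (Suc n))))
        \<le> 4 * C * (1 / sqrt N - 1 / sqrt n) + C * (4 * (1 / sqrt n - 1 / sqrt (Suc n)))"
      by (intro norm_triangle_mono)
    then show ?case by (simp add: algebra_simps)
  qed simp
  have bound: "norm (zeta_approx M s - zeta_approx N s) \<le> (4 * C + 2 * K) / sqrt N" if M: "M \<ge> N" for M
  proof -
    have "norm (zeta_approx M s - zeta_approx N s)
        \<le> norm (zeta_approx M s - zeta_approx N s - (b N - b M)) + norm (b N - b M)"
      using norm_triangle_ineq[of "zeta_approx M s - zeta_approx N s - (b N - b M)" "b N - b M"] by simp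
    also have "\<dots> \<le> 4 * C * (1 / sqrt N) + (K / sqrt N + K / sqrt N)"
    proof (intro add_mono order.trans[OF tele[OF M]] order.trans[OF norm_triangle_ineq4] b)
      show "4 * C * (1 / sqrt N - 1 / sqrt M) \<le> 4 * C * (1 / sqrt N)"
        using C by (intro mult_left_mono) auto
      show "norm (b M) \<le> K / sqrt N"
        using b[OF M] M N K by (rule_tac order.trans[OF _ divide_left_mono[of "sqrt N" "sqrt M" K]]) auto
    qed auto
    finally show ?thesis by (simp add: add_divide_distrib)
  qed
  have "(\<lambda>M. norm (zeta_approx M s - zeta_approx N s)) \<longlonglongrightarrow> norm (riemann_zeta s - zeta_approx N s)"
    by (intro tendsto_intros zeta_approx_tendsto s)
  then show ?thesis
    by (rule tendsto_upperbound) (use bound in \<open>auto simp: eventually_sequentially\<close>)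
qed

lemma critical_line_in_zeta_domain: "Complex (1/2) t \<in> zeta_domain"
  by (simp add: zeta_domain_def complex_eq_iff)

text \<open>
  An approximation of Hardy-Littlewood type: the error is as small as a single term of the sum
  already when the length \<open>N\<close> reaches the height \<open>t\<close>. At height 0 the frequency vanishes and the trivial bound of the steps is summable.
\<close>

lemma zeta_approx_error:
  obtains C where "C > 0"
    "\<And>N t. N \<ge> 1 \<Longrightarrow> 0 \<le> t \<Longrightarrow> t \<le> real N \<Longrightarrow>
       norm (riemann_zeta (Complex (1/2) t) - zeta_approx N (Complex (1/2) t)) \<le> C / sqrt N"
proof -
  define K where "K = norm (euler_kernel 1) + 1"
  have K: "K \<ge> 1" by (simp add: K_def)
  define C where "C = 4 * (2 * K + 3) + 2 * K"
  have "norm (riemann_zeta (Complex (1/2) t) - zeta_approx N (Complex (1/2) t)) \<le> C / sqrt N"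
    if N: "N \<ge> 1" and t: "0 \<le> t" "t \<le> real N" for N t
  proof (cases "t = 0")
    case False
    then have t': "0 < t" using t by simp
    show ?thesis unfolding C_def
    proof (rule zeta_approx_error_of_telescope[OF N critical_line_in_zeta_domain])
      fix n assume n: "n \<ge> N"
      show "norm (of_nat n powr (- Complex (1/2) t) * euler_kernel (t / real n)) \<le> K / sqrt n"
        using euler_kernel_bound[of "t / n"] n N t t'
        by (simp add: norm_mult norm_critical_powr K_def divide_simps)
      show "norm (zeta_approx (Suc n) (Complex (1/2) t) - zeta_approx n (Complex (1/2) t)
          - (of_nat n powr (- Complex (1/2) t) * euler_kernel (t / real n)
             - of_nat (Suc n) powr (- Complex (1/2) t) * euler_kernel (t / real (Suc n))))
        \<le> (2 * K + 3) / (real n * sqrt n)"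
        unfolding K_def using n N t' t by (intro critical_step_telescopes) auto
    qed (use K in auto)
  next
    case True
    show ?thesis unfolding C_def
    proof (rule zeta_approx_error_of_telescope[OF N critical_line_in_zeta_domain, where b = "\<lambda>_. 0"])
      fix n assume n: "n \<ge> N"
      have "real n powr (- (3/2)) = 1 / (real n * sqrt n)"
        using n N powr_add[of "real n" 1 "1/2"] by (simp add: powr_minus_divide powr_half_sqrt)
      moreover have "norm (Complex (1/2) t) = 1/2"
        by (simp add: True cmod_def power2_eq_square real_sqrt_divide)
      moreover have "norm (zeta_approx (Suc n) (Complex (1/2) t) - zeta_approx n (Complex (1/2) t))
          \<le> norm (Complex (1/2) t) * real n powr (- (3/2))"
        using zeta_approx_step_bound[of n "Complex (1/2) t"] n N by (simp add: complex_eq_iff)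
      ultimately have "norm (zeta_approx (Suc n) (Complex (1/2) t) - zeta_approx n (Complex (1/2) t))
          \<le> (1/2) * (1 / (real n * sqrt n))"
        by metis
      also have "\<dots> = (1/2) / (real n * sqrt n)" by simp
      also have "\<dots> \<le> (2 * K + 3) / (real n * sqrt n)"
        using K by (intro divide_right_mono) auto
      finally show "norm (zeta_approx (Suc n) (Complex (1/2) t) - zeta_approx n (Complex (1/2) t) - (0 - 0))
          \<le> (2 * K + 3) / (real n * sqrt n)" by simp
    qed (use K in auto)
  qed
  moreover have "C > 0" using K by (simp add: C_def)
  ultimately show ?thesis using that by blast
qed

section \<open>Mean square of a Dirichlet polynomial with a Fejer weight\<close>

definition zeta_sq :: "real \<Rightarrow> real" where
  "zeta_sq t = (cmod (riemann_zeta (Complex (1/2) t)))\<^sup>2"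

definition dirichlet_sq :: "nat \<Rightarrow> real \<Rightarrow> real" where
  "dirichlet_sq N t = (cmod (\<Sum>n=1..<N. of_nat n powr (- Complex (1/2) t)))\<^sup>2"

lemma dirichlet_sq_expand:
  "dirichlet_sq N t = (\<Sum>m=1..<N. \<Sum>n=1..<N. 1 / (sqrt (real m) * sqrt (real n)) * cos ((ln (real m) - ln (real n)) * t))"
proof -
  define z where "z n = of_nat n powr (- Complex (1/2) t)" for n :: nat
  have z: "z n = of_real (1 / sqrt n) * cis (- t * ln n)" if "n \<ge> 1" for n
    using critical_powr[of "real n" t] that by (simp add: z_def)
  have "complex_of_real (dirichlet_sq N t) = (\<Sum>m=1..<N. z m) * cnj (\<Sum>n=1..<N. z n)"
    unfolding dirichlet_sq_def z_def[symmetric] by (rule complex_norm_square)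
  also have "\<dots> = (\<Sum>m=1..<N. \<Sum>n=1..<N. z m * cnj (z n))"
    by (simp only: cnj_sum sum_product)
  finally have "dirichlet_sq N t = Re (\<Sum>m=1..<N. \<Sum>n=1..<N. z m * cnj (z n))"
    by (metis Re_complex_of_real)
  also have "\<dots> = (\<Sum>m=1..<N. \<Sum>n=1..<N. Re (z m * cnj (z n)))" by simp
  also have "\<dots> = (\<Sum>m=1..<N. \<Sum>n=1..<N. 1 / (sqrt (real m) * sqrt (real n)) * cos ((ln (real m) - ln (real n)) * t))"
  proof (intro sum.cong refl)
    fix m n assume mn: "m \<in> {1..<N}" "n \<in> {1..<N}"
    then have "z m * cnj (z n) = of_real (1 / (sqrt m * sqrt n)) * (cis (- t * ln m) * cnj (cis (- t * ln n)))"
      by (simp add: z)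
    also have "cis (- t * ln m) * cnj (cis (- t * ln n)) = cis (- ((ln m - ln n) * t))"
      by (simp add: cis_cnj cis_mult algebra_simps)
    finally show "Re (z m * cnj (z n)) = 1 / (sqrt m * sqrt n) * cos ((ln m - ln n) * t)"
      by (simp add: cis.code)
  qed
  finally show ?thesis .
qed

text \<open>
  The weight \<open>T - t\<close> vanishes at the upper endpoint, so a frequency \<open>b\<close> contributes \<open>O(1/b^2)\<close> instead of
  the \<open>O(1/b)\<close> of a sharp cutoff.
\<close>

lemma fejer_cos_has_integral:
  fixes T b :: real
  assumes "T \<ge> 0"
  shows "((\<lambda>t. (T - t) * cos (b * t)) has_integral
           (if b = 0 then T\<^sup>2 / 2 else (1 - cos (b * T)) / b\<^sup>2)) {0..T}"
proof (cases "b = 0")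
  case True
  have "((\<lambda>t. T - t) has_integral ((T * T - T\<^sup>2 / 2) - (T * 0 - 0\<^sup>2 / 2))) {0..T}"
    using assms by (intro fundamental_theorem_of_calculus)
      (auto intro!: derivative_eq_intros simp flip: has_real_derivative_iff_has_vector_derivative)
  then show ?thesis using True by (simp add: power2_eq_square)
next
  case False
  have "((\<lambda>t. (T - t) * cos (b * t)) has_integral
      (((T - T) * sin (b * T) / b - cos (b * T) / b\<^sup>2) - ((T - 0) * sin (b * 0) / b - cos (b * 0) / b\<^sup>2))) {0..T}"
    using assms False by (intro fundamental_theorem_of_calculus)
      (auto intro!: derivative_eq_intros simp: field_simps power2_eq_square
        simp flip: has_real_derivative_iff_has_vector_derivative)
  then show ?thesis using False by (simp add: diff_divide_distrib)
qed

lemma sum_inverse_three_halves: "N \<ge> 1 \<Longrightarrow> (\<Sum>r=1..<N. 1 / (real r * sqrt r)) \<le> 4 * (1 - 1 / sqrt N)"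
proof (induction N rule: dec_induct)
  case (step n)
  then show ?case using inverse_sqrt_step[of n] by (simp add: algebra_simps)
qed simp

lemma sum_distance_le:
  fixes g :: "nat \<Rightarrow> real"
  assumes "\<And>r. g r \<ge> 0" "m < N"
  shows "(\<Sum>n\<in>{1..<N} - {m}. g (if n < m then m - n else n - m)) \<le> 2 * (\<Sum>r=1..<N. g r)"
proof -
  have "(\<Sum>n\<in>{1..<N} - {m}. g (if n < m then m - n else n - m)) \<le>
      (\<Sum>n\<in>{1..<m} \<union> {m<..<N}. g (if n < m then m - n else n - m))"
    using assms by (intro sum_mono2) auto
  also have "\<dots> = (\<Sum>n\<in>{1..<m}. g (m - n)) + (\<Sum>n\<in>{m<..<N}. g (n - m))"
    by (subst sum.union_disjoint) auto
  also have "(\<Sum>n\<in>{1..<m}. g (m - n)) = (\<Sum>r\<in>{1..<m}. g r)"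
    by (rule sum.reindex_bij_witness[of _ "\<lambda>r. m - r" "\<lambda>r. m - r"]) auto
  also have "(\<Sum>n\<in>{m<..<N}. g (n - m)) = (\<Sum>r\<in>{1..<N-m}. g r)"
    by (rule sum.reindex_bij_witness[of _ "\<lambda>r. r + m" "\<lambda>r. r - m"]) auto
  also have "(\<Sum>r\<in>{1..<m}. g r) + (\<Sum>r\<in>{1..<N-m}. g r) \<le> (\<Sum>r\<in>{1..<N}. g r) + (\<Sum>r\<in>{1..<N}. g r)"
    using assms by (intro add_mono sum_mono2) auto
  finally show ?thesis by simp
qed

text \<open>
  With \<open>r = n - m\<close> one has \<open>ln n - ln m \<ge> r/n\<close> and \<open>n/m \<le> 1 + r \<le> 4r\<close>. The second inequality treats close and
  distant pairs alike and leaves the summable factor \<open>r^(-3/2)\<close>.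
\<close>

lemma off_diagonal_term_bound:
  fixes m n N :: nat
  assumes "m \<ge> 1" "m < n" "n \<le> N"
  shows "1 / (sqrt m * sqrt n) * (1 / (ln m - ln n)\<^sup>2) \<le> 2 * real N * (1 / (real (n - m) * sqrt (n - m)))"
proof -
  define r where "r = real (n - m)"
  have r: "r \<ge> 1" "real n = m + r" using assms by (auto simp: r_def)
  have m: "real m \<ge> 1" using assms by simp
  have l: "ln n - ln m \<ge> r / n"
  proof -
    have "ln (real m / real n) \<le> real m / real n - 1" by (rule ln_le_minus_one) (use assms in auto)
    also have "ln (real m / real n) = ln m - ln n" using assms by (simp add: ln_div)
    also have "real m / real n - 1 = - (r / n)" using assms r(2) by (simp add: field_simps)
    finally show ?thesis by linarith
  qed
  have "(r / n)\<^sup>2 \<le> (ln n - ln m)\<^sup>2" using l r by (intro power_mono) auto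
  then have "1 / (ln m - ln n)\<^sup>2 \<le> 1 / (r / n)\<^sup>2"
    using r assms by (subst power2_commute, intro divide_left_mono mult_pos_pos) auto
  then have 1: "1 / (ln m - ln n)\<^sup>2 \<le> (real n)\<^sup>2 / r\<^sup>2" by (simp add: power_divide)
  have "real n \<le> m * (4 * r)" 
  proof -
    have "real m * 1 \<le> real m * r" "1 * r \<le> real m * r" using m r by (intro mult_mono; simp)+
    moreover have "real m * (4 * r) = 4 * (real m * r)" by simp
    ultimately show ?thesis using r(2) m r(1) by linarith
  qed
  then have "sqrt n \<le> sqrt (m * (4 * r))" by (rule real_sqrt_le_mono)
  then have sq: "sqrt n \<le> sqrt m * (2 * sqrt r)" by (simp add: real_sqrt_mult)
  have "1 / (x * y) = y / (x * (y * y))" if "y \<noteq> 0" for x y :: real using that by simp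
  from this[of "sqrt n" "sqrt m"]
  have "1 / (sqrt m * sqrt n) = sqrt n / (sqrt m * (sqrt n * sqrt n))" using assms by simp
  also have "\<dots> = sqrt n / (sqrt m * n)" by simp
  also have "\<dots> \<le> (sqrt m * (2 * sqrt r)) / (sqrt m * n)" by (intro divide_right_mono sq) simp
  also have "\<dots> = (2 * sqrt r) / n" using assms by simp
  finally have 2: "1 / (sqrt m * sqrt n) \<le> (2 * sqrt r) / n" .
  have "1 / (sqrt m * sqrt n) * (1 / (ln m - ln n)\<^sup>2) \<le> (2 * sqrt r) / n * ((real n)\<^sup>2 / r\<^sup>2)"
    using r by (intro mult_mono 1 2) auto
  also have "\<dots> = 2 * real n * (1 / (r * sqrt r))"
  proof -
    define x where "x = sqrt r"
    have x: "x > 0" "r = x * x" using r by (simp_all add: x_def)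
    have "real n > 0" using assms by simp
    then show ?thesis
      unfolding x_def[symmetric] using x by (simp add: divide_simps power2_eq_square)
  qed
  also have "\<dots> \<le> 2 * real N * (1 / (r * sqrt r))"
    using assms r by (intro mult_right_mono) auto
  finally show ?thesis using assms by (simp add: r_def)
qed

lemma off_diagonal_row_bound:
  fixes m N :: nat
  assumes m: "m \<in> {1..<N}"
  shows "(\<Sum>n\<in>{1..<N} - {m}. 1 / (sqrt m * sqrt n) * (1 / (ln m - ln n)\<^sup>2)) \<le> 16 * real N"
proof -
  define g where "g r = 1 / (real r * sqrt r)" for r :: nat
  have "(\<Sum>n\<in>{1..<N} - {m}. 1 / (sqrt m * sqrt n) * (1 / (ln m - ln n)\<^sup>2))
      \<le> (\<Sum>n\<in>{1..<N} - {m}. 2 * real N * g (if n < m then m - n else n - m))"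
  proof (rule sum_mono)
    fix n assume n: "n \<in> {1..<N} - {m}"
    show "1 / (sqrt m * sqrt n) * (1 / (ln m - ln n)\<^sup>2) \<le> 2 * real N * g (if n < m then m - n else n - m)"
    proof (cases "n < m")
      case True
      then show ?thesis
        using off_diagonal_term_bound[of n m N] n m by (simp add: g_def mult.commute power2_commute)
    next
      case False
      then show ?thesis using off_diagonal_term_bound[of m n N] n m by (simp add: g_def)
    qed
  qed
  also have "\<dots> = 2 * real N * (\<Sum>n\<in>{1..<N} - {m}. g (if n < m then m - n else n - m))"
    by (simp add: sum_distrib_left)
  also have "\<dots> \<le> 2 * real N * (2 * (\<Sum>r=1..<N. g r))"
    using m by (intro mult_left_mono sum_distance_le) (auto simp: g_def)
  also have "\<dots> \<le> 2 * real N * (2 * 4)"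
  proof (intro mult_left_mono)
    have "4 * (1 - 1 / sqrt N) \<le> 4" by simp
    then show "(\<Sum>r=1..<N. g r) \<le> 4"
      using sum_inverse_three_halves[of N] m unfolding g_def by (auto intro: order.trans)
  qed auto
  finally show ?thesis by simp
qed

lemma harmonic_bounds:
  assumes "N \<ge> 1"
  shows "ln N \<le> (\<Sum>n=1..<N. 1 / real n)" "(\<Sum>n=1..<N. 1 / real n) \<le> 1 + ln N"
proof -
  show "ln N \<le> (\<Sum>n=1..<N. 1 / real n)" using assms
  proof (induction N rule: dec_induct)
    case (step n)
    have "ln (real (Suc n) / real n) \<le> real (Suc n) / real n - 1"
      using step by (intro ln_le_minus_one) auto
    then have "ln (Suc n) \<le> ln n + 1 / real n"
      using step by (simp add: ln_div field_simps)
    then show ?case using step by simp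
  qed simp
  have "(\<Sum>n=1..<Suc N. 1 / real n) \<le> 1 + ln N" using assms
  proof (induction N rule: dec_induct)
    case (step n)
    have "ln (real n / real (Suc n)) \<le> real n / real (Suc n) - 1"
      using step by (intro ln_le_minus_one) auto
    then have "1 / real (Suc n) \<le> ln (Suc n) - ln n"
      using step by (simp add: ln_div field_simps)
    then show ?case using step by simp
  qed simp
  moreover have "(\<Sum>n=1..<N. 1 / real n) \<le> (\<Sum>n=1..<Suc N. 1 / real n)" by (intro sum_mono2) auto
  ultimately show "(\<Sum>n=1..<N. 1 / real n) \<le> 1 + ln N" by linarith
qed

text \<open>
  Every off-diagonal integral is nonnegative, which makes the lower bound immediate. In the upper bound
  each of the fewer than \<open>N\<close> rows contributes \<open>O(N)\<close>.
\<close>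

lemma fejer_dirichlet:
  fixes T :: real
  assumes N: "N \<ge> 1" and T: "T \<ge> 0"
  obtains J where "((\<lambda>t. (T - t) * dirichlet_sq N t) has_integral J) {0..T}"
    "T\<^sup>2 / 2 * ln N \<le> J" "J \<le> T\<^sup>2 / 2 * (1 + ln N) + 32 * (real N)\<^sup>2"
proof -
  define c where "c m n = (if ln m - ln n = 0 then T\<^sup>2 / 2
     else (1 - cos ((ln m - ln n) * T)) / (ln m - ln n)\<^sup>2)" for m n :: nat
  define q where "q m n = 1 / (sqrt m * sqrt n)" for m n :: nat
  define J where "J = (\<Sum>m=1..<N. \<Sum>n=1..<N. q m n * c m n)"
  have "((\<lambda>t. \<Sum>m=1..<N. \<Sum>n=1..<N. q m n * ((T - t) * cos ((ln m - ln n) * t))) has_integral J) {0..T}"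
    unfolding J_def c_def
    by (intro has_integral_sum has_integral_mult_right fejer_cos_has_integral T) auto
  moreover have "(T - t) * dirichlet_sq N t
      = (\<Sum>m=1..<N. \<Sum>n=1..<N. q m n * ((T - t) * cos ((ln m - ln n) * t)))" for t
    unfolding dirichlet_sq_expand sum_distrib_left by (intro sum.cong refl) (simp add: q_def)
  ultimately have int: "((\<lambda>t. (T - t) * dirichlet_sq N t) has_integral J) {0..T}" by simp
  define off where "off = (\<Sum>m=1..<N. \<Sum>n\<in>{1..<N} - {m}. q m n * c m n)"
  have "J = (\<Sum>m=1..<N. q m m * c m m + (\<Sum>n\<in>{1..<N} - {m}. q m n * c m n))"
    unfolding J_def by (intro sum.cong refl sum.remove) auto
  also have "\<dots> = (\<Sum>m=1..<N. q m m * c m m) + off" unfolding off_def by (rule sum.distrib)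
  also have "(\<Sum>m=1..<N. q m m * c m m) = T\<^sup>2 / 2 * (\<Sum>n=1..<N. 1 / real n)"
    by (simp add: sum_distrib_left q_def c_def mult.commute)
  finally have J: "J = T\<^sup>2 / 2 * (\<Sum>n=1..<N. 1 / real n) + off" .
  have "off \<ge> 0"
    unfolding off_def by (intro sum_nonneg mult_nonneg_nonneg) (auto simp: q_def c_def)
  have "off \<le> (\<Sum>m=1..<N. 2 * (16 * real N))"
    unfolding off_def
  proof (rule sum_mono)
    fix m assume m: "m \<in> {1..<N}"
    have "(\<Sum>n\<in>{1..<N} - {m}. q m n * c m n)
        \<le> (\<Sum>n\<in>{1..<N} - {m}. 2 * (1 / (sqrt m * sqrt n) * (1 / (ln m - ln n)\<^sup>2)))"
    proof (rule sum_mono)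
      fix n assume n: "n \<in> {1..<N} - {m}"
      then have "ln (real m) - ln (real n) \<noteq> 0" using m by auto
      moreover have "1 - cos x \<le> 2" for x :: real using cos_ge_minus_one[of x] by linarith
      ultimately have "c m n \<le> 2 / (ln m - ln n)\<^sup>2"
        unfolding c_def by (auto intro!: divide_right_mono)
      then have "q m n * c m n \<le> q m n * (2 / (ln m - ln n)\<^sup>2)"
        by (intro mult_left_mono) (auto simp: q_def)
      then show "q m n * c m n \<le> 2 * (1 / (sqrt m * sqrt n) * (1 / (ln m - ln n)\<^sup>2))"
        by (simp add: q_def)
    qed
    also have "\<dots> = 2 * (\<Sum>n\<in>{1..<N} - {m}. 1 / (sqrt m * sqrt n) * (1 / (ln m - ln n)\<^sup>2))"
      by (rule sum_distrib_left[symmetric])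
    also have "\<dots> \<le> 2 * (16 * real N)"
      by (intro mult_left_mono off_diagonal_row_bound m) auto
    finally show "(\<Sum>n\<in>{1..<N} - {m}. q m n * c m n) \<le> 2 * (16 * real N)" .
  qed
  also have "\<dots> \<le> 32 * (real N)\<^sup>2" using N by (simp add: power2_eq_square)
  finally have off: "off \<le> 32 * (real N)\<^sup>2" .
  have T2: "T\<^sup>2 / 2 \<ge> 0" by simp
  show ?thesis
  proof (rule that[OF int])
    show "T\<^sup>2 / 2 * ln N \<le> J"
      unfolding J using \<open>off \<ge> 0\<close> mult_left_mono[OF harmonic_bounds(1)[OF N] T2] by linarith
    show "J \<le> T\<^sup>2 / 2 * (1 + ln N) + 32 * (real N)\<^sup>2"
      unfolding J using off mult_left_mono[OF harmonic_bounds(2)[OF N] T2] by linarith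
  qed
qed

section \<open>Mean square of the zeta-function\<close>

lemma continuous_on_zeta_sq: "continuous_on S zeta_sq"
proof -
  have "continuous_on zeta_domain riemann_zeta"
    by (intro holomorphic_on_imp_continuous_on riemann_zeta_holomorphic)
  moreover have "continuous_on S (\<lambda>t. Complex (1/2) t)"
    unfolding Complex_eq by (intro continuous_intros)
  ultimately have "continuous_on S (\<lambda>t. riemann_zeta (Complex (1/2) t))"
    by (rule continuous_on_compose2) (use critical_line_in_zeta_domain in blast)
  then show ?thesis unfolding zeta_sq_def[abs_def] by (intro continuous_on_power continuous_on_norm)
qed

lemma zeta_sq_nonneg [simp]: "zeta_sq t \<ge> 0"
  by (simp add: zeta_sq_def)

text \<open>
  Used in place of the Cauchy-Schwarz inequality for integrals: the cross term is absorbed at the price of a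
  factor \<open>1 + \<epsilon>\<close>, where \<open>\<epsilon>\<close> may depend on \<open>T\<close>.
\<close>

lemma power2_norm_add_le:
  fixes x y :: "'a::real_normed_vector"
  assumes "\<epsilon> > 0"
  shows "(norm (x + y))\<^sup>2 \<le> (1 + \<epsilon>) * (norm x)\<^sup>2 + (1 + 1 / \<epsilon>) * (norm y)\<^sup>2"
proof -
  define p q where "p = norm x" and "q = norm y"
  define r where "r = sqrt \<epsilon>"
  have r: "r > 0" "\<epsilon> = r\<^sup>2" using assms by (auto simp: r_def)
  have "(norm (x + y))\<^sup>2 \<le> (p + q)\<^sup>2"
    unfolding p_def q_def by (intro power_mono norm_triangle_ineq norm_ge_zero)
  also have "\<dots> = (1 + \<epsilon>) * p\<^sup>2 + (1 + 1 / \<epsilon>) * q\<^sup>2 - (r * p - q / r)\<^sup>2"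
    using r by (simp add: power2_eq_square field_simps)
  also have "\<dots> \<le> (1 + \<epsilon>) * p\<^sup>2 + (1 + 1 / \<epsilon>) * q\<^sup>2" by simp
  finally show ?thesis unfolding p_def q_def .
qed

lemma zeta_minus_dirichlet_bound:
  obtains C where "C > 0" "\<And>N t. N \<ge> 1 \<Longrightarrow> 0 \<le> t \<Longrightarrow> t \<le> real N \<Longrightarrow>
    (cmod (riemann_zeta (Complex (1/2) t) - (\<Sum>n=1..<N. of_nat n powr (- Complex (1/2) t))))\<^sup>2
      \<le> 8 * real N / (1 + t\<^sup>2) + C / real N"
proof -
  obtain C where C: "C > 0" "\<And>N t. N \<ge> 1 \<Longrightarrow> 0 \<le> t \<Longrightarrow> t \<le> real N \<Longrightarrow>
       norm (riemann_zeta (Complex (1/2) t) - zeta_approx N (Complex (1/2) t)) \<le> C / sqrt N"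
    by (fact zeta_approx_error)
  have "(cmod (riemann_zeta (Complex (1/2) t) - (\<Sum>n=1..<N. of_nat n powr (- Complex (1/2) t))))\<^sup>2
      \<le> 8 * real N / (1 + t\<^sup>2) + 2 * C\<^sup>2 / real N" if N: "N \<ge> 1" and t: "0 \<le> t" "t \<le> real N" for N t
  proof -
    define s where "s = Complex (1/2) t"
    define P where "P = of_nat N powr (1 - s) / (s - 1)"
    have "cmod P = sqrt N / cmod (s - 1)"
      using norm_of_real_powr[of N "1 - s"] N by (simp add: P_def norm_divide s_def powr_half_sqrt)
    then have "(cmod P)\<^sup>2 = N / (cmod (s - 1))\<^sup>2" by (simp add: power_divide)
    also have "(cmod (s - 1))\<^sup>2 = 1/4 + t\<^sup>2"
      unfolding cmod_power2 by (simp add: s_def power2_eq_square)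
    also have "N / (1/4 + t\<^sup>2) \<le> N / ((1 + t\<^sup>2) / 4)"
      by (intro divide_left_mono mult_pos_pos divide_pos_pos add_pos_nonneg) simp_all
    finally have P: "(cmod P)\<^sup>2 \<le> 4 * N / (1 + t\<^sup>2)" by (simp add: mult.commute)
    have "(cmod (riemann_zeta s - zeta_approx N s))\<^sup>2 \<le> (C / sqrt N)\<^sup>2"
      unfolding s_def by (intro power_mono C N t) auto
    then have R: "(cmod (riemann_zeta s - zeta_approx N s))\<^sup>2 \<le> C\<^sup>2 / N" by (simp add: power_divide)
    have "riemann_zeta s - (\<Sum>n=1..<N. of_nat n powr (- s)) = P + (riemann_zeta s - zeta_approx N s)"
      by (simp add: P_def zeta_approx_def)
    then have "(cmod (riemann_zeta s - (\<Sum>n=1..<N. of_nat n powr (- s))))\<^sup>2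
        = (cmod (P + (riemann_zeta s - zeta_approx N s)))\<^sup>2"
      by (simp only:)
    also have "\<dots> \<le> 2 * (cmod P)\<^sup>2 + 2 * (cmod (riemann_zeta s - zeta_approx N s))\<^sup>2"
      using power2_norm_add_le[of 1 P "riemann_zeta s - zeta_approx N s"] by simp
    also have "\<dots> \<le> 2 * (4 * N / (1 + t\<^sup>2)) + 2 * (C\<^sup>2 / N)"
      by (intro add_mono mult_left_mono P R) auto
    finally show ?thesis by (simp add: s_def)
  qed
  note bound = this
  show ?thesis
    by (rule that[of "2 * C\<^sup>2"]) (use C(1) in simp, fact bound)
qed

definition zeta_second_primitive :: "real \<Rightarrow> real" where
  "zeta_second_primitive T = integral {0..T} (\<lambda>t. (T - t) * zeta_sq t)"

text \<open>
  The Dirichlet polynomial of length \<open>N\<close>, the least integer not below \<open>T\<close>, is compared with zeta in mean square. The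
  difference contributes \<open>O(T^2)\<close>, because \<open>N / (1 + t^2)\<close> has integral \<open>O(N)\<close>.
\<close>

lemma fejer_zeta_bounds:
  obtains D where "D > 0"
    "\<And>T \<epsilon>. T \<ge> 1 \<Longrightarrow> \<epsilon> > 0 \<Longrightarrow> zeta_second_primitive T
        \<le> (1 + \<epsilon>) * (T\<^sup>2 / 2 * (ln T + D)) + (1 + 1 / \<epsilon>) * (D * T\<^sup>2)"
    "\<And>T \<epsilon>. T \<ge> 1 \<Longrightarrow> \<epsilon> > 0 \<Longrightarrow> T\<^sup>2 / 2 * ln T
        \<le> (1 + \<epsilon>) * zeta_second_primitive T + (1 + 1 / \<epsilon>) * (D * T\<^sup>2)"
proof -
  obtain C where C: "C > 0" "\<And>N t. N \<ge> 1 \<Longrightarrow> 0 \<le> t \<Longrightarrow> t \<le> real N \<Longrightarrow>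
    (cmod (riemann_zeta (Complex (1/2) t) - (\<Sum>n=1..<N. of_nat n powr (- Complex (1/2) t))))\<^sup>2
      \<le> 8 * real N / (1 + t\<^sup>2) + C / real N"
    using zeta_minus_dirichlet_bound by blast
  define D where "D = 258 + 32 + C"
  have "zeta_second_primitive T
        \<le> (1 + \<epsilon>) * (T\<^sup>2 / 2 * (ln T + D)) + (1 + 1 / \<epsilon>) * (D * T\<^sup>2) \<and>
      T\<^sup>2 / 2 * ln T
        \<le> (1 + \<epsilon>) * zeta_second_primitive T + (1 + 1 / \<epsilon>) * (D * T\<^sup>2)"
    if T: "T \<ge> 1" and \<epsilon>: "\<epsilon> > 0" for T \<epsilon> :: real
  proof -
    define N where "N = nat \<lceil>T\<rceil>"
    have N: "N \<ge> 1" "T \<le> N" "N \<le> 2 * T" using T by (auto simp: N_def) linarith+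
    obtain J where J: "((\<lambda>t. (T - t) * dirichlet_sq N t) has_integral J) {0..T}"
      "T\<^sup>2 / 2 * ln N \<le> J" "J \<le> T\<^sup>2 / 2 * (1 + ln N) + 32 * (real N)\<^sup>2"
      using fejer_dirichlet[of N T] N T by auto
    define M where "M = zeta_second_primitive T"
    have M: "((\<lambda>t. (T - t) * zeta_sq t) has_integral M) {0..T}"
      unfolding M_def zeta_second_primitive_def
      by (intro integrable_integral integrable_continuous_interval continuous_intros continuous_on_zeta_sq)
    define e where "e t = 16 * T / (1 + t\<^sup>2) + C / T" for t
    have "((\<lambda>t. 16 * T / (1 + t\<^sup>2) + C / T) has_integral
        ((16 * T * arctan T + C / T * T) - (16 * T * arctan 0 + C / T * 0))) {0..T}"
      using T by (intro fundamental_theorem_of_calculus)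
        (auto intro!: derivative_eq_intros simp: divide_inverse simp flip: has_real_derivative_iff_has_vector_derivative)
    then have e_int: "(e has_integral (16 * T * arctan T + C)) {0..T}"
      using T by (simp add: e_def[abs_def])
    have "arctan T \<le> 2" using arctan_ubound[of T] pi_less_4 by linarith
    then have "16 * T * arctan T \<le> 16 * T * 2" using T by (intro mult_left_mono) auto
    moreover have "C * 1 \<le> C * T" using C(1) T by (intro mult_left_mono) auto
    moreover have "D * T = 290 * T + C * T" by (simp add: D_def algebra_simps)
    ultimately have "16 * T * arctan T + C \<le> D * T" using T by linarith
    then have "T * (16 * T * arctan T + C) \<le> T * (D * T)" using T by (intro mult_left_mono) auto
    also have "T * (D * T) = D * T\<^sup>2" by (simp add: power2_eq_square)
    finally have De: "T * (16 * T * arctan T + C) \<le> D * T\<^sup>2" .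
    have Te_int: "((\<lambda>t. T * e t) has_integral (T * (16 * T * arctan T + C))) {0..T}"
      by (intro has_integral_mult_right e_int)
    define S where "S t = (\<Sum>n=1..<N. complex_of_nat n powr (- Complex (1/2) t))" for t
    have err: "(cmod (riemann_zeta (Complex (1/2) t) - S t))\<^sup>2 \<le> e t" if t: "t \<in> {0..T}" for t
    proof -
      have "(cmod (riemann_zeta (Complex (1/2) t) - S t))\<^sup>2 \<le> 8 * real N / (1 + t\<^sup>2) + C / real N"
        unfolding S_def using t N by (intro C) auto
      also have "\<dots> \<le> 8 * (2 * T) / (1 + t\<^sup>2) + C / T"
        using N T C(1) by (intro add_mono divide_right_mono divide_left_mono mult_left_mono) auto
      finally show ?thesis by (simp add: e_def)
    qed
    have weigh: "(T - t) * x \<le> (1 + \<epsilon>) * ((T - t) * y) + (1 + 1 / \<epsilon>) * (T * e t)"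
      if t: "t \<in> {0..T}" and "x \<le> (1 + \<epsilon>) * y + (1 + 1 / \<epsilon>) * e t" for x y t
    proof -
      have "0 \<le> e t" using T C(1) by (simp add: e_def)
      then have "(T - t) * e t \<le> T * e t" using t by (intro mult_right_mono) auto
      then have "(1 + 1 / \<epsilon>) * ((T - t) * e t) \<le> (1 + 1 / \<epsilon>) * (T * e t)"
        using \<epsilon> by (intro mult_left_mono) auto
      moreover have "(T - t) * x \<le> (T - t) * ((1 + \<epsilon>) * y + (1 + 1 / \<epsilon>) * e t)"
        using that by (intro mult_left_mono) auto
      moreover have "(T - t) * ((1 + \<epsilon>) * y + K * z) = (1 + \<epsilon>) * ((T - t) * y) + K * ((T - t) * z)" for K z
        by (simp add: algebra_simps)
      ultimately show ?thesis by (simp only:)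
    qed
    have sq: "(cmod u)\<^sup>2 \<le> (1 + \<epsilon>) * (cmod v)\<^sup>2 + (1 + 1 / \<epsilon>) * e t"
      if "(cmod (u - v))\<^sup>2 \<le> e t" for u v t
    proof -
      have "(cmod u)\<^sup>2 \<le> (1 + \<epsilon>) * (cmod v)\<^sup>2 + (1 + 1 / \<epsilon>) * (cmod (u - v))\<^sup>2"
        using power2_norm_add_le[OF \<epsilon>, of v "u - v"] by simp
      also have "\<dots> \<le> (1 + \<epsilon>) * (cmod v)\<^sup>2 + (1 + 1 / \<epsilon>) * e t"
        using that \<epsilon> by (intro add_left_mono mult_left_mono) auto
      finally show ?thesis .
    qed
    have eps: "1 + 1 / \<epsilon> \<ge> 0" using \<epsilon> by simp
    have lnN: "ln T \<le> ln N" "ln N \<le> 1 + ln T"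
    proof -
      show "ln T \<le> ln N" using N T by simp
      have "ln N \<le> ln (2 * T)" using N T by simp
      also have "\<dots> = ln 2 + ln T" using T by (simp add: ln_mult)
      also have "ln 2 \<le> (1::real)" using ln_le_minus_one[of "2::real"] by simp
      finally show "ln N \<le> 1 + ln T" by simp
    qed
    have "J \<le> T\<^sup>2 / 2 * (ln T + D)"
    proof -
      have "T\<^sup>2 / 2 * (1 + ln N) \<le> T\<^sup>2 / 2 * (2 + ln T)"
        using lnN by (intro mult_left_mono) auto
      also have "\<dots> = T\<^sup>2 / 2 * ln T + T\<^sup>2" by (simp add: distrib_left)
      finally have 1: "T\<^sup>2 / 2 * (1 + ln N) \<le> T\<^sup>2 / 2 * ln T + T\<^sup>2" .
      have "(real N)\<^sup>2 \<le> (2 * T)\<^sup>2" using N by (intro power_mono) auto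
      then have 2: "(real N)\<^sup>2 \<le> 4 * T\<^sup>2" by (simp add: power_mult_distrib)
      have "T\<^sup>2 / 2 * 258 \<le> T\<^sup>2 / 2 * D" using C(1) by (intro mult_left_mono) (auto simp: D_def)
      with 1 2 J(3) show ?thesis unfolding distrib_left[of "T\<^sup>2 / 2"] by linarith
    qed
    have "M \<le> (1 + \<epsilon>) * J + (1 + 1 / \<epsilon>) * (T * (16 * T * arctan T + C))"
    proof (rule has_integral_le[OF M])
      show "((\<lambda>t. (1 + \<epsilon>) * ((T - t) * dirichlet_sq N t) + (1 + 1 / \<epsilon>) * (T * e t)) has_integral
          (1 + \<epsilon>) * J + (1 + 1 / \<epsilon>) * (T * (16 * T * arctan T + C))) {0..T}"
        by (intro has_integral_add has_integral_mult_right J(1) Te_int)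
      show "(T - t) * zeta_sq t \<le> (1 + \<epsilon>) * ((T - t) * dirichlet_sq N t) + (1 + 1 / \<epsilon>) * (T * e t)"
        if t: "t \<in> {0..T}" for t
        using sq[OF err[OF t]] by (intro weigh t) (simp add: zeta_sq_def dirichlet_sq_def S_def)
    qed
    also have "\<dots> \<le> (1 + \<epsilon>) * (T\<^sup>2 / 2 * (ln T + D)) + (1 + 1 / \<epsilon>) * (D * T\<^sup>2)"
      using \<epsilon> by (intro add_mono mult_left_mono De eps \<open>J \<le> T\<^sup>2 / 2 * (ln T + D)\<close>) auto
    finally have up: "M \<le> (1 + \<epsilon>) * (T\<^sup>2 / 2 * (ln T + D)) + (1 + 1 / \<epsilon>) * (D * T\<^sup>2)" .
    have "T\<^sup>2 / 2 * ln T \<le> T\<^sup>2 / 2 * ln N" using lnN by (intro mult_left_mono) auto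
    also note J(2)
    also have "J \<le> (1 + \<epsilon>) * M + (1 + 1 / \<epsilon>) * (T * (16 * T * arctan T + C))"
    proof (rule has_integral_le[OF J(1)])
      show "((\<lambda>t. (1 + \<epsilon>) * ((T - t) * zeta_sq t) + (1 + 1 / \<epsilon>) * (T * e t)) has_integral
          (1 + \<epsilon>) * M + (1 + 1 / \<epsilon>) * (T * (16 * T * arctan T + C))) {0..T}"
        by (intro has_integral_add has_integral_mult_right M Te_int)
      show "(T - t) * dirichlet_sq N t \<le> (1 + \<epsilon>) * ((T - t) * zeta_sq t) + (1 + 1 / \<epsilon>) * (T * e t)"
        if t: "t \<in> {0..T}" for t
        using sq[of "S t" "riemann_zeta (Complex (1/2) t)" t] err[OF t]
        by (intro weigh t) (simp add: zeta_sq_def dirichlet_sq_def S_def norm_minus_commute)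
    qed
    also have "\<dots> \<le> (1 + \<epsilon>) * M + (1 + 1 / \<epsilon>) * (D * T\<^sup>2)"
      by (intro add_left_mono mult_left_mono De eps)
    finally show ?thesis using up unfolding M_def by blast
  qed
  note bounds = this
  show ?thesis
  proof (rule that[of D])
    show "D > 0" using C(1) by (simp add: D_def)
    fix T \<epsilon> :: real assume "T \<ge> 1" "\<epsilon> > 0"
    note b = bounds[OF this]
    show "zeta_second_primitive T \<le> (1 + \<epsilon>) * (T\<^sup>2 / 2 * (ln T + D)) + (1 + 1 / \<epsilon>) * (D * T\<^sup>2)"
      by (rule conjunct1[OF b])
    show "T\<^sup>2 / 2 * ln T \<le> (1 + \<epsilon>) * zeta_second_primitive T + (1 + 1 / \<epsilon>) * (D * T\<^sup>2)"
      by (rule conjunct2[OF b])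
  qed
qed

text \<open>
  The choice \<open>\<epsilon> = (ln T)^(-1/2)\<close> makes both \<open>\<epsilon> ln T\<close> and \<open>1/\<epsilon>\<close> of smaller order than the main factor \<open>ln T\<close>.
\<close>

lemma zeta_second_primitive_asymp:
  "((\<lambda>T. zeta_second_primitive T / (T\<^sup>2 * ln T)) \<longlongrightarrow> 1/2) at_top"
proof -
  obtain D where D: "D > 0"
    "\<And>T \<epsilon>. T \<ge> 1 \<Longrightarrow> \<epsilon> > 0 \<Longrightarrow> zeta_second_primitive T
        \<le> (1 + \<epsilon>) * (T\<^sup>2 / 2 * (ln T + D)) + (1 + 1 / \<epsilon>) * (D * T\<^sup>2)"
    "\<And>T \<epsilon>. T \<ge> 1 \<Longrightarrow> \<epsilon> > 0 \<Longrightarrow> T\<^sup>2 / 2 * ln T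
        \<le> (1 + \<epsilon>) * zeta_second_primitive T + (1 + 1 / \<epsilon>) * (D * T\<^sup>2)"
    by (fact fejer_zeta_bounds)
  define \<epsilon> where "\<epsilon> T = 1 / sqrt (ln T)" for T :: real
  have \<epsilon>0: "(\<epsilon> \<longlongrightarrow> 0) at_top" unfolding \<epsilon>_def by real_asymp
  have facts: "\<epsilon> T > 0" "ln T = 1 / (\<epsilon> T)\<^sup>2" "T\<^sup>2 * ln T > 0" "(1 + 1 / \<epsilon> T) * (D * T\<^sup>2) / (T\<^sup>2 * ln T) = D * ((\<epsilon> T)\<^sup>2 + \<epsilon> T)"
    if "T \<ge> 3" for T
  proof -
    have ln: "ln T > 0" using that by simp
    show 1: "\<epsilon> T > 0" "ln T = 1 / (\<epsilon> T)\<^sup>2" "T\<^sup>2 * ln T > 0"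
      using ln that by (simp_all add: \<epsilon>_def power_divide)
    have "(1 + 1 / \<epsilon> T) * (D * T\<^sup>2) / (T\<^sup>2 * ln T) = (1 + 1 / \<epsilon> T) * D / ln T"
      using that by simp
    also have "\<dots> = D * ((\<epsilon> T)\<^sup>2 + \<epsilon> T)"
      unfolding 1(2) using 1(1) by (simp add: field_simps power2_eq_square)
    finally show "(1 + 1 / \<epsilon> T) * (D * T\<^sup>2) / (T\<^sup>2 * ln T) = D * ((\<epsilon> T)\<^sup>2 + \<epsilon> T)" .
  qed
  show ?thesis
  proof (rule tendsto_sandwich)
    show "\<forall>\<^sub>F T in at_top. (1/2 - D * ((\<epsilon> T)\<^sup>2 + \<epsilon> T)) / (1 + \<epsilon> T) \<le> zeta_second_primitive T / (T\<^sup>2 * ln T)"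
      using eventually_ge_at_top[of 3]
    proof eventually_elim
      case (elim T)
      note f = facts[OF elim]
      have "(T\<^sup>2 / 2 * ln T) / (T\<^sup>2 * ln T)
          \<le> ((1 + \<epsilon> T) * zeta_second_primitive T + (1 + 1 / \<epsilon> T) * (D * T\<^sup>2)) / (T\<^sup>2 * ln T)"
        using f(1,3) elim by (intro divide_right_mono D) simp_all
      also have "(T\<^sup>2 / 2 * ln T) / (T\<^sup>2 * ln T) = 1/2" using f(3) by (simp add: zero_less_mult_iff)
      finally have "1/2 \<le> (1 + \<epsilon> T) * (zeta_second_primitive T / (T\<^sup>2 * ln T)) + D * ((\<epsilon> T)\<^sup>2 + \<epsilon> T)"
        unfolding add_divide_distrib f(4) by simp
      then show ?case using f(1) by (simp add: divide_le_eq mult.commute)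
    qed
    show "\<forall>\<^sub>F T in at_top. zeta_second_primitive T / (T\<^sup>2 * ln T)
        \<le> (1 + \<epsilon> T) * (1/2 + D / 2 * (\<epsilon> T)\<^sup>2) + D * ((\<epsilon> T)\<^sup>2 + \<epsilon> T)"
      using eventually_ge_at_top[of 3]
    proof eventually_elim
      case (elim T)
      note f = facts[OF elim]
      have "zeta_second_primitive T / (T\<^sup>2 * ln T)
          \<le> ((1 + \<epsilon> T) * (T\<^sup>2 / 2 * (ln T + D)) + (1 + 1 / \<epsilon> T) * (D * T\<^sup>2)) / (T\<^sup>2 * ln T)"
        using f(1,3) elim by (intro divide_right_mono D) simp_all
      also have "\<dots> = (1 + \<epsilon> T) * ((T\<^sup>2 / 2 * (ln T + D)) / (T\<^sup>2 * ln T)) + D * ((\<epsilon> T)\<^sup>2 + \<epsilon> T)"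
        unfolding add_divide_distrib f(4) by simp
      also have "(T\<^sup>2 / 2 * (ln T + D)) / (T\<^sup>2 * ln T) = 1/2 + D / 2 / ln T"
      proof -
        have "ln T > 0" using elim by simp
        then show ?thesis using elim by (simp add: field_simps)
      qed
      also have "D / 2 / ln T = D / 2 * (\<epsilon> T)\<^sup>2" unfolding f(2) by simp
      finally show ?case .
    qed
    have "((\<lambda>T. (1/2 - D * ((\<epsilon> T)\<^sup>2 + \<epsilon> T)) / (1 + \<epsilon> T)) \<longlongrightarrow> (1/2 - D * (0\<^sup>2 + 0)) / (1 + 0)) at_top"
      by (intro tendsto_intros \<epsilon>0) simp
    then show "((\<lambda>T. (1/2 - D * ((\<epsilon> T)\<^sup>2 + \<epsilon> T)) / (1 + \<epsilon> T)) \<longlongrightarrow> 1/2) at_top" by simp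
    have "((\<lambda>T. (1 + \<epsilon> T) * (1/2 + D / 2 * (\<epsilon> T)\<^sup>2) + D * ((\<epsilon> T)\<^sup>2 + \<epsilon> T)) \<longlongrightarrow>
        (1 + 0) * (1/2 + D / 2 * 0\<^sup>2) + D * (0\<^sup>2 + 0)) at_top"
      by (intro tendsto_intros \<epsilon>0)
    then show "((\<lambda>T. (1 + \<epsilon> T) * (1/2 + D / 2 * (\<epsilon> T)\<^sup>2) + D * ((\<epsilon> T)\<^sup>2 + \<epsilon> T)) \<longlongrightarrow> 1/2) at_top"
      by simp
  qed
qed

text \<open>
  Bounding every term of the sum by 1 suffices, since this estimate is only applied against an
  exponentially small factor.
\<close>

lemma zeta_sq_quadratic_bound:
  obtains C where "C > 0" "\<And>t. t \<ge> 1 \<Longrightarrow> zeta_sq t \<le> C * t\<^sup>2"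
proof -
  obtain C where C: "C > 0" "\<And>N t. N \<ge> 1 \<Longrightarrow> 0 \<le> t \<Longrightarrow> t \<le> real N \<Longrightarrow>
    (cmod (riemann_zeta (Complex (1/2) t) - (\<Sum>n=1..<N. of_nat n powr (- Complex (1/2) t))))\<^sup>2
      \<le> 8 * real N / (1 + t\<^sup>2) + C / real N"
    using zeta_minus_dirichlet_bound by blast
  have "zeta_sq t \<le> (40 + 2 * C) * t\<^sup>2" if t: "t \<ge> 1" for t
  proof -
    define N where "N = nat \<lceil>t\<rceil>"
    have N: "N \<ge> 1" "t \<le> N" "N \<le> 2 * t" using t by (auto simp: N_def) linarith+
    have t2: "t \<le> t\<^sup>2" "1 \<le> t\<^sup>2" using t by (auto simp: power2_eq_square intro: mult_mono[of 1 t 1 t, simplified])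
    define S where "S = (\<Sum>n=1..<N. complex_of_nat n powr (- Complex (1/2) t))"
    have "cmod S \<le> (\<Sum>n=1..<N. 1)"
      unfolding S_def by (rule sum_norm_le) (auto simp: norm_critical_powr)
    also have "\<dots> \<le> 2 * t" using N by simp
    finally have "(cmod S)\<^sup>2 \<le> (2 * t)\<^sup>2" by (intro power_mono) auto
    then have S: "(cmod S)\<^sup>2 \<le> 4 * t\<^sup>2" by (simp add: power_mult_distrib)
    have "zeta_sq t \<le> 2 * (cmod S)\<^sup>2 + 2 * (cmod (riemann_zeta (Complex (1/2) t) - S))\<^sup>2"
      using power2_norm_add_le[of 1 S "riemann_zeta (Complex (1/2) t) - S"] by (simp add: zeta_sq_def)
    also have "\<dots> \<le> 2 * (4 * t\<^sup>2) + 2 * (8 * real N / (1 + t\<^sup>2) + C / real N)"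
      unfolding S_def using t N by (intro add_mono mult_left_mono C S[unfolded S_def]) auto
    finally have z: "zeta_sq t \<le> 2 * (4 * t\<^sup>2) + 2 * (8 * real N / (1 + t\<^sup>2) + C / real N)" .
    have "8 * real N / (1 + t\<^sup>2) \<le> 8 * (2 * t) / 1"
      using N t by (intro frac_le) auto
    then have N1: "8 * real N / (1 + t\<^sup>2) \<le> 16 * t\<^sup>2" using t2 by simp
    have "C / N \<le> C / 1" using N C(1) by (intro divide_left_mono) auto
    also have "C / 1 \<le> C * t\<^sup>2" using t2 C(1) by simp
    finally have "C / N \<le> C * t\<^sup>2" .
    with N1 have "2 * (8 * real N / (1 + t\<^sup>2) + C / real N) \<le> 2 * (16 * t\<^sup>2 + C * t\<^sup>2)"
      by (intro mult_left_mono add_mono) auto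
    with z have "zeta_sq t \<le> 2 * (4 * t\<^sup>2) + 2 * (16 * t\<^sup>2 + C * t\<^sup>2)" by (meson add_left_mono order.trans)
    then show ?thesis by (simp add: algebra_simps)
  qed
  then show ?thesis using that[of "40 + 2 * C"] C(1) by auto
qed

definition zeta_primitive :: "real \<Rightarrow> real" where
  "zeta_primitive T = integral {0..T} zeta_sq"

lemma zeta_sq_integrable: "zeta_sq integrable_on {a..b}"
  by (intro integrable_continuous_interval continuous_on_zeta_sq)

lemma zeta_primitive_diff:
  assumes "0 \<le> a" "a \<le> b"
  shows "zeta_primitive b - zeta_primitive a = integral {a..b} zeta_sq"
  using Henstock_Kurzweil_Integration.integral_combine[OF assms zeta_sq_integrable]
  by (simp add: zeta_primitive_def)

text \<open>
  Otherwise zeta would vanish identically by analytic continuation, contradicting \<open>zeta(2) > 0\<close>.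
\<close>

lemma zeta_not_zero_on_interval:
  assumes "a < b" shows "\<exists>t\<in>{a..b}. zeta_sq t \<noteq> 0"
proof (rule ccontr)
  assume "\<not> ?thesis"
  then have z: "riemann_zeta (Complex (1/2) t) = 0" if "t \<in> {a..b}" for t
    using that by (auto simp: zeta_sq_def)
  define U where "U = (\<lambda>t. Complex (1/2) t) ` {a..b}"
  have "continuous_on {a..b} (\<lambda>t. Complex (1/2) t)"
    unfolding Complex_eq by (intro continuous_intros)
  then have "connected U" unfolding U_def by (intro connected_continuous_image) auto
  moreover have "Complex (1/2) a \<in> U" "Complex (1/2) b \<in> U" using assms by (auto simp: U_def)
  moreover have "Complex (1/2) a \<noteq> Complex (1/2) b" using assms by simp
  ultimately have lim: "Complex (1/2) a islimpt U" by (intro connected_imp_perfect) auto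
  have zero: "riemann_zeta 2 = 0"
    by (rule analytic_continuation[OF riemann_zeta_holomorphic open_zeta_domain connected_zeta_domain _ _ lim])
       (use z critical_line_in_zeta_domain in \<open>auto simp: U_def zeta_domain_def\<close>)
  have "(\<lambda>n. Re (of_nat (Suc n) powr (- 2))) sums Re (riemann_zeta 2)"
    by (intro sums_Re riemann_zeta_sums) simp
  moreover have "Re (of_nat (Suc n) powr (- 2)) = 1 / (real (Suc n))\<^sup>2" for n
  proof -
    have "complex_of_nat (Suc n) powr (- 2) = of_real (1 / (real (Suc n))\<^sup>2)"
      by (simp add: powr_minus powr_numeral inverse_eq_divide del: of_nat_Suc)
    then show ?thesis by (simp only: Re_complex_of_real)
  qed
  ultimately have s: "(\<lambda>n. 1 / (real (Suc n))\<^sup>2) sums 0" using zero by simp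
  have "(\<Sum>n. 1 / (real (Suc n))\<^sup>2) > 0"
    using s by (intro suminf_pos) (auto simp: sums_iff)
  then show False using s by (simp add: sums_iff)
qed

lemma zeta_primitive_strict_mono:
  assumes "0 \<le> a" "a < b" shows "zeta_primitive a < zeta_primitive b"
proof -
  have nonneg: "integral {a..b} zeta_sq \<ge> 0" by (intro integral_nonneg zeta_sq_integrable) simp
  moreover have "integral {a..b} zeta_sq \<noteq> 0"
  proof
    assume "integral {a..b} zeta_sq = 0"
    then have "(zeta_sq has_integral 0) (cbox a b)"
      using integrable_integral[OF zeta_sq_integrable[of a b]] by simp
    then have "zeta_sq t = 0" if "t \<in> {a..b}" for t
      using that assms by (intro has_integral_0_cbox_imp_0[of a b zeta_sq] continuous_on_zeta_sq) auto
    then show False using zeta_not_zero_on_interval[OF assms(2)] by auto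
  qed
  ultimately show ?thesis using zeta_primitive_diff[of a b] assms by simp
qed

lemma zeta_primitive_mono:
  assumes "0 \<le> a" "a \<le> b" shows "zeta_primitive a \<le> zeta_primitive b"
  using zeta_primitive_strict_mono[of a b] assms by (cases "a = b") auto

lemma zeta_primitive_0 [simp]: "T \<le> 0 \<Longrightarrow> zeta_primitive T = 0"
  by (cases "T = 0") (auto simp: zeta_primitive_def)

lemma zeta_primitive_has_derivative:
  assumes "T > 0" shows "(zeta_primitive has_field_derivative zeta_sq T) (at T)"
proof -
  have "(zeta_primitive has_field_derivative zeta_sq T) (at T within {0..T + 1})"
    unfolding zeta_primitive_def[abs_def] using assms
    by (intro integral_has_real_derivative continuous_on_zeta_sq) auto
  then show ?thesis using assms by (subst (asm) at_within_interior) auto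
qed

text \<open>
  The second primitive is convex, with derivative the first primitive. These are the corresponding bounds for
  its difference quotients.
\<close>

lemma zeta_second_primitive_diff:
  assumes "0 \<le> S" "S \<le> T"
  shows "(T - S) * zeta_primitive S \<le> zeta_second_primitive T - zeta_second_primitive S"
    and "zeta_second_primitive T - zeta_second_primitive S \<le> (T - S) * zeta_primitive T"
proof -
  have int: "(\<lambda>t. (c - t) * zeta_sq t) integrable_on {a..b}" for a b c
    by (intro integrable_continuous_interval continuous_intros continuous_on_zeta_sq)
  have "integral {0..S} (\<lambda>t. (T - t) * zeta_sq t) - zeta_second_primitive S
      = integral {0..S} (\<lambda>t. (T - t) * zeta_sq t - (S - t) * zeta_sq t)"
    unfolding zeta_second_primitive_def by (intro integral_diff[symmetric] int)
  also have "\<dots> = (T - S) * zeta_primitive S"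
    unfolding zeta_primitive_def by (simp flip: integral_mult_right add: algebra_simps)
  finally have 1: "integral {0..S} (\<lambda>t. (T - t) * zeta_sq t) = zeta_second_primitive S + (T - S) * zeta_primitive S"
    by simp
  have 2: "zeta_second_primitive T = integral {0..S} (\<lambda>t. (T - t) * zeta_sq t) + integral {S..T} (\<lambda>t. (T - t) * zeta_sq t)"
    using Henstock_Kurzweil_Integration.integral_combine[OF assms int] by (simp add: zeta_second_primitive_def)
  have "0 \<le> integral {S..T} (\<lambda>t. (T - t) * zeta_sq t)"
    by (intro integral_nonneg int) auto
  with 1 2 show "(T - S) * zeta_primitive S \<le> zeta_second_primitive T - zeta_second_primitive S" by simp
  have "integral {S..T} (\<lambda>t. (T - t) * zeta_sq t) \<le> integral {S..T} (\<lambda>t. (T - S) * zeta_sq t)"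
    by (intro integral_le int integrable_on_mult_right zeta_sq_integrable mult_right_mono) auto
  also have "\<dots> = (T - S) * (zeta_primitive T - zeta_primitive S)"
    using zeta_primitive_diff[OF assms] by simp
  finally show "zeta_second_primitive T - zeta_second_primitive S \<le> (T - S) * zeta_primitive T"
    using 1 2 by (simp add: algebra_simps)
qed

lemma zeta_second_primitive_scaled:
  assumes c: "c > 0"
  shows "((\<lambda>T. zeta_second_primitive (c * T) / (T\<^sup>2 * ln T)) \<longlongrightarrow> c\<^sup>2 / 2) at_top"
proof -
  have "filterlim (\<lambda>T. c * T) at_top at_top" using c by real_asymp
  then have "((\<lambda>T. zeta_second_primitive (c * T) / ((c * T)\<^sup>2 * ln (c * T))) \<longlongrightarrow> 1/2) at_top"
    by (rule filterlim_compose[OF zeta_second_primitive_asymp])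
  moreover have "((\<lambda>T. ln (c * T) / ln T) \<longlongrightarrow> 1) at_top" using c by real_asymp
  ultimately have "((\<lambda>T. (zeta_second_primitive (c * T) / ((c * T)\<^sup>2 * ln (c * T))) * (c\<^sup>2 * (ln (c * T) / ln T)))
      \<longlongrightarrow> 1/2 * (c\<^sup>2 * 1)) at_top"
    by (intro tendsto_mult tendsto_const)
  moreover have "\<forall>\<^sub>F T in at_top. (zeta_second_primitive (c * T) / ((c * T)\<^sup>2 * ln (c * T))) * (c\<^sup>2 * (ln (c * T) / ln T))
      = zeta_second_primitive (c * T) / (T\<^sup>2 * ln T)"
    using eventually_gt_at_top[of "max 1 (1 / c)"]
  proof eventually_elim
    case (elim T)
    then have "c * T > 1" using c by (simp add: field_simps)
    then have "ln (c * T) \<noteq> 0" "c * T \<noteq> 0" by auto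
    then show ?case by (simp add: power_mult_distrib)
  qed
  ultimately show ?thesis by (simp add: tendsto_cong)
qed

text \<open>
  A Tauberian step: by convexity the derivative of the second primitive lies between the difference quotients over
  \<open>[(1-\<epsilon>)T, T]\<close> and \<open>[T, (1+\<epsilon>)T]\<close>, whose asymptotics are \<open>1 - \<epsilon>/2\<close> and \<open>1 + \<epsilon>/2\<close> times \<open>T ln T\<close>.
\<close>

lemma zeta_primitive_asymp: "((\<lambda>T. zeta_primitive T / (T * ln T)) \<longlongrightarrow> 1) at_top"
proof (rule order_tendstoI)
  fix a :: real assume a: "a < 1"
  define \<epsilon> where "\<epsilon> = min (1 - a) (1/2)"
  have "\<epsilon> \<le> 1 - a" by (simp add: \<epsilon>_def)
  moreover have "0 < \<epsilon>" "\<epsilon> < 1" using a by (auto simp: \<epsilon>_def)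
  ultimately have \<epsilon>: "0 < \<epsilon>" "\<epsilon> < 1" "a < 1 - \<epsilon> / 2" using a by linarith+
  have "((\<lambda>T. (zeta_second_primitive (1 * T) / (T\<^sup>2 * ln T) - zeta_second_primitive ((1 - \<epsilon>) * T) / (T\<^sup>2 * ln T)) / \<epsilon>)
      \<longlongrightarrow> (1\<^sup>2 / 2 - (1 - \<epsilon>)\<^sup>2 / 2) / \<epsilon>) at_top"
    using \<epsilon> by (intro tendsto_intros zeta_second_primitive_scaled) auto
  also have "(1\<^sup>2 / 2 - (1 - \<epsilon>)\<^sup>2 / 2) / \<epsilon> = 1 - \<epsilon> / 2" using \<epsilon> by (simp add: field_simps power2_eq_square)
  finally have "\<forall>\<^sub>F T in at_top. a < (zeta_second_primitive (1 * T) / (T\<^sup>2 * ln T)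
      - zeta_second_primitive ((1 - \<epsilon>) * T) / (T\<^sup>2 * ln T)) / \<epsilon>"
    using \<epsilon> by (auto dest: order_tendstoD)
  with eventually_gt_at_top[of 1] show "\<forall>\<^sub>F T in at_top. a < zeta_primitive T / (T * ln T)"
  proof eventually_elim
    case (elim T)
    have "zeta_second_primitive T - zeta_second_primitive ((1 - \<epsilon>) * T) \<le> (\<epsilon> * T) * zeta_primitive T"
      using zeta_second_primitive_diff(2)[of "(1 - \<epsilon>) * T" T] elim \<epsilon> by (simp add: algebra_simps)
    then have "(zeta_second_primitive T - zeta_second_primitive ((1 - \<epsilon>) * T)) / (\<epsilon> * (T\<^sup>2 * ln T))
        \<le> ((\<epsilon> * T) * zeta_primitive T) / (\<epsilon> * (T\<^sup>2 * ln T))"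
      using elim \<epsilon> by (intro divide_right_mono) auto
    also have "\<dots> = zeta_primitive T / (T * ln T)" using elim \<epsilon> by (simp add: power2_eq_square)
    finally show ?case using elim by (simp add: diff_divide_distrib mult.commute)
  qed
next
  fix a :: real assume a: "a > 1"
  define \<epsilon> where "\<epsilon> = a - 1"
  have \<epsilon>: "0 < \<epsilon>" using a by (simp add: \<epsilon>_def)
  have \<epsilon>': "1 + \<epsilon> / 2 < a" using a by (simp add: \<epsilon>_def field_simps)
  have "((\<lambda>T. (zeta_second_primitive ((1 + \<epsilon>) * T) / (T\<^sup>2 * ln T) - zeta_second_primitive (1 * T) / (T\<^sup>2 * ln T)) / \<epsilon>)
      \<longlongrightarrow> ((1 + \<epsilon>)\<^sup>2 / 2 - 1\<^sup>2 / 2) / \<epsilon>) at_top"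
    using \<epsilon> by (intro tendsto_intros zeta_second_primitive_scaled) auto
  also have "((1 + \<epsilon>)\<^sup>2 / 2 - 1\<^sup>2 / 2) / \<epsilon> = 1 + \<epsilon> / 2" using \<epsilon> by (simp add: field_simps power2_eq_square)
  finally have "\<forall>\<^sub>F T in at_top. (zeta_second_primitive ((1 + \<epsilon>) * T) / (T\<^sup>2 * ln T)
      - zeta_second_primitive (1 * T) / (T\<^sup>2 * ln T)) / \<epsilon> < a"
    using \<epsilon>' by (auto dest: order_tendstoD)
  with eventually_gt_at_top[of 1] show "\<forall>\<^sub>F T in at_top. zeta_primitive T / (T * ln T) < a"
  proof eventually_elim
    case (elim T)
    have "(\<epsilon> * T) * zeta_primitive T \<le> zeta_second_primitive ((1 + \<epsilon>) * T) - zeta_second_primitive T"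
      using zeta_second_primitive_diff(1)[of T "(1 + \<epsilon>) * T"] elim \<epsilon> by (simp add: algebra_simps)
    then have "((\<epsilon> * T) * zeta_primitive T) / (\<epsilon> * (T\<^sup>2 * ln T))
        \<le> (zeta_second_primitive ((1 + \<epsilon>) * T) - zeta_second_primitive T) / (\<epsilon> * (T\<^sup>2 * ln T))"
      using elim \<epsilon> by (intro divide_right_mono) auto
    moreover have "((\<epsilon> * T) * zeta_primitive T) / (\<epsilon> * (T\<^sup>2 * ln T)) = zeta_primitive T / (T * ln T)"
      using elim \<epsilon> by (simp add: power2_eq_square)
    ultimately show ?case using elim by (simp add: diff_divide_distrib mult.commute)
  qed
qed

section \<open>The truncated Laplace integral\<close>

text \<open>
  The derivative of \<open>exp(-2t/y)\<close> with respect to \<open>y\<close>.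
\<close>

definition laplace_kernel :: "real \<Rightarrow> real \<Rightarrow> real" where
  "laplace_kernel y t = 2 * t / y\<^sup>2 * exp (- (2 / y) * t)"

definition ladder_lhs :: "real \<Rightarrow> real \<Rightarrow> real" where
  "ladder_lhs \<alpha> y = integral {0..ladder_mu \<alpha> y} (\<lambda>t. zeta_sq t * exp (- (2 / y) * t))"

definition ladder_lhs_deriv :: "real \<Rightarrow> real \<Rightarrow> real" where
  "ladder_lhs_deriv \<alpha> y = integral {0..ladder_mu \<alpha> y} (\<lambda>t. zeta_sq t * laplace_kernel y t)
     + zeta_sq (ladder_mu \<alpha> y) * exp (- (2 / y) * ladder_mu \<alpha> y) * (\<alpha> * (ln y + 1))"

lemma ladder_mu_pos: "\<alpha> > 0 \<Longrightarrow> y > 1 \<Longrightarrow> ladder_mu \<alpha> y > 0"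
  by (simp add: ladder_mu_def)

text \<open>
  Continuous partial derivatives: the upper limit is differentiated by the fundamental theorem of
  calculus, the parameter under the integral sign.
\<close>

lemma truncated_laplace_has_derivative:
  fixes w :: "real \<Rightarrow> real"
  assumes w: "continuous_on UNIV w" and y: "y > 0" and \<tau>: "\<tau> > 0"
  shows "((\<lambda>(\<tau>, y). integral {0..\<tau>} (\<lambda>t. w t * exp (- (2 / y) * t))) has_derivative
     (\<lambda>(d\<tau>, dy). w \<tau> * exp (- (2 / y) * \<tau>) * d\<tau> + integral {0..\<tau>} (\<lambda>t. w t * laplace_kernel y t) * dy))
     (at (\<tau>, y))"
proof -
  define K where "K y \<tau> = integral {0..\<tau>} (\<lambda>t. w t * exp (- (2 / y) * t))" for y \<tau>
  define X where "X = ({0<..} :: real set)"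
  have wS: "continuous_on S w" for S using w continuous_on_subset by blast
  have fx: "((\<lambda>y. K y \<tau>) has_field_derivative integral {0..\<tau>} (\<lambda>t. w t * laplace_kernel y t)) (at y within X)"
    unfolding K_def cbox_interval[symmetric]
  proof (rule leibniz_rule_field_derivative)
    fix z t :: real assume "z \<in> X"
    then have z: "z > 0" by (simp add: X_def)
    then show "((\<lambda>z. w t * exp (- (2 / z) * t)) has_field_derivative w t * laplace_kernel z t) (at z within X)"
      unfolding laplace_kernel_def
      by (auto intro!: derivative_eq_intros simp: field_simps power2_eq_square)
  next
    fix z :: real
    show "(\<lambda>t. w t * exp (- (2 / z) * t)) integrable_on cbox 0 \<tau>"
      by (intro integrable_continuous continuous_intros wS)
  next
    show "continuous_on (X \<times> cbox 0 \<tau>) (\<lambda>(x, t). w t * laplace_kernel x t)"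
      unfolding laplace_kernel_def split_beta
      by (intro continuous_intros continuous_on_compose2[OF w]) (auto simp: X_def)
  qed (use y in \<open>auto simp: X_def\<close>)
  have "((\<lambda>(y, \<tau>). K y \<tau>) has_derivative
      (\<lambda>(dy, d\<tau>). integral {0..\<tau>} (\<lambda>t. w t * laplace_kernel y t) * dy
         + blinfun_apply (blinfun_mult_right (w \<tau> * exp (- (2 / y) * \<tau>))) d\<tau>)) (at (y, \<tau>) within X \<times> X)"
  proof (rule has_derivative_partialsI[where fy = "\<lambda>y \<tau>. blinfun_mult_right (w \<tau> * exp (- (2 / y) * \<tau>))"])
    show "((\<lambda>y. K y \<tau>) has_derivative (*) (integral {0..\<tau>} (\<lambda>t. w t * laplace_kernel y t))) (at y within X)"
      using fx by (simp add: has_field_derivative_def)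
    fix z s :: real assume "z \<in> X" "s \<in> X"
    then have s: "s > 0" by (simp add: X_def)
    have "(K z has_field_derivative w s * exp (- (2 / z) * s)) (at s within {0..s + 1})"
      unfolding K_def[abs_def] using s
      by (intro integral_has_real_derivative continuous_intros wS) auto
    then have "(K z has_field_derivative w s * exp (- (2 / z) * s)) (at s)"
      using s by (subst (asm) at_within_interior) auto
    then show "(K z has_derivative blinfun_apply (blinfun_mult_right (w s * exp (- (2 / z) * s)))) (at s within X)"
      by (auto simp: has_field_derivative_def intro: has_derivative_at_withinI)
  next
    have "continuous_on (X \<times> X) (\<lambda>(y, \<tau>). blinfun_mult_right (w \<tau> * exp (- (2 / y) * \<tau>)))"
      unfolding split_beta
      by (intro continuous_intros continuous_on_compose2[OF w] bounded_linear.continuous_on[OF bounded_linear_blinfun_mult_right])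
         (auto simp: X_def)
    then show "continuous (at (y, \<tau>) within X \<times> X) (\<lambda>(y, \<tau>). blinfun_mult_right (w \<tau> * exp (- (2 / y) * \<tau>)))"
      using y \<tau> by (auto simp: continuous_on_eq_continuous_within X_def)
  qed (use \<tau> in \<open>auto simp: X_def\<close>)
  moreover have "at (y, \<tau>) within X \<times> X = at (y, \<tau>)"
    using y \<tau> by (intro at_within_open open_Times) (auto simp: X_def)
  ultimately have D: "((\<lambda>(y, \<tau>). K y \<tau>) has_derivative
      (\<lambda>(dy, d\<tau>). integral {0..\<tau>} (\<lambda>t. w t * laplace_kernel y t) * dy + w \<tau> * exp (- (2 / y) * \<tau>) * d\<tau>)) (at (y, \<tau>))"
    by simp
  have swap: "((\<lambda>p. (snd p, fst p)) has_derivative (\<lambda>p. (snd p, fst p))) (at (\<tau>, y))"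
    by (intro derivative_intros)
  have "((\<lambda>(y, \<tau>). K y \<tau>) has_derivative
      (\<lambda>(dy, d\<tau>). integral {0..\<tau>} (\<lambda>t. w t * laplace_kernel y t) * dy + w \<tau> * exp (- (2 / y) * \<tau>) * d\<tau>))
      (at (snd (\<tau>, y), fst (\<tau>, y)))"
    using D by simp
  from has_derivative_compose[OF swap this]
  show ?thesis by (simp add: case_prod_beta' K_def add.commute)
qed

lemma ladder_lhs_has_derivative:
  assumes \<alpha>: "\<alpha> > 0" and y: "y > 1"
  shows "(ladder_lhs \<alpha> has_field_derivative ladder_lhs_deriv \<alpha> y) (at y)"
proof -
  have mu: "ladder_mu \<alpha> y > 0" using ladder_mu_pos[OF \<alpha> y] .
  have "(ladder_mu \<alpha> has_field_derivative \<alpha> * (ln y + 1)) (at y)"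
    unfolding ladder_mu_def[abs_def] using y by (auto intro!: derivative_eq_intros simp: field_simps)
  then have "(ladder_mu \<alpha> has_derivative (\<lambda>h. \<alpha> * (ln y + 1) * h)) (at y)"
    by (simp add: has_field_derivative_def)
  then have "((\<lambda>y. (ladder_mu \<alpha> y, y)) has_derivative (\<lambda>h. (\<alpha> * (ln y + 1) * h, h))) (at y)"
    by (intro has_derivative_Pair has_derivative_ident)
  from has_derivative_compose[OF this truncated_laplace_has_derivative[OF continuous_on_zeta_sq _ mu, of y]]
  have "(ladder_lhs \<alpha> has_derivative (\<lambda>h. zeta_sq (ladder_mu \<alpha> y) * exp (- (2 / y) * ladder_mu \<alpha> y) * (\<alpha> * (ln y + 1) * h)
      + integral {0..ladder_mu \<alpha> y} (\<lambda>t. zeta_sq t * laplace_kernel y t) * h)) (at y)"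
    using y by (simp add: ladder_lhs_def[abs_def])
  moreover have "(\<lambda>h. zeta_sq (ladder_mu \<alpha> y) * exp (- (2 / y) * ladder_mu \<alpha> y) * (\<alpha> * (ln y + 1) * h)
      + integral {0..ladder_mu \<alpha> y} (\<lambda>t. zeta_sq t * laplace_kernel y t) * h) = (*) (ladder_lhs_deriv \<alpha> y)"
    by (simp add: fun_eq_iff ladder_lhs_deriv_def algebra_simps)
  ultimately show ?thesis by (simp add: has_field_derivative_def)
qed

lemma power_le_fact_exp:
  fixes s :: real assumes "s \<ge> 0" shows "s ^ k \<le> fact k * exp s"
proof -
  have "(\<Sum>n\<in>{k}. inverse (fact n) * s ^ n) \<le> (\<Sum>n. inverse (fact n) * s ^ n)"
    using assms summable_exp[of s] by (intro sum_le_suminf) auto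
  also have "\<dots> = exp s" by (simp add: exp_def scaleR_conv_of_real)
  finally show ?thesis by (simp add: field_simps)
qed

lemma abs_mult_ln_le: "t \<ge> 0 \<Longrightarrow> \<bar>t * ln t\<bar> \<le> t\<^sup>2 + 1" for t :: real
proof (cases "t = 0")
  case False
  assume "t \<ge> 0"
  with False have t: "t > 0" by simp
  have "t * ln t \<le> t * t" using t ln_le_minus_one[OF t] by (intro mult_left_mono) auto
  moreover have "t * ln (1 / t) \<le> t * (1 / t)"
    using t ln_le_minus_one[of "1 / t"] by (intro mult_left_mono) auto
  then have "- (t * ln t) \<le> 1" using t by (simp add: ln_div)
  moreover have "t * t \<ge> 0" by simp
  ultimately show ?thesis unfolding power2_eq_square by linarith
qed simp

lemma abs_mult_ln_scaled_le:
  fixes t y :: real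
  assumes "t \<ge> 0" "y > 0"
  shows "\<bar>t * ln t - t * ln y\<bar> \<le> t\<^sup>2 / y + y"
proof (cases "t = 0")
  case False
  with assms have t: "t > 0" by simp
  define u where "u = t / y"
  have u: "u > 0" "t = u * y" using t assms by (auto simp: u_def)
  have "t * ln t - t * ln y = y * (u * ln u)" using u assms by (simp add: ln_mult algebra_simps)
  moreover have "\<bar>y * (u * ln u)\<bar> = y * \<bar>u * ln u\<bar>" using assms by (simp add: abs_mult)
  moreover have "y * \<bar>u * ln u\<bar> \<le> y * (u\<^sup>2 + 1)"
    using u assms by (intro mult_left_mono abs_mult_ln_le) auto
  moreover have "y * (u\<^sup>2 + 1) = t\<^sup>2 / y + y" using u assms by (simp add: power2_eq_square algebra_simps)
  ultimately show ?thesis by simp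
qed (use assms in simp)

lemma zeta_primitive_approx:
  assumes \<epsilon>: "\<epsilon> > 0"
  obtains C where "C > 0" "\<And>t. t \<ge> 0 \<Longrightarrow> \<bar>zeta_primitive t - t * ln t\<bar> \<le> \<epsilon> * \<bar>t * ln t\<bar> + C"
proof -
  have "\<forall>\<^sub>F t in at_top. dist (zeta_primitive t / (t * ln t)) 1 < \<epsilon>"
    by (rule tendstoD[OF zeta_primitive_asymp \<epsilon>])
  then obtain N0 where N0: "\<And>t. t \<ge> N0 \<Longrightarrow> dist (zeta_primitive t / (t * ln t)) 1 < \<epsilon>"
    by (auto simp: eventually_at_top_linorder)
  define N where "N = max N0 2"
  define C where "C = zeta_primitive N + N\<^sup>2 + 1"
  have C: "C > 0"
    using zeta_primitive_mono[of 0 N] by (simp add: C_def N_def add_nonneg_pos)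
  have "\<bar>zeta_primitive t - t * ln t\<bar> \<le> \<epsilon> * \<bar>t * ln t\<bar> + C" if t: "t \<ge> 0" for t
  proof (cases "t \<ge> N")
    case True
    then have tl: "t * ln t > 0" by (simp add: N_def)
    have "\<bar>zeta_primitive t / (t * ln t) - 1\<bar> * (t * ln t) \<le> \<epsilon> * (t * ln t)"
      using N0[of t] True tl by (intro mult_right_mono) (auto simp: dist_real_def N_def)
    also have "\<bar>zeta_primitive t / (t * ln t) - 1\<bar> * (t * ln t) = \<bar>(zeta_primitive t / (t * ln t) - 1) * (t * ln t)\<bar>"
      by (subst abs_mult) (simp only: abs_of_pos[OF tl])
    also have "(zeta_primitive t / (t * ln t) - 1) * (t * ln t) = zeta_primitive t - t * ln t"
      using less_imp_neq[OF tl] by (simp add: left_diff_distrib)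
    finally show ?thesis using tl C by simp
  next
    case False
    have "0 \<le> zeta_primitive t" "zeta_primitive t \<le> zeta_primitive N"
      using t False zeta_primitive_mono[of 0 t] zeta_primitive_mono[of t N] by auto
    moreover have "t\<^sup>2 \<le> N\<^sup>2" using t False by (intro power_mono) auto
    moreover have "0 \<le> \<epsilon> * \<bar>t * ln t\<bar>" using \<epsilon> by simp
    ultimately show ?thesis using abs_mult_ln_le[OF t] unfolding C_def by linarith
  qed
  with C show ?thesis by (rule that)
qed

text \<open>
  Comparison with the linear function \<open>t ln y\<close> rather than with \<open>t ln t\<close>: the kernel concentrates on
  \<open>t\<close> of size \<open>y\<close>, where the two agree up to \<open>O(y)\<close>, and the error \<open>t^2/y + y\<close>, valid for all
  \<open>t \<ge> 0\<close>, contributes \<open>O(1)\<close> after integration against the derivative of the kernel.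
\<close>

lemma zeta_primitive_approx_scaled:
  assumes \<epsilon>: "\<epsilon> > 0" "\<epsilon> \<le> 1"
  obtains C where "C > 0" "\<And>t y. t \<ge> 0 \<Longrightarrow> y \<ge> 1 \<Longrightarrow>
    \<bar>zeta_primitive t - t * ln y\<bar> \<le> \<epsilon> * (t * ln y) + C * (t\<^sup>2 / y + y)"
proof -
  obtain C where C: "C > 0" "\<And>t. t \<ge> 0 \<Longrightarrow> \<bar>zeta_primitive t - t * ln t\<bar> \<le> \<epsilon> * \<bar>t * ln t\<bar> + C"
    by (fact zeta_primitive_approx[OF \<epsilon>(1)])
  have "\<bar>zeta_primitive t - t * ln y\<bar> \<le> \<epsilon> * (t * ln y) + (2 + C) * (t\<^sup>2 / y + y)"
    if t: "t \<ge> 0" and y: "y \<ge> 1" for t y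
  proof -
    define b where "b = t\<^sup>2 / y + y"
    have b: "b \<ge> 1" using y by (simp add: b_def add_increasing)
    have d: "\<bar>t * ln t - t * ln y\<bar> \<le> b"
      unfolding b_def using t y by (intro abs_mult_ln_scaled_le) auto
    have ty: "t * ln y \<ge> 0" using t y by simp
    have "\<epsilon> * \<bar>t * ln t\<bar> \<le> \<epsilon> * (t * ln y + b)"
      using d ty \<epsilon> by (intro mult_left_mono) auto
    also have "\<dots> = \<epsilon> * (t * ln y) + \<epsilon> * b" by (simp add: distrib_left)
    also have "\<epsilon> * b \<le> 1 * b" using \<epsilon> b by (intro mult_right_mono) auto
    finally have "\<epsilon> * \<bar>t * ln t\<bar> \<le> \<epsilon> * (t * ln y) + b" by simp
    moreover have "C * 1 \<le> C * b" using C(1) b by (intro mult_left_mono) auto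
    ultimately have "\<bar>zeta_primitive t - t * ln y\<bar> \<le> \<epsilon> * (t * ln y) + (2 * b + C * b)"
      using C(2)[OF t] d by linarith
    then show ?thesis by (simp add: b_def distrib_right)
  qed
  then show ?thesis using C(1) by (intro that[of "2 + C"]) auto
qed

lemma laplace_kernel_has_derivative:
  assumes "y > 0"
  shows "(laplace_kernel y has_field_derivative (2 / y\<^sup>2) * (1 - 2 * (t / y)) * exp (- (2 / y) * t)) (at t within S)"
  unfolding laplace_kernel_def[abs_def] using assms
  by (auto intro!: derivative_eq_intros simp: field_simps power2_eq_square)

lemma laplace_kernel_integral:
  assumes y: "y > 0" and m: "m \<ge> 0"
  shows "(laplace_kernel y has_integral (1/2 - (m / y + 1/2) * exp (- 2 * (m / y)))) {0..m}"
proof -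
  have "(laplace_kernel y has_integral
      (- (m / y + 1/2) * exp (- (2 / y) * m) - (- (0 / y + 1/2) * exp (- (2 / y) * 0)))) {0..m}"
    unfolding laplace_kernel_def[abs_def] using y m
    by (intro fundamental_theorem_of_calculus)
       (auto intro!: derivative_eq_intros simp: field_simps power2_eq_square
          simp flip: has_real_derivative_iff_has_vector_derivative)
  then show ?thesis by (simp add: algebra_simps)
qed

lemma power_exp_bounds:
  fixes s :: real assumes "s \<ge> 0"
  shows "1 \<le> exp s" "s \<le> exp s" "s\<^sup>2 \<le> 2 * exp s" "s ^ 3 \<le> 6 * exp s"
  using power_le_fact_exp[OF assms, of 0] power_le_fact_exp[OF assms, of 1]
    power_le_fact_exp[OF assms, of 2] power_le_fact_exp[OF assms, of 3]
  by (simp_all add: fact_numeral)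

text \<open>
  Everything scales with \<open>s = t/y\<close>. The polynomial factors in \<open>s\<close> are absorbed by one of the two factors
  \<open>exp(-s)\<close> of \<open>exp(-2s)\<close>, using \<open>s^k \<le> k! exp(s)\<close>.
\<close>

lemma laplace_error_bounds:
  fixes y t L a c H :: real
  assumes y: "y > 0" and t: "t \<ge> 0" and nn: "a \<ge> 0" "c \<ge> 0"
    and H: "\<bar>H\<bar> \<le> a * t + c * (t\<^sup>2 / y + y)"
  shows "\<bar>H * ((2 / y\<^sup>2) * (1 - 2 * (t / y)) * exp (- (2 / y) * t))\<bar> \<le> (10 * a + 34 * c) * (exp (- (t / y)) / y)"
    and "\<bar>H * laplace_kernel y t\<bar> \<le> 4 * a + 14 * c"
proof -
  define s where "s = t / y"
  have s: "s \<ge> 0" "t = y * s" using y t by (auto simp: s_def)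
  note p = power_exp_bounds[OF s(1)]
  define E where "E = exp s"
  have E: "exp (- (2 / y) * t) = 1 / (E * E)" "exp (- (t / y)) = 1 / E" "E \<ge> 1"
    using p(1) y by (simp_all add: E_def s(2) exp_minus inverse_eq_divide flip: exp_add)
  have H': "\<bar>H\<bar> \<le> y * (a * s + c * (s\<^sup>2 + 1))"
    using H y unfolding s(2) by (simp add: power2_eq_square algebra_simps)
  have "\<bar>H * ((2 / y\<^sup>2) * (1 - 2 * (t / y)) * exp (- (2 / y) * t))\<bar>
      = \<bar>H\<bar> * ((2 / y\<^sup>2) * \<bar>1 - 2 * s\<bar> * (1 / (E * E)))"
  proof -
    have A: "\<bar>2 / y\<^sup>2\<bar> = 2 / y\<^sup>2" "\<bar>1 / (E * E)\<bar> = 1 / (E * E)" using y E(3) by simp_all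
    show ?thesis unfolding E s_def[symmetric] abs_mult A ..
  qed
  also have "\<dots> \<le> (y * (a * s + c * (s\<^sup>2 + 1))) * ((2 / y\<^sup>2) * (1 + 2 * s) * (1 / (E * E)))"
    using y s E(3) nn by (intro mult_mono H') (auto simp: abs_if)
  also have "\<dots> = 2 / y * (a * (s + 2 * s\<^sup>2) + c * (1 + 2 * s + s\<^sup>2 + 2 * s ^ 3)) / (E * E)"
    using y E(3) by (simp add: field_simps power2_eq_square power3_eq_cube)
  also have "\<dots> \<le> 2 / y * (a * (5 * E) + c * (17 * E)) / (E * E)"
    using p[folded E_def] y nn by (intro divide_right_mono mult_left_mono add_mono) auto
  also have "\<dots> = (10 * a + 34 * c) * (exp (- (t / y)) / y)"
    unfolding E using y E(3) by (simp add: field_simps)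
  finally show "\<bar>H * ((2 / y\<^sup>2) * (1 - 2 * (t / y)) * exp (- (2 / y) * t))\<bar> \<le> (10 * a + 34 * c) * (exp (- (t / y)) / y)" .
  have "\<bar>H * laplace_kernel y t\<bar> = \<bar>H\<bar> * (2 * s / y * (1 / (E * E)))"
    unfolding laplace_kernel_def E(1) using y s E(3) by (simp add: abs_mult power2_eq_square)
  also have "\<dots> \<le> (y * (a * s + c * (s\<^sup>2 + 1))) * (2 * s / y * (1 / (E * E)))"
    using y s E(3) by (intro mult_right_mono H') auto
  also have "\<dots> = 2 * ((a * s + c * (s\<^sup>2 + 1)) * s) / (E * E)" using y by simp
  also have "\<dots> = 2 * (a * s\<^sup>2 + c * (s ^ 3 + s)) / (E * E)"
  proof -
    have "(a * s + c * (s\<^sup>2 + 1)) * s = a * s\<^sup>2 + c * (s ^ 3 + s)"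
      by (simp add: algebra_simps power2_eq_square power3_eq_cube)
    then show ?thesis by simp
  qed
  also have "\<dots> \<le> 2 * (a * (2 * E) + c * (6 * E + E)) / (E * E)"
    using p[folded E_def] nn by (intro divide_right_mono mult_left_mono add_mono) auto
  also have "\<dots> = (4 * a + 14 * c) / E"
    using E(3) by (simp add: field_simps)
  also have "\<dots> \<le> (4 * a + 14 * c) / 1" using E(3) nn by (intro divide_left_mono) auto
  finally show "\<bar>H * laplace_kernel y t\<bar> \<le> 4 * a + 14 * c" by simp
qed

text \<open>
  Integration by parts replaces \<open>w - ln y\<close> by its primitive \<open>G(t) - t ln y\<close>, which is small in the sense
  of the hypothesis, so that \<open>w\<close> behaves like the constant \<open>ln y\<close> when averaged with the kernel.
\<close>

lemma zeta_laplace_integral_approx: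
  assumes y: "y \<ge> 1" and m: "m > 0" and a: "a \<ge> 0" and c: "c \<ge> 0"
    and H: "\<And>t. t \<ge> 0 \<Longrightarrow> \<bar>zeta_primitive t - t * ln y\<bar> \<le> a * t + c * (t\<^sup>2 / y + y)"
  shows "\<bar>integral {0..m} (\<lambda>t. zeta_sq t * laplace_kernel y t) - ln y * (1/2 - (m / y + 1/2) * exp (- 2 * (m / y)))\<bar>
           \<le> 14 * a + 48 * c"
proof -
  define H where "H t = zeta_primitive t - t * ln y" for t
  define q where "q = laplace_kernel y"
  define q' where "q' t = (2 / y\<^sup>2) * (1 - 2 * (t / y)) * exp (- (2 / y) * t)" for t
  have y0: "y > 0" using y by simp
  have Hb: "\<bar>H t\<bar> \<le> a * t + c * (t\<^sup>2 / y + y)" if "t \<ge> 0" for t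
    unfolding H_def by (rule assms(5)[OF that])
  have dq: "(q has_field_derivative q' t) (at t within S)" for t S
    unfolding q_def q'_def by (rule laplace_kernel_has_derivative[OF y0])
  have contG: "continuous_on {0..m} zeta_primitive"
    unfolding zeta_primitive_def[abs_def] by (intro indefinite_integral_continuous_1 zeta_sq_integrable)
  have contq: "continuous_on {0..m} q" by (rule DERIV_continuous_on[OF dq])
  have contH: "continuous_on {0..m} H" unfolding H_def[abs_def] by (intro continuous_intros contG)
  have contq': "continuous_on {0..m} q'" unfolding q'_def[abs_def] using y0 by (intro continuous_intros) auto
  have intHq': "(\<lambda>t. H t * q' t) integrable_on {0..m}"
    by (intro integrable_continuous_interval continuous_intros contH contq')
  define J where "J = integral {0..m} (\<lambda>t. H t * q' t)"
  have "((\<lambda>t. (zeta_sq t - ln y) * q t) has_integral (H m * q m - H 0 * q 0 - J)) {0..m}"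
  proof (rule integration_by_parts_interior[OF bounded_bilinear_mult, of 0 m H q _ q'])
    show "((\<lambda>t. H t * q' t) has_integral (H m * q m - H 0 * q 0 - (H m * q m - H 0 * q 0 - J))) {0..m}"
      unfolding J_def using integrable_integral[OF intHq'] by simp
    fix t assume t: "t \<in> {0<..<m}"
    have "(H has_field_derivative zeta_sq t - 1 * ln y) (at t)"
      unfolding H_def[abs_def] using t
      by (intro DERIV_diff zeta_primitive_has_derivative DERIV_cmult_right DERIV_ident) auto
    then show "(H has_vector_derivative zeta_sq t - ln y) (at t)"
      by (simp add: has_real_derivative_iff_has_vector_derivative)
    show "(q has_vector_derivative q' t) (at t)"
      using dq by (simp add: has_real_derivative_iff_has_vector_derivative)
  qed (use m contH contq in auto)
  moreover have "q 0 = 0" by (simp add: q_def laplace_kernel_def)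
  ultimately have 1: "((\<lambda>t. (zeta_sq t - ln y) * q t) has_integral (H m * q m - J)) {0..m}" by simp
  have "((\<lambda>t. ln y * q t) has_integral ln y * (1/2 - (m / y + 1/2) * exp (- 2 * (m / y)))) {0..m}"
    unfolding q_def using y0 m by (intro has_integral_mult_right laplace_kernel_integral) auto
  from has_integral_add[OF 1 this]
  have "((\<lambda>t. zeta_sq t * q t) has_integral (H m * q m - J) + ln y * (1/2 - (m / y + 1/2) * exp (- 2 * (m / y)))) {0..m}"
    by (simp add: algebra_simps)
  then have eq: "integral {0..m} (\<lambda>t. zeta_sq t * q t) - ln y * (1/2 - (m / y + 1/2) * exp (- 2 * (m / y))) = H m * q m - J"
    by (simp add: integral_unique)
  have "((\<lambda>t. exp (- (t / y)) / y) has_integral (- exp (- (m / y)) - (- exp (- (0 / y))))) {0..m}"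
    using y0 m by (intro fundamental_theorem_of_calculus)
      (auto intro!: derivative_eq_intros simp flip: has_real_derivative_iff_has_vector_derivative)
  then have int_exp: "((\<lambda>t. (10 * a + 34 * c) * (exp (- (t / y)) / y)) has_integral (10 * a + 34 * c) * (1 - exp (- (m / y)))) {0..m}"
    by (intro has_integral_mult_right) simp
  have "norm J \<le> integral {0..m} (\<lambda>t. (10 * a + 34 * c) * (exp (- (t / y)) / y))"
    unfolding J_def
  proof (rule integral_norm_bound_integral[OF intHq'])
    show "(\<lambda>t. (10 * a + 34 * c) * (exp (- (t / y)) / y)) integrable_on {0..m}" using int_exp by blast
    show "norm (H t * q' t) \<le> (10 * a + 34 * c) * (exp (- (t / y)) / y)" if "t \<in> {0..m}" for t
      unfolding q'_def real_norm_def using that by (intro laplace_error_bounds y0 a c Hb) auto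
  qed
  also have "\<dots> = (10 * a + 34 * c) * (1 - exp (- (m / y)))" using int_exp by (rule integral_unique)
  also have "\<dots> \<le> (10 * a + 34 * c) * 1" using a c by (intro mult_left_mono) auto
  finally have "\<bar>J\<bar> \<le> 10 * a + 34 * c" by simp
  moreover have "\<bar>H m * q m\<bar> \<le> 4 * a + 14 * c"
    unfolding q_def using m by (intro laplace_error_bounds(2)[OF y0 _ a c Hb]) auto
  ultimately have "\<bar>H m * q m - J\<bar> \<le> 14 * a + 48 * c" by linarith
  then show ?thesis using eq unfolding q_def by simp
qed

text \<open>
  The kernel has total mass \<open>1/2\<close> on the half-line. Truncation at \<open>\<alpha> y ln y\<close>, that is at \<open>s = \<alpha> ln y\<close>, costs
  factors \<open>exp(-2s) = y^(-2\<alpha>)\<close>. With \<open>\<alpha> \<ge> 7\<close> they outweigh the quadratic bound of \<open>w\<close> in the boundary term.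
\<close>

lemma ladder_lhs_deriv_asymp:
  assumes \<alpha>: "\<alpha> \<in> {7..8}"
  shows "((\<lambda>y. ladder_lhs_deriv \<alpha> y / ln y) \<longlongrightarrow> 1/2) at_top"
proof (rule tendstoI)
  fix e :: real assume e: "e > 0"
  define \<epsilon> where "\<epsilon> = min 1 (e / 28)"
  have \<epsilon>: "\<epsilon> > 0" "\<epsilon> \<le> 1" "28 * \<epsilon> \<le> e" using e by (simp_all add: \<epsilon>_def min_def)
  obtain C where C: "C > 0" "\<And>t y. t \<ge> 0 \<Longrightarrow> y \<ge> 1 \<Longrightarrow>
    \<bar>zeta_primitive t - t * ln y\<bar> \<le> \<epsilon> * (t * ln y) + C * (t\<^sup>2 / y + y)"
    by (fact zeta_primitive_approx_scaled[OF \<epsilon>(1,2)])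
  obtain D where D: "D > 0" "\<And>t. t \<ge> 1 \<Longrightarrow> zeta_sq t \<le> D * t\<^sup>2"
    by (fact zeta_sq_quadratic_bound)
  define K where "K = 48 * C + 3 + 22 * D"
  have main: "\<bar>ladder_lhs_deriv \<alpha> y - ln y / 2\<bar> \<le> 14 * \<epsilon> * ln y + K" if y: "y \<ge> 3" for y
  proof -
    define L where "L = ln y"
    define s where "s = \<alpha> * L"
    define E where "E = exp s"
    have "ln (exp 1) \<le> ln y" using y exp_le by (intro ln_mono) auto
    then have L: "L \<ge> 1" by (simp add: L_def)
    have "s \<ge> 7 * L" "s \<le> 8 * L" using \<alpha> L by (auto simp: s_def)
    with L have s: "s \<ge> 7 * L" "s \<le> 8 * L" "s \<ge> 7" by linarith+
    have mu: "ladder_mu \<alpha> y = y * s" by (simp add: ladder_mu_def s_def L_def)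
    have "1 * 1 \<le> y * s" using y s by (intro mult_mono) auto
    then have ys: "y * s \<ge> 1" by simp
    note p = power_exp_bounds[of s]
    have E: "E \<ge> 1" "s \<le> E" "s\<^sup>2 \<le> 2 * E" "s ^ 3 \<le> 6 * E" using p s by (auto simp: E_def)
    have exp2: "exp (- 2 * s) = 1 / (E * E)" by (simp add: E_def exp_minus inverse_eq_divide flip: exp_add)
    have 1: "\<bar>integral {0..y * s} (\<lambda>t. zeta_sq t * laplace_kernel y t) - L * (1/2 - (s + 1/2) * exp (- 2 * s))\<bar>
        \<le> 14 * (\<epsilon> * L) + 48 * C"
    proof -
      have H: "\<bar>zeta_primitive t - t * ln y\<bar> \<le> \<epsilon> * L * t + C * (t\<^sup>2 / y + y)" if "t \<ge> 0" for t
      proof -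
        have eq: "\<epsilon> * (t * ln y) = \<epsilon> * L * t" by (simp add: L_def)
        have "1 \<le> y" using y by simp
        from C(2)[OF that this] show ?thesis unfolding eq .
      qed
      have "\<bar>integral {0..y * s} (\<lambda>t. zeta_sq t * laplace_kernel y t)
          - ln y * (1/2 - (y * s / y + 1/2) * exp (- 2 * (y * s / y)))\<bar> \<le> 14 * (\<epsilon> * L) + 48 * C"
      proof (rule zeta_laplace_integral_approx)
        show "y \<ge> 1" "y * s > 0" "\<epsilon> * L \<ge> 0" "C \<ge> 0" using y ys \<epsilon> L C(1) by simp_all
      qed (fact H)
      moreover have "y * s / y = s" using y by simp
      ultimately show ?thesis unfolding L_def[symmetric] by (simp only:)
    qed
    have 2: "0 \<le> L * ((s + 1/2) * exp (- 2 * s))" "L * ((s + 1/2) * exp (- 2 * s)) \<le> 3"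
    proof -
      show "0 \<le> L * ((s + 1/2) * exp (- 2 * s))" using L s by simp
      have "L * ((s + 1/2) * exp (- 2 * s)) \<le> s * ((s + 1) * exp (- 2 * s))"
        using L s by (intro mult_mono mult_right_mono) auto
      also have "\<dots> = (s\<^sup>2 + s) / (E * E)" unfolding exp2 by (simp add: power2_eq_square algebra_simps)
      also have "\<dots> \<le> (2 * E + E) / (E * E)" using E by (intro divide_right_mono add_mono) auto
      also have "\<dots> = 3 / E" using E(1) by simp
      also have "\<dots> \<le> 3 / 1" using E(1) by (intro divide_left_mono) auto
      finally show "L * ((s + 1/2) * exp (- 2 * s)) \<le> 3" by simp
    qed
    have 3: "0 \<le> zeta_sq (y * s) * exp (- 2 * s) * (\<alpha> * (L + 1))"
      "zeta_sq (y * s) * exp (- 2 * s) * (\<alpha> * (L + 1)) \<le> 22 * D"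
    proof -
      show "0 \<le> zeta_sq (y * s) * exp (- 2 * s) * (\<alpha> * (L + 1))"
        using L \<alpha> by (intro mult_nonneg_nonneg zeta_sq_nonneg exp_ge_zero add_nonneg_nonneg) simp_all
      \<comment> \<open>\<open>y^2 \<le> exp(s)\<close>, as \<open>2 ln y \<le> \<alpha> ln y\<close>\<close>
      have "exp L = y" using y by (simp add: L_def)
      then have "y\<^sup>2 = exp (2 * L)" unfolding mult_2 exp_add power2_eq_square by simp
      also have "\<dots> \<le> E" unfolding E_def using s L by simp
      finally have yE: "y\<^sup>2 \<le> E" .
      have "zeta_sq (y * s) \<le> D * (y * s)\<^sup>2" by (rule D(2)[OF ys])
      also have "\<dots> \<le> D * (E * s\<^sup>2)" unfolding power_mult_distrib
        using D(1) yE by (intro mult_left_mono mult_right_mono) auto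
      finally have z: "zeta_sq (y * s) \<le> D * (E * s\<^sup>2)" .
      have "zeta_sq (y * s) * exp (- 2 * s) * (\<alpha> * (L + 1)) \<le> D * (E * s\<^sup>2) * exp (- 2 * s) * (s + 8)"
      proof (intro mult_mono mult_right_mono z)
        show "\<alpha> * (L + 1) \<le> s + 8" using \<alpha> by (simp add: s_def distrib_left)
        show "0 \<le> \<alpha> * (L + 1)" using \<alpha> L by simp
      qed (use D(1) E(1) in simp_all)
      also have "\<dots> = D * (s ^ 3 + 8 * s\<^sup>2) / E"
      proof -
        have "s\<^sup>2 * (s + 8) = s ^ 3 + 8 * s\<^sup>2" by (simp add: algebra_simps power2_eq_square power3_eq_cube)
        moreover have "D * (E * s\<^sup>2) * (1 / (E * E)) * (s + 8) = D * (s\<^sup>2 * (s + 8)) / E" using E(1) by simp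
        ultimately show ?thesis unfolding exp2 by simp
      qed
      also have "\<dots> \<le> D * (6 * E + 8 * (2 * E)) / E"
        using E D(1) by (intro divide_right_mono mult_left_mono add_mono) auto
      also have "\<dots> = 22 * D" using E(1) by simp
      finally show "zeta_sq (y * s) * exp (- 2 * s) * (\<alpha> * (L + 1)) \<le> 22 * D" .
    qed
    have "ladder_lhs_deriv \<alpha> y = integral {0..y * s} (\<lambda>t. zeta_sq t * laplace_kernel y t)
        + zeta_sq (y * s) * exp (- 2 * s) * (\<alpha> * (L + 1))"
      unfolding ladder_lhs_deriv_def mu L_def using y by simp
    moreover have "L * (1/2 - (s + 1/2) * exp (- 2 * s)) = L / 2 - L * ((s + 1/2) * exp (- 2 * s))"
      by (simp add: right_diff_distrib)
    moreover have "\<bar>i + w - L / 2\<bar> \<le> 14 * \<epsilon> * L + K"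
      if "\<bar>i - (L / 2 - x)\<bar> \<le> 14 * (\<epsilon> * L) + 48 * C" "0 \<le> x" "x \<le> 3" "0 \<le> w" "w \<le> 22 * D" for i w x
      using that unfolding K_def mult.assoc abs_le_iff by linarith
    ultimately show ?thesis using 1 2 3 unfolding L_def[symmetric] by (simp only:)
  qed
  have "((\<lambda>y. K / ln y) \<longlongrightarrow> 0) at_top" by real_asymp
  then have "\<forall>\<^sub>F y in at_top. K / ln y < e / 2"
    by (rule order_tendstoD(2)) (use e in simp)
  with eventually_ge_at_top[of 3] show "\<forall>\<^sub>F y in at_top. dist (ladder_lhs_deriv \<alpha> y / ln y) (1/2) < e"
  proof eventually_elim
    case (elim y)
    have L: "ln y > 0" using elim by simp
    have "dist (ladder_lhs_deriv \<alpha> y / ln y) (1/2) = \<bar>(ladder_lhs_deriv \<alpha> y - ln y / 2) / ln y\<bar>"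
      using L by (simp add: dist_real_def diff_divide_distrib)
    also have "\<dots> = \<bar>ladder_lhs_deriv \<alpha> y - ln y / 2\<bar> / ln y" using L by simp
    also have "\<dots> \<le> (14 * \<epsilon> * ln y + K) / ln y" using L main[OF elim(1)] by (intro divide_right_mono) auto
    also have "\<dots> = 14 * \<epsilon> + K / ln y" using L by (simp add: add_divide_distrib)
    also have "\<dots> < e / 2 + e / 2" using elim(2) \<epsilon>(3) by (intro add_le_less_mono) simp_all
    also have "\<dots> = e" by simp
    finally show ?case .
  qed
qed

section \<open>Regularity and size of the ladder\<close>

lemma ln_zeta_primitive_asymp: "((\<lambda>T. ln (zeta_primitive T) / ln T) \<longlongrightarrow> 1) at_top"
proof -
  have "((\<lambda>T. ln (zeta_primitive T / (T * ln T))) \<longlongrightarrow> ln 1) at_top"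
    by (intro tendsto_ln zeta_primitive_asymp) simp
  moreover have "((\<lambda>T::real. 1 / ln T) \<longlongrightarrow> 0) at_top" "((\<lambda>T::real. ln (T * ln T) / ln T) \<longlongrightarrow> 1) at_top"
    by real_asymp+
  ultimately have "((\<lambda>T. ln (zeta_primitive T / (T * ln T)) * (1 / ln T) + ln (T * ln T) / ln T) \<longlongrightarrow> ln 1 * 0 + 1) at_top"
    by (intro tendsto_add tendsto_mult)
  moreover have "\<forall>\<^sub>F T in at_top. ln (zeta_primitive T / (T * ln T)) * (1 / ln T) + ln (T * ln T) / ln T
      = ln (zeta_primitive T) / ln T"
    using eventually_gt_at_top[of 1]
  proof eventually_elim
    case (elim T)
    have "zeta_primitive T > 0" using zeta_primitive_strict_mono[of 0 T] elim by simp
    moreover have "T \<noteq> 0" "ln T \<noteq> 0" using elim by auto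
    ultimately have "ln (zeta_primitive T / (T * ln T)) = ln (zeta_primitive T) - ln (T * ln T)"
      by (simp add: ln_div)
    then show ?case by (simp add: diff_divide_distrib)
  qed
  ultimately have "((\<lambda>T. ln (zeta_primitive T) / ln T) \<longlongrightarrow> ln 1 * 0 + 1) at_top"
    by (rule Lim_transform_eventually)
  then show ?thesis by simp
qed

lemma ladder_lhs_bounds:
  assumes \<alpha>: "\<alpha> > 0" and y: "y > 1" "\<alpha> * ln y \<ge> 1"
  shows "exp (- 2) * zeta_primitive y \<le> ladder_lhs \<alpha> y" "ladder_lhs \<alpha> y \<le> zeta_primitive (ladder_mu \<alpha> y)"
proof -
  have "y * 1 \<le> y * (\<alpha> * ln y)" using y by (intro mult_left_mono) auto
  then have mu: "y \<le> ladder_mu \<alpha> y" by (simp add: ladder_mu_def mult_ac)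
  have int: "(\<lambda>t. zeta_sq t * exp (- (2 / y) * t)) integrable_on {a..b}" for a b
    by (intro integrable_continuous_interval continuous_intros continuous_on_zeta_sq)
  have "exp (- 2) * zeta_primitive y = integral {0..y} (\<lambda>t. exp (- 2) * zeta_sq t)"
    unfolding zeta_primitive_def by simp
  also have "\<dots> \<le> integral {0..y} (\<lambda>t. zeta_sq t * exp (- (2 / y) * t))"
  proof (intro integral_le int integrable_on_mult_right zeta_sq_integrable)
    fix t assume t: "t \<in> {0..y}"
    have "exp (- 2) \<le> exp (- (2 / y) * t)" using t y by (simp add: field_simps)
    then show "exp (- 2) * zeta_sq t \<le> zeta_sq t * exp (- (2 / y) * t)"
      by (subst mult.commute) (intro mult_left_mono zeta_sq_nonneg)
  qed
  also have "\<dots> \<le> ladder_lhs \<alpha> y"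
    unfolding ladder_lhs_def using mu by (intro integral_subset_le int) auto
  finally show "exp (- 2) * zeta_primitive y \<le> ladder_lhs \<alpha> y" .
  show "ladder_lhs \<alpha> y \<le> zeta_primitive (ladder_mu \<alpha> y)"
    unfolding ladder_lhs_def zeta_primitive_def
    using y by (intro integral_le int zeta_sq_integrable) (auto intro!: mult_left_le)
qed

text \<open>
  On the logarithmic scale the crude bounds of the preceding lemma already determine \<open>F\<close>.
\<close>

lemma ln_ladder_lhs_asymp:
  assumes \<alpha>: "\<alpha> > 0"
  shows "((\<lambda>y. ln (ladder_lhs \<alpha> y) / ln y) \<longlongrightarrow> 1) at_top"
proof (rule tendsto_sandwich)
  have large: "\<forall>\<^sub>F y in at_top. y > 1 \<and> \<alpha> * ln y \<ge> 1"
    using \<alpha> by (intro eventually_conj) real_asymp+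
  have bounds: "y > 1 \<and> \<alpha> * ln y \<ge> 1 \<Longrightarrow> 0 < zeta_primitive y \<and> 0 < ln y
      \<and> exp (- 2) * zeta_primitive y \<le> ladder_lhs \<alpha> y \<and> ladder_lhs \<alpha> y \<le> zeta_primitive (ladder_mu \<alpha> y)" for y
    using ladder_lhs_bounds[OF \<alpha>, of y] zeta_primitive_strict_mono[of 0 y] by simp
  show "\<forall>\<^sub>F y in at_top. (- 2) * (1 / ln y) + ln (zeta_primitive y) / ln y \<le> ln (ladder_lhs \<alpha> y) / ln y"
    using large
  proof eventually_elim
    case (elim y)
    note b = bounds[OF elim]
    have "ln (exp (- 2) * zeta_primitive y) \<le> ln (ladder_lhs \<alpha> y)"
      using b by (intro ln_mono) auto
    then have "- 2 + ln (zeta_primitive y) \<le> ln (ladder_lhs \<alpha> y)" using b by (simp add: ln_mult)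
    then have "(- 2 + ln (zeta_primitive y)) / ln y \<le> ln (ladder_lhs \<alpha> y) / ln y"
      using b by (intro divide_right_mono) auto
    then show ?case by (simp add: add_divide_distrib diff_divide_distrib)
  qed
  have "filterlim (\<lambda>y. ladder_mu \<alpha> y) at_top at_top" unfolding ladder_mu_def using \<alpha> by real_asymp
  from filterlim_compose[OF ln_zeta_primitive_asymp this]
  have 1: "((\<lambda>y. ln (zeta_primitive (ladder_mu \<alpha> y)) / ln (ladder_mu \<alpha> y)) \<longlongrightarrow> 1) at_top" .
  have 2: "((\<lambda>y. ln (ladder_mu \<alpha> y) / ln y) \<longlongrightarrow> 1) at_top" unfolding ladder_mu_def using \<alpha> by real_asymp
  have "((\<lambda>y. ln (zeta_primitive (ladder_mu \<alpha> y)) / ln (ladder_mu \<alpha> y) * (ln (ladder_mu \<alpha> y) / ln y)) \<longlongrightarrow> 1 * 1) at_top"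
    by (intro tendsto_mult 1 2)
  then show "((\<lambda>y. ln (zeta_primitive (ladder_mu \<alpha> y)) / ln (ladder_mu \<alpha> y) * (ln (ladder_mu \<alpha> y) / ln y)) \<longlongrightarrow> 1) at_top"
    by simp
  have "\<forall>\<^sub>F y in at_top. ladder_mu \<alpha> y > 1" unfolding ladder_mu_def using \<alpha> by real_asymp
  with large show "\<forall>\<^sub>F y in at_top. ln (ladder_lhs \<alpha> y) / ln y
      \<le> ln (zeta_primitive (ladder_mu \<alpha> y)) / ln (ladder_mu \<alpha> y) * (ln (ladder_mu \<alpha> y) / ln y)"
  proof eventually_elim
    case (elim y)
    note b = bounds[OF elim(1)]
    have "0 < ladder_lhs \<alpha> y" using b by (meson exp_gt_zero mult_pos_pos order.strict_trans2)
    then have "ln (ladder_lhs \<alpha> y) \<le> ln (zeta_primitive (ladder_mu \<alpha> y))"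
      using b by (intro ln_mono) auto
    then have "ln (ladder_lhs \<alpha> y) / ln y \<le> ln (zeta_primitive (ladder_mu \<alpha> y)) / ln y"
      using b by (intro divide_right_mono) auto
    moreover have "ln (ladder_mu \<alpha> y) \<noteq> 0" using elim(2) by simp
    ultimately show ?case by simp
  qed
  have 0: "((\<lambda>y::real. 1 / ln y) \<longlongrightarrow> 0) at_top" by real_asymp
  have "((\<lambda>y. (- 2) * (1 / ln y) + ln (zeta_primitive y) / ln y) \<longlongrightarrow> (- 2) * 0 + 1) at_top"
    by (intro tendsto_add tendsto_mult tendsto_const 0 ln_zeta_primitive_asymp)
  then show "((\<lambda>y. (- 2) * (1 / ln y) + ln (zeta_primitive y) / ln y) \<longlongrightarrow> 1) at_top" by simp
qed

locale ladder_solution =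
  fixes \<alpha> T\<^sub>0 :: real and \<phi> :: "real \<Rightarrow> real"
  assumes alpha: "\<alpha> \<in> {7..8}" and solution: "solves_ladder_equation \<alpha> T\<^sub>0 \<phi>"
begin

lemma ladder_equation: "T \<ge> T\<^sub>0 \<Longrightarrow> ladder_lhs \<alpha> (\<phi> T) = zeta_primitive T"
proof -
  have "(cmod (hardy_Z t))\<^sup>2 = zeta_sq t" for t
    by (simp add: hardy_Z_def zeta_sq_def norm_mult)
  then show "T \<ge> T\<^sub>0 \<Longrightarrow> ?thesis"
    using solution unfolding solves_ladder_equation_def ladder_lhs_def zeta_primitive_def by simp
qed

lemma phi_at_top: "filterlim \<phi> at_top at_top"
  using solution unfolding solves_ladder_equation_def by blast

text \<open>
  The denominator in \<open>\<phi>\<^sub>1' = w / \<omega>\<close>.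
\<close>

definition omega :: "real \<Rightarrow> real" where
  "omega T = 2 * ladder_lhs_deriv \<alpha> (\<phi> T)"

lemma ln_phi_asymp: "((\<lambda>T. ln (\<phi> T) / ln T) \<longlongrightarrow> 1) at_top"
proof -
  have \<alpha>: "\<alpha> > 0" using alpha by simp
  have "((\<lambda>T. ln (ladder_lhs \<alpha> (\<phi> T)) / ln (\<phi> T)) \<longlongrightarrow> 1) at_top"
    by (rule filterlim_compose[OF ln_ladder_lhs_asymp[OF \<alpha>] phi_at_top])
  from tendsto_divide[OF ln_zeta_primitive_asymp this]
  have "((\<lambda>T. (ln (zeta_primitive T) / ln T) / (ln (ladder_lhs \<alpha> (\<phi> T)) / ln (\<phi> T))) \<longlongrightarrow> 1) at_top"
    by simp
  moreover have "\<forall>\<^sub>F T in at_top. ln (zeta_primitive T) / ln T > 1/2"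
    by (rule order_tendstoD[OF ln_zeta_primitive_asymp]) simp
  then have "\<forall>\<^sub>F T in at_top. (ln (zeta_primitive T) / ln T) / (ln (ladder_lhs \<alpha> (\<phi> T)) / ln (\<phi> T)) = ln (\<phi> T) / ln T"
    using eventually_ge_at_top[of T\<^sub>0]
  proof eventually_elim
    case (elim T)
    have "ln (zeta_primitive T) \<noteq> 0" using elim(1) by auto
    then show ?case using ladder_equation[OF elim(2)] by simp
  qed
  ultimately show ?thesis by (rule Lim_transform_eventually)
qed

lemma omega_asymp: "((\<lambda>T. omega T / ln T) \<longlongrightarrow> 1) at_top"
proof -
  have "((\<lambda>T. ladder_lhs_deriv \<alpha> (\<phi> T) / ln (\<phi> T)) \<longlongrightarrow> 1/2) at_top"
    by (rule filterlim_compose[OF ladder_lhs_deriv_asymp[OF alpha] phi_at_top])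
  from tendsto_mult[OF tendsto_mult[OF tendsto_const[of 2] this] ln_phi_asymp]
  have "((\<lambda>T. 2 * (ladder_lhs_deriv \<alpha> (\<phi> T) / ln (\<phi> T)) * (ln (\<phi> T) / ln T)) \<longlongrightarrow> 1) at_top" by simp
  moreover have "\<forall>\<^sub>F T in at_top. \<phi> T > 1" using phi_at_top by (simp add: filterlim_at_top_dense)
  then have "\<forall>\<^sub>F T in at_top. 2 * (ladder_lhs_deriv \<alpha> (\<phi> T) / ln (\<phi> T)) * (ln (\<phi> T) / ln T) = omega T / ln T"
    by eventually_elim (auto simp: omega_def)
  ultimately show ?thesis by (rule Lim_transform_eventually)
qed

text \<open>
  For large arguments \<open>F\<close> is strictly increasing with positive derivative, so \<open>\<phi>\<close> inherits monotonicity, continuity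
  and differentiability from \<open>G\<close>. The last conclusion compares with every \<open>T' \<ge> T\<^sub>0\<close>, also where
  \<open>\<phi>\<close> need not be regular: \<open>\<phi>(T') = \<phi>(T)\<close> forces \<open>G(T') = G(T)\<close>, and \<open>G\<close> is injective on \<open>[0, \<infinity>)\<close>.
\<close>

lemma jacob_ladder_regular:
  obtains A where "A > 1" "A \<ge> T\<^sub>0"
    "\<And>T. T \<ge> A \<Longrightarrow> omega T > 0"
    "\<And>T. T \<ge> A \<Longrightarrow> (jacob_ladder \<phi> has_field_derivative zeta_sq T / omega T) (at T)"
    "\<And>T T'. A \<le> T \<Longrightarrow> T < T' \<Longrightarrow> jacob_ladder \<phi> T < jacob_ladder \<phi> T'"
    "\<And>T T'. A \<le> T \<Longrightarrow> T' \<ge> T\<^sub>0 \<Longrightarrow> jacob_ladder \<phi> T' = jacob_ladder \<phi> T \<Longrightarrow> T' = T"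
proof -
  define F where "F = ladder_lhs \<alpha>"
  define F' where "F' = ladder_lhs_deriv \<alpha>"
  have \<alpha>: "\<alpha> > 0" using alpha by simp
  have "\<forall>\<^sub>F y in at_top. F' y / ln y > 0"
    unfolding F'_def by (rule order_tendstoD[OF ladder_lhs_deriv_asymp[OF alpha]]) simp
  with eventually_gt_at_top[of 1] have "\<forall>\<^sub>F y in at_top. 1 < y \<and> F' y > 0"
    by eventually_elim (auto simp: zero_less_divide_iff)
  then obtain y0 where y0: "\<And>y. y \<ge> y0 \<Longrightarrow> 1 < y \<and> F' y > 0"
    by (auto simp: eventually_at_top_linorder)
  have dF: "(F has_field_derivative F' y) (at y)" if "y \<ge> y0" for y
    unfolding F_def F'_def using ladder_lhs_has_derivative[OF \<alpha>] y0[OF that] by blast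
  have F_less: "F x < F y" if "y0 \<le> x" "x < y" for x y
  proof (rule DERIV_pos_imp_increasing[OF that(2)])
    fix z assume "x \<le> z" "z \<le> y"
    then have "z \<ge> y0" using that by simp
    from dF[OF this] y0[OF this] show "\<exists>D. (F has_field_derivative D) (at z) \<and> 0 < D" by blast
  qed
  have "\<forall>\<^sub>F T in at_top. \<phi> T \<ge> y0 + 1" using phi_at_top by (simp add: filterlim_at_top)
  then obtain B where B: "\<And>T. T \<ge> B \<Longrightarrow> \<phi> T \<ge> y0 + 1"
    by (auto simp: eventually_at_top_linorder)
  define A where "A = max (max B T\<^sub>0) 1 + 1"
  have A: "A > 1" "A \<ge> T\<^sub>0" using A_def by auto
  have \<phi>: "\<phi> T > y0" "F (\<phi> T) = zeta_primitive T" "T > 0" if "T > A - 1" for T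
  proof -
    have "T \<ge> B" "T \<ge> T\<^sub>0" "T > 0" using that by (auto simp: A_def)
    then show "\<phi> T > y0" "F (\<phi> T) = zeta_primitive T" "T > 0"
      using B[of T] ladder_equation[of T] by (auto simp: F_def)
  qed
  have less: "\<phi> T < \<phi> T'" if "T > A - 1" "T < T'" for T T'
  proof (rule ccontr)
    assume "\<not> \<phi> T < \<phi> T'"
    then have "F (\<phi> T') \<le> F (\<phi> T)"
      using F_less[of "\<phi> T'" "\<phi> T"] \<phi>(1)[of T'] that by (cases "\<phi> T' = \<phi> T") auto
    then show False
      using zeta_primitive_strict_mono[of T T'] \<phi>[of T] \<phi>[of T'] that by simp
  qed
  have near: "\<forall>\<^sub>F T' in at T. T' > A - 1" if "T > A - 1" for T
    using eventually_at_in_open'[of "{A - 1<..}" T] that by auto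
  have prim: "(zeta_primitive \<longlongrightarrow> zeta_primitive T) (at T)" if "T > A - 1" for T
    using DERIV_isCont[OF zeta_primitive_has_derivative[OF \<phi>(3)[OF that]]] by (simp add: isCont_def)
  have cont: "isCont \<phi> T" if T: "T > A - 1" for T
    unfolding isCont_def
  proof (rule order_tendstoI)
    fix c assume c: "c < \<phi> T"
    define d where "d = max c y0"
    have d: "d \<ge> y0" "d \<ge> c" "d < \<phi> T" using c \<phi>(1)[OF T] by (auto simp: d_def)
    have "F d < zeta_primitive T" using F_less[of d "\<phi> T"] d \<phi>(2)[OF T] by simp
    from order_tendstoD(1)[OF prim[OF T] this] near[OF T]
    show "\<forall>\<^sub>F T' in at T. c < \<phi> T'"
    proof eventually_elim
      case (elim T')
      show ?case
      proof (rule ccontr)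
        assume "\<not> c < \<phi> T'"
        then have "\<phi> T' \<le> d" using d by simp
        then have "F (\<phi> T') \<le> F d"
          using F_less[of "\<phi> T'" d] \<phi>(1)[OF elim(2)] by (cases "\<phi> T' = d") auto
        then show False using elim(1) \<phi>(2)[OF elim(2)] by simp
      qed
    qed
  next
    fix c assume c: "\<phi> T < c"
    have "zeta_primitive T < F c" using F_less[of "\<phi> T" c] c \<phi>(1,2)[OF T] by simp
    from order_tendstoD(2)[OF prim[OF T] this] near[OF T]
    show "\<forall>\<^sub>F T' in at T. \<phi> T' < c"
    proof eventually_elim
      case (elim T')
      show ?case
      proof (rule ccontr)
        assume "\<not> \<phi> T' < c"
        then have "F c \<le> F (\<phi> T')"
          using F_less[of c "\<phi> T'"] c \<phi>(1)[OF T] by (cases "\<phi> T' = c") auto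
        then show False using elim(1) \<phi>(2)[OF elim(2)] by simp
      qed
    qed
  qed
  have deriv: "(\<phi> has_field_derivative zeta_sq T / F' (\<phi> T)) (at T)" if T: "T > A - 1" for T
  proof -
    have "(F has_field_derivative F' (\<phi> T)) (at (\<phi> T))" using dF \<phi>(1)[OF T] by simp
    \<comment> \<open>Caratheodory's form of the derivative: the difference quotient of \<open>\<phi>\<close> is that of \<open>G\<close> divided by \<open>g\<close>\<close>
    then obtain g where g: "\<And>z. F z - F (\<phi> T) = g z * (z - \<phi> T)" "isCont g (\<phi> T)" "g (\<phi> T) = F' (\<phi> T)"
      unfolding CARAT_DERIV by blast
    have pos: "F' (\<phi> T) > 0" using y0 \<phi>(1)[OF T] by simp
    have "isCont (\<lambda>T'. g (\<phi> T')) T" by (rule isCont_o2[OF cont[OF T] g(2)])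
    then have g_lim: "((\<lambda>T'. g (\<phi> T')) \<longlongrightarrow> F' (\<phi> T)) (at T)" by (simp add: isCont_def g(3))
    have "((\<lambda>T'. (zeta_primitive T' - zeta_primitive T) / (T' - T)) \<longlongrightarrow> zeta_sq T) (at T)"
      using zeta_primitive_has_derivative[OF \<phi>(3)[OF T]] by (simp add: has_field_derivative_iff)
    from tendsto_divide[OF this g_lim] pos
    have "((\<lambda>T'. (zeta_primitive T' - zeta_primitive T) / (T' - T) / g (\<phi> T')) \<longlongrightarrow> zeta_sq T / F' (\<phi> T)) (at T)"
      by simp
    moreover have "\<forall>\<^sub>F T' in at T. g (\<phi> T') > 0" by (rule order_tendstoD(1)[OF g_lim pos])
    then have "\<forall>\<^sub>F T' in at T. (zeta_primitive T' - zeta_primitive T) / (T' - T) / g (\<phi> T') = (\<phi> T' - \<phi> T) / (T' - T)"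
      using near[OF T]
    proof eventually_elim
      case (elim T')
      have "zeta_primitive T' - zeta_primitive T = g (\<phi> T') * (\<phi> T' - \<phi> T)"
        using g(1)[of "\<phi> T'"] \<phi>(2)[OF T] \<phi>(2)[OF elim(2)] by simp
      then show ?case using elim(1) by simp
    qed
    ultimately show ?thesis by (simp add: has_field_derivative_iff tendsto_cong)
  qed
  show ?thesis
  proof (rule that[OF A])
    fix T assume T: "T \<ge> A"
    then have T': "T > A - 1" by simp
    show "omega T > 0" unfolding omega_def using y0[of "\<phi> T"] \<phi>(1)[OF T'] by (simp add: F'_def)
    show "(jacob_ladder \<phi> has_field_derivative zeta_sq T / omega T) (at T)"
      using DERIV_cdivide[OF deriv[OF T'], of 2]
      by (simp add: jacob_ladder_def[abs_def] omega_def F'_def mult.commute)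
  next
    fix T T' assume "A \<le> T" "T < T'"
    then show "jacob_ladder \<phi> T < jacob_ladder \<phi> T'" using less[of T T'] by (simp add: jacob_ladder_def)
  next
    fix T T' assume T: "A \<le> T" "T' \<ge> T\<^sub>0" "jacob_ladder \<phi> T' = jacob_ladder \<phi> T"
    then have G: "zeta_primitive T' = zeta_primitive T" "T > 0"
      using ladder_equation[of T] ladder_equation[of T'] A by (auto simp: jacob_ladder_def)
    have "zeta_primitive T > 0" using zeta_primitive_strict_mono[of 0 T] G(2) by simp
    then have "T' > 0" using G(1) zeta_primitive_0[of T'] by (rule_tac ccontr) simp
    have "\<not> T < T'" "\<not> T' < T"
      using zeta_primitive_strict_mono[of T T'] zeta_primitive_strict_mono[of T' T] G \<open>T' > 0\<close> by linarith+
    then show "T' = T" by simp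
  qed
qed

end

context ladder_solution
begin

abbreviation J :: "real \<Rightarrow> real" where "J \<equiv> jacob_ladder \<phi>"
abbreviation R :: "real \<Rightarrow> real" where "R \<equiv> inv_into {T\<^sub>0..} (jacob_ladder \<phi>)"

text \<open>
  Surjectivity onto a half-line is the intermediate value theorem; injectivity among all arguments \<open>\<ge> T\<^sub>0\<close> makes
  the chosen preimage the large one.
\<close>

lemma jacob_ladder_inverse:
  obtains A where "A > 1"
    "\<And>T. T \<ge> A \<Longrightarrow> omega T > 0"
    "\<And>T. T \<ge> A \<Longrightarrow> (J has_field_derivative zeta_sq T / omega T) (at T)"
    "\<And>T T'. A \<le> T \<Longrightarrow> T < T' \<Longrightarrow> J T < J T'"
    "\<And>S. S \<ge> J A \<Longrightarrow> R S \<ge> A \<and> J (R S) = S"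
    "filterlim R at_top at_top"
proof -
  obtain A where A: "A > 1" "A \<ge> T\<^sub>0"
    "\<And>T. T \<ge> A \<Longrightarrow> omega T > 0"
    "\<And>T. T \<ge> A \<Longrightarrow> (J has_field_derivative zeta_sq T / omega T) (at T)"
    "\<And>T T'. A \<le> T \<Longrightarrow> T < T' \<Longrightarrow> J T < J T'"
    "\<And>T T'. A \<le> T \<Longrightarrow> T' \<ge> T\<^sub>0 \<Longrightarrow> J T' = J T \<Longrightarrow> T' = T"
    by (fact jacob_ladder_regular)
  have J_top: "filterlim J at_top at_top"
    unfolding jacob_ladder_def[abs_def]
    using filterlim_tendsto_pos_mult_at_top[OF tendsto_const[of "1/2"] _ phi_at_top] by simp
  have R: "R S \<ge> Z \<and> J (R S) = S" if Z: "Z \<ge> A" and S: "S \<ge> J Z" for S Z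
  proof -
    have "\<forall>\<^sub>F T in at_top. J T \<ge> S \<and> T \<ge> Z"
      using J_top by (intro eventually_conj eventually_ge_at_top) (simp add: filterlim_at_top)
    then obtain B where B: "J B \<ge> S" "B \<ge> Z"
      by (auto simp: eventually_at_top_linorder)
    \<comment> \<open>the preimage is located between two points where the ladder is regular\<close>
    have "continuous_on {Z..B} J"
      by (rule DERIV_continuous_on[OF has_field_derivative_at_within[OF A(4)]]) (use Z in auto)
    then obtain T where T: "Z \<le> T" "T \<le> B" "J T = S"
      using IVT'[of J Z S B] S B by blast
    have "S \<in> J ` {T\<^sub>0..}" using T Z A(2) by auto
    then have "R S \<in> {T\<^sub>0..}" "J (R S) = S" by (rule inv_into_into, rule f_inv_into_f)
    then have "R S = T" using A(6)[of T "R S"] T Z by simp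
    then show ?thesis using T by simp
  qed
  show ?thesis
  proof (rule that[of A])
    show "filterlim R at_top at_top"
      unfolding filterlim_at_top
    proof
      fix Z
      show "\<forall>\<^sub>F S in at_top. Z \<le> R S"
        using eventually_ge_at_top[of "J (max A Z)"] by eventually_elim (use R[of "max A Z"] in auto)
    qed
  qed (use A R[of A] in auto)
qed

lemma filterlim_reverse_iter: "filterlim (R ^^ i) at_top at_top"
proof (induction i)
  case 0
  then show ?case by (simp add: filterlim_ident id_def)
next
  case (Suc i)
  have "filterlim R at_top at_top" by (rule jacob_ladder_inverse)
  from filterlim_compose[OF this Suc] show ?case by (simp add: o_def)
qed

lemma ln_reverse_asymp: "((\<lambda>S. ln (R S) / ln S) \<longlongrightarrow> 1) at_top"
proof -
  obtain A where A: "A > 1" "\<And>S. S \<ge> J A \<Longrightarrow> R S \<ge> A \<and> J (R S) = S" "filterlim R at_top at_top"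
    by (rule jacob_ladder_inverse) blast
  have "((\<lambda>T::real. ln 2 / ln T) \<longlongrightarrow> 0) at_top" by real_asymp
  from tendsto_diff[OF ln_phi_asymp this]
  have "((\<lambda>T. ln (\<phi> T) / ln T - ln 2 / ln T) \<longlongrightarrow> 1) at_top" by simp
  moreover have "\<forall>\<^sub>F T in at_top. \<phi> T > 0" using phi_at_top by (simp add: filterlim_at_top_dense)
  then have "\<forall>\<^sub>F T in at_top. ln (\<phi> T) / ln T - ln 2 / ln T = ln (J T) / ln T"
    by eventually_elim (simp add: jacob_ladder_def ln_div diff_divide_distrib)
  ultimately have "((\<lambda>T. ln (J T) / ln T) \<longlongrightarrow> 1) at_top" by (rule Lim_transform_eventually)
  from tendsto_inverse[OF filterlim_compose[OF this A(3)]]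
  have "((\<lambda>S. inverse (ln (J (R S)) / ln (R S))) \<longlongrightarrow> 1) at_top" by simp
  moreover have "\<forall>\<^sub>F S in at_top. inverse (ln (J (R S)) / ln (R S)) = ln (R S) / ln S"
    using eventually_ge_at_top[of "J A"] by eventually_elim (use A(2) in simp)
  ultimately show ?thesis by (rule Lim_transform_eventually)
qed

lemma ln_reverse_iter_asymp: "((\<lambda>S. ln ((R ^^ i) S) / ln S) \<longlongrightarrow> 1) at_top"
proof (induction i)
  case 0
  have "\<forall>\<^sub>F S::real in at_top. 1 = ln S / ln S" using eventually_gt_at_top[of 1] by eventually_elim simp
  from Lim_transform_eventually[OF tendsto_const this] show ?case by simp
next
  case (Suc i)
  have "((\<lambda>S. ln (R ((R ^^ i) S)) / ln ((R ^^ i) S)) \<longlongrightarrow> 1) at_top"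
    by (rule filterlim_compose[OF ln_reverse_asymp filterlim_reverse_iter])
  from tendsto_mult[OF this Suc]
  have "((\<lambda>S. ln (R ((R ^^ i) S)) / ln ((R ^^ i) S) * (ln ((R ^^ i) S) / ln S)) \<longlongrightarrow> 1) at_top" by simp
  moreover have "\<forall>\<^sub>F S in at_top. (R ^^ i) S > 1"
    using filterlim_reverse_iter[of i] by (simp add: filterlim_at_top_dense)
  then have "\<forall>\<^sub>F S in at_top. ln (R ((R ^^ i) S)) / ln ((R ^^ i) S) * (ln ((R ^^ i) S) / ln S) = ln ((R ^^ Suc i) S) / ln S"
    by eventually_elim simp
  ultimately show ?case by (rule Lim_transform_eventually)
qed

end

section \<open>Change of variables and uniform limits\<close>

text \<open>
  Products of two square-integrable functions are integrable, and substitution multiplies their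
  integrals by the constant \<open>1/c\<close>.
\<close>

lemma L2_orthogonal_change_of_variables:
  fixes a b c :: real and f :: "nat \<Rightarrow> real \<Rightarrow> real"
  assumes orth: "L2_orthogonal f {a..b}" and c: "c > 0"
    and der: "\<And>t. t \<in> {a..b} \<Longrightarrow> (g has_field_derivative c * W t) (at t within {a..b})"
    and inj: "inj_on g {a..b}" and img: "g ` {a..b} = {a..b}"
    and W: "\<And>t. t \<in> {a..b} \<Longrightarrow> W t \<ge> 0"
  shows "L2_orthogonal_weight (\<lambda>n t. f n (g t)) W {a..b}"
proof -
  define S where "S = {a..b}"
  have S: "S \<in> sets lebesgue" by (simp add: S_def)
  have meas: "f n \<in> borel_measurable (lebesgue_on S)"
    and sq: "integrable (lebesgue_on S) (\<lambda>t. (f n t)\<^sup>2)" for n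
    using orth unfolding L2_orthogonal_def S_def by blast+
  have main: "integrable (lebesgue_on S) (\<lambda>t. f m (g t) * f n (g t) * W t) \<and>
      (LINT t|lebesgue_on S. f m (g t) * f n (g t) * W t) = (LINT t|lebesgue_on S. f m t * f n t) / c" for m n
  proof -
    define F where "F t = f m t * f n t" for t
    have "integrable (lebesgue_on S) F"
    proof (rule Bochner_Integration.integrable_bound)
      show "integrable (lebesgue_on S) (\<lambda>t. (f m t)\<^sup>2 + (f n t)\<^sup>2)"
        by (intro Bochner_Integration.integrable_add sq)
      show "F \<in> borel_measurable (lebesgue_on S)"
        unfolding F_def[abs_def] by (intro borel_measurable_times meas)
      have "\<bar>x * y\<bar> \<le> x\<^sup>2 + y\<^sup>2" for x y :: real
      proof -
        have "0 \<le> (\<bar>x\<bar> - \<bar>y\<bar>)\<^sup>2" by simp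
        also have "(\<bar>x\<bar> - \<bar>y\<bar>)\<^sup>2 = x\<^sup>2 + y\<^sup>2 - 2 * \<bar>x * y\<bar>" by (simp add: power2_diff abs_mult)
        finally show ?thesis using abs_ge_zero[of "x * y"] by linarith
      qed
      then show "AE t in lebesgue_on S. norm (F t) \<le> norm ((f m t)\<^sup>2 + (f n t)\<^sup>2)"
        by (intro AE_I2) (simp add: F_def)
    qed
    note F = this
    have "F absolutely_integrable_on g ` S \<and> integral (g ` S) F = integral S F"
      using F S img by (simp add: S_def set_integrable_def integrable_restrict_space)
    moreover have "(\<lambda>x. \<bar>c * W x\<bar> * F (g x)) absolutely_integrable_on S \<and>
           integral S (\<lambda>x. \<bar>c * W x\<bar> * F (g x)) = integral S F
       \<longleftrightarrow> F absolutely_integrable_on g ` S \<and> integral (g ` S) F = integral S F"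
      by (rule has_absolute_integral_change_of_variables_1'[OF S])
         (use der inj in \<open>auto simp: S_def\<close>)
    ultimately have abs: "(\<lambda>x. \<bar>c * W x\<bar> * F (g x)) absolutely_integrable_on S"
      "integral S (\<lambda>x. \<bar>c * W x\<bar> * F (g x)) = integral S F" by blast+
    define h where "h x = \<bar>c * W x\<bar> * F (g x)" for x
    have h: "integrable (lebesgue_on S) h"
      unfolding h_def[abs_def] by (rule absolutely_integrable_imp_integrable[OF abs(1) S])
    have "(LINT t|lebesgue_on S. h t) = integral S h" by (rule lebesgue_integral_eq_integral[OF h S])
    also have "\<dots> = integral S F" using abs(2) by (simp add: h_def[abs_def])
    also have "\<dots> = (LINT t|lebesgue_on S. F t)" by (rule lebesgue_integral_eq_integral[OF F S, symmetric])
    finally have hF: "(LINT t|lebesgue_on S. h t) = (LINT t|lebesgue_on S. F t)" .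
    have eq: "f m (g t) * f n (g t) * W t = h t / c" if "t \<in> space (lebesgue_on S)" for t
    proof -
      have "t \<in> {a..b}" using that by (simp add: S_def)
      from W[OF this] c show ?thesis by (simp add: h_def F_def abs_mult)
    qed
    have "integrable (lebesgue_on S) (\<lambda>t. f m (g t) * f n (g t) * W t) = integrable (lebesgue_on S) (\<lambda>t. h t / c)"
      by (rule Bochner_Integration.integrable_cong[OF refl eq])
    moreover have "(LINT t|lebesgue_on S. f m (g t) * f n (g t) * W t) = (LINT t|lebesgue_on S. h t / c)"
      by (rule Bochner_Integration.integral_cong[OF refl eq])
    ultimately show ?thesis using h hF by (simp add: F_def[abs_def])
  qed
  show ?thesis
    unfolding L2_orthogonal_weight_def S_def[symmetric]
  proof (intro conjI allI impI ballI)
    show "W t \<ge> 0" if "t \<in> S" for t using W that by (simp add: S_def)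
    show "integrable (lebesgue_on S) (\<lambda>t. f m (g t) * f n (g t) * W t)" for m n using main by blast
    show "(LINT t|lebesgue_on S. f m (g t) * f n (g t) * W t) = 0" if "m \<noteq> n" for m n
      using orth that main unfolding L2_orthogonal_def S_def[symmetric] by simp
  qed
qed

text \<open>
  Limits along this filter are limits as \<open>T \<rightarrow> \<infinity>\<close> that are uniform in the second component, so that the limit
  rules for products and quotients apply to uniform limits without boundedness conditions.
\<close>

definition uniformly_at_top :: "'a set \<Rightarrow> (real \<times> 'a) filter" where
  "uniformly_at_top S = inf (filtercomap fst at_top) (principal (UNIV \<times> S))"

lemma eventually_uniformly_at_top:
  "eventually P (uniformly_at_top S) \<longleftrightarrow> (\<forall>\<^sub>F T in at_top. \<forall>t\<in>S. P (T, t))"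
proof
  assume "eventually P (uniformly_at_top S)"
  then obtain Q where Q: "eventually Q at_top" "\<And>x. Q (fst x) \<Longrightarrow> x \<in> UNIV \<times> S \<longrightarrow> P x"
    unfolding uniformly_at_top_def eventually_inf_principal eventually_filtercomap by blast
  from Q(1) show "\<forall>\<^sub>F T in at_top. \<forall>t\<in>S. P (T, t)"
    by eventually_elim (use Q(2) in auto)
next
  assume "\<forall>\<^sub>F T in at_top. \<forall>t\<in>S. P (T, t)"
  then show "eventually P (uniformly_at_top S)"
    unfolding uniformly_at_top_def eventually_inf_principal eventually_filtercomap
    by (intro exI[of _ "\<lambda>T. \<forall>t\<in>S. P (T, t)"]) auto
qed

lemma uniform_limit_at_top_iff:
  "uniform_limit S h (\<lambda>_. l) at_top \<longleftrightarrow> ((\<lambda>(T, t). h T t) \<longlongrightarrow> l) (uniformly_at_top S)"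
  by (simp add: uniform_limit_iff tendsto_iff eventually_uniformly_at_top)

lemma filterlim_fst_uniformly_at_top: "filterlim fst at_top (uniformly_at_top S)"
  unfolding uniformly_at_top_def
  by (rule filterlim_mono[OF filterlim_filtercomap order_refl inf_le1])

section \<open>Iterates of the ladder\<close>

context ladder_solution
begin

text \<open>
  Once the first \<open>k\<close> reverse iterates of \<open>T\<close> and \<open>T + 2l\<close> are so large that the ladder is regular above them, each
  application of the ladder maps the interval between the \<open>i\<close>-th reverse iterates onto the one between the \<open>(i-1)\<close>-th.
  All points of an orbit therefore stay in the regular range.
\<close>

lemma eventually_ladder_orbit:
  assumes l: "l > 0"
  shows "\<forall>\<^sub>F T in at_top. \<forall>p\<le>k.
    (R ^^ p) T < (R ^^ p) (T + 2 * l) \<and>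
    (J ^^ p) ((R ^^ p) T) = T \<and> (J ^^ p) ((R ^^ p) (T + 2 * l)) = T + 2 * l \<and>
    (\<forall>u v. (R ^^ p) T \<le> u \<and> u < v \<and> v \<le> (R ^^ p) (T + 2 * l) \<longrightarrow> (J ^^ p) u < (J ^^ p) v) \<and>
    (\<forall>u\<in>{(R ^^ p) T..(R ^^ p) (T + 2 * l)}.
       (J ^^ p has_field_derivative (\<Prod>r<p. Z_tilde_sq \<phi> ((J ^^ r) u))) (at u) \<and>
       (\<forall>r<p. omega ((J ^^ r) u) > 0 \<and>
         Z_tilde_sq \<phi> ((J ^^ r) u) = zeta_sq ((J ^^ r) u) / omega ((J ^^ r) u) \<and>
         (R ^^ (p - r)) T \<le> (J ^^ r) u \<and> (J ^^ r) u \<le> (R ^^ (p - r)) (T + 2 * l)))"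
proof -
  obtain A where A: "A > 1"
    "\<And>T. T \<ge> A \<Longrightarrow> omega T > 0"
    "\<And>T. T \<ge> A \<Longrightarrow> (J has_field_derivative zeta_sq T / omega T) (at T)"
    "\<And>T T'. A \<le> T \<Longrightarrow> T < T' \<Longrightarrow> J T < J T'"
    "\<And>S. S \<ge> J A \<Longrightarrow> R S \<ge> A \<and> J (R S) = S"
    "filterlim R at_top at_top"
    by (fact jacob_ladder_inverse)
  define B where "B = max A (J A)"
  have "filterlim (\<lambda>T::real. T + 2 * l) at_top at_top" by real_asymp
  then have "\<forall>\<^sub>F T in at_top. (R ^^ i) T \<ge> B \<and> (R ^^ i) (T + 2 * l) \<ge> B" for i
    using filterlim_compose[OF filterlim_reverse_iter[of i], of "\<lambda>T. T + 2 * l" at_top]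
      filterlim_reverse_iter[of i]
    unfolding filterlim_at_top by (intro eventually_conj) blast+
  then have "\<forall>\<^sub>F T in at_top. \<forall>i\<in>{..k}. (R ^^ i) T \<ge> B \<and> (R ^^ i) (T + 2 * l) \<ge> B"
    by (intro eventually_ball_finite) auto
  then show ?thesis
  proof eventually_elim
    case (elim T)
    define U where "U = T + 2 * l"
    have big: "(R ^^ i) T \<ge> A" "(R ^^ i) U \<ge> A" "(R ^^ i) T \<ge> J A" "(R ^^ i) U \<ge> J A" if "i \<le> k" for i
      using elim that by (auto simp: B_def U_def)
    have J_mono: "J x \<le> J y" if "A \<le> x" "x \<le> y" for x y
      using A(4)[of x y] that by (cases "x = y") auto
    have JR: "J ((R ^^ (p - r)) S) = (R ^^ (p - Suc r)) S"
      if "S \<in> {T, U}" "Suc r \<le> p" "p \<le> k" for S r p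
    proof -
      have "p - r = Suc (p - Suc r)" using that by simp
      then have "(R ^^ (p - r)) S = R ((R ^^ (p - Suc r)) S)" by simp
      moreover have "(R ^^ (p - Suc r)) S \<ge> J A" using that big(3,4)[of "p - Suc r"] by auto
      ultimately show ?thesis using A(5) by simp
    qed
    have ret: "(J ^^ r) ((R ^^ p) S) = (R ^^ (p - r)) S" if "S \<in> {T, U}" "r \<le> p" "p \<le> k" for S r p
      using that(2)
    proof (induction r)
      case (Suc r)
      then show ?case using JR[OF that(1) Suc.prems that(3)] by simp
    qed simp
    have lt: "(R ^^ i) T < (R ^^ i) U" if "i \<le> k" for i
      using that
    proof (induction i)
      case (Suc i)
      then have IH: "(R ^^ i) T < (R ^^ i) U" by simp
      note b = big[of i]
      show ?case
      proof (rule ccontr)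
        assume "\<not> ?thesis"
        then have "R ((R ^^ i) U) \<le> R ((R ^^ i) T)" by simp
        then have "J (R ((R ^^ i) U)) \<le> J (R ((R ^^ i) T))"
          using A(5)[of "(R ^^ i) U"] b(4) Suc.prems by (intro J_mono) auto
        then show False using IH A(5)[of "(R ^^ i) U"] A(5)[of "(R ^^ i) T"] b(3,4) Suc.prems by simp
      qed
    qed (use l in \<open>simp add: U_def\<close>)
    have bounds: "(R ^^ (p - r)) T \<le> (J ^^ r) u \<and> (J ^^ r) u \<le> (R ^^ (p - r)) U"
      if u: "(R ^^ p) T \<le> u" "u \<le> (R ^^ p) U" and r: "r \<le> p" and p: "p \<le> k" for u r p
      using r
    proof (induction r)
      case (Suc r)
      then have IH: "(R ^^ (p - r)) T \<le> (J ^^ r) u" "(J ^^ r) u \<le> (R ^^ (p - r)) U" by simp_all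
      have "(R ^^ (p - r)) T \<ge> A" using big(1)[of "p - r"] p by simp
      then have "J ((R ^^ (p - r)) T) \<le> J ((J ^^ r) u)" "J ((J ^^ r) u) \<le> J ((R ^^ (p - r)) U)"
        using IH by (auto intro!: J_mono)
      then show ?case using JR[of T r p] JR[of U r p] Suc.prems p by simp
    qed (use u in simp)
    have ge: "(J ^^ r) u \<ge> A"
      if u: "(R ^^ p) T \<le> u" "u \<le> (R ^^ p) U" and r: "r \<le> p" and p: "p \<le> k" for u r p
    proof -
      have "p - r \<le> k" using p by simp
      from big(1)[OF this] bounds[OF that] show ?thesis by (meson order.trans)
    qed
    have strict: "(J ^^ r) u < (J ^^ r) v"
      if uv: "(R ^^ p) T \<le> u" "u < v" "v \<le> (R ^^ p) U" and r: "r \<le> p" and p: "p \<le> k" for u v r p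
      using r
    proof (induction r)
      case (Suc r)
      then have "(J ^^ r) u < (J ^^ r) v" by simp
      moreover have "(J ^^ r) u \<ge> A" using uv Suc.prems p by (intro ge[of p]) auto
      ultimately show ?case using A(4) by simp
    qed (use uv in simp)
    have Z: "Z_tilde_sq \<phi> x = zeta_sq x / omega x" if "x \<ge> A" for x
      unfolding Z_tilde_sq_def by (rule DERIV_imp_deriv[OF A(3)[OF that]])
    have der: "(J ^^ r has_field_derivative (\<Prod>i<r. Z_tilde_sq \<phi> ((J ^^ i) u))) (at u)"
      if u: "(R ^^ p) T \<le> u" "u \<le> (R ^^ p) U" and r: "r \<le> p" and p: "p \<le> k" for u r p
      using r
    proof (induction r)
      case 0
      then show ?case by (simp add: id_def)
    next
      case (Suc r)
      have "(J ^^ r) u \<ge> A" using ge[OF u _ p, of r] Suc.prems by simp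
      then have "(J has_field_derivative Z_tilde_sq \<phi> ((J ^^ r) u)) (at ((J ^^ r) u))"
        using A(3) Z by simp
      from DERIV_chain2[OF this Suc.IH] Suc.prems
      show ?case by (simp add: o_def mult.commute)
    qed
    show ?case
      unfolding U_def[symmetric]
    proof (intro allI impI conjI ballI)
      fix p assume p: "p \<le> k"
      show "(R ^^ p) T < (R ^^ p) U" by (rule lt[OF p])
      show "(J ^^ p) ((R ^^ p) T) = T" "(J ^^ p) ((R ^^ p) U) = U" using ret[of _ p p] p by simp_all
      show "(J ^^ p) u < (J ^^ p) v" if "(R ^^ p) T \<le> u \<and> u < v \<and> v \<le> (R ^^ p) U" for u v
        using strict[of p u v p] that p by simp
      fix u assume "u \<in> {(R ^^ p) T..(R ^^ p) U}"
      then have u: "(R ^^ p) T \<le> u" "u \<le> (R ^^ p) U" by simp_all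
      show "(J ^^ p has_field_derivative (\<Prod>r<p. Z_tilde_sq \<phi> ((J ^^ r) u))) (at u)"
        by (rule der[OF u order_refl p])
      fix r assume r: "r < p"
      note g = ge[OF u less_imp_le[OF r] p]
      show "omega ((J ^^ r) u) > 0" by (rule A(2)[OF g])
      show "Z_tilde_sq \<phi> ((J ^^ r) u) = zeta_sq ((J ^^ r) u) / omega ((J ^^ r) u)" by (rule Z[OF g])
      show "(R ^^ (p - r)) T \<le> (J ^^ r) u" "(J ^^ r) u \<le> (R ^^ (p - r)) U"
        using bounds[OF u less_imp_le[OF r] p] by simp_all
    qed
  qed
qed

lemma ladder_u_image:
  fixes a l T :: real
  assumes l: "l > 0" and lt: "(R ^^ p) T < (R ^^ p) (T + 2 * l)" and t: "t \<in> {a..a + 2 * l}"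
  shows "ladder_u T\<^sub>0 \<phi> a l p T t \<in> {(R ^^ p) T..(R ^^ p) (T + 2 * l)}"
proof -
  define d where "d = (R ^^ p) (T + 2 * l) - (R ^^ p) T"
  define x where "x = (t - a) / (2 * l)"
  have x: "0 \<le> x" "x \<le> 1" using t l by (auto simp: x_def field_simps)
  have d: "d > 0" using lt by (simp add: d_def)
  have "ladder_u T\<^sub>0 \<phi> a l p T t = d * x + (R ^^ p) T"
    by (simp add: ladder_u_def ladder_reverse_def d_def x_def)
  moreover have "0 \<le> d * x" "d * x \<le> d * 1" using x d by (auto intro: mult_left_mono)
  ultimately show ?thesis by (simp add: d_def)
qed

lemma ladder_system_orthogonal:
  assumes l: "l > 0" and orth: "L2_orthogonal f {a..a + 2 * l}"
  shows "\<forall>\<^sub>F T in at_top. \<forall>p\<in>{1..k}.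
            L2_orthogonal_weight
              (\<lambda>n t. f n (ladder_iter \<phi> p (ladder_u T\<^sub>0 \<phi> a l p T t) - T + a))
              (ladder_weight T\<^sub>0 \<phi> a l p T) {a..a + 2 * l}"
  using eventually_ladder_orbit[OF l, of k]
proof eventually_elim
  case (elim T)
  show ?case
  proof
    fix p assume p: "p \<in> {1..k}"
    define lo hi where "lo = (R ^^ p) T" and "hi = (R ^^ p) (T + 2 * l)"
    define u where "u = ladder_u T\<^sub>0 \<phi> a l p T"
    define c where "c = (hi - lo) / (2 * l)"
    define g where "g t = (J ^^ p) (u t) - T + a" for t
    have orbit: "lo < hi" "(J ^^ p) lo = T" "(J ^^ p) hi = T + 2 * l"
      "\<And>x y. lo \<le> x \<Longrightarrow> x < y \<Longrightarrow> y \<le> hi \<Longrightarrow> (J ^^ p) x < (J ^^ p) y"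
      "\<And>x. x \<in> {lo..hi} \<Longrightarrow> (J ^^ p has_field_derivative (\<Prod>r<p. Z_tilde_sq \<phi> ((J ^^ r) x))) (at x)"
      "\<And>x r. x \<in> {lo..hi} \<Longrightarrow> r < p \<Longrightarrow> omega ((J ^^ r) x) > 0 \<and>
         Z_tilde_sq \<phi> ((J ^^ r) x) = zeta_sq ((J ^^ r) x) / omega ((J ^^ r) x)"
      using elim p unfolding lo_def hi_def by auto
    have c: "c > 0" using orbit(1) l by (simp add: c_def)
    have u_eq: "u t = c * (t - a) + lo" for t
      by (simp add: u_def ladder_u_def ladder_reverse_def c_def lo_def hi_def)
    have u_in: "u t \<in> {lo..hi}" if "t \<in> {a..a + 2 * l}" for t
      unfolding u_def lo_def hi_def
      by (rule ladder_u_image[OF l orbit(1)[unfolded lo_def hi_def] that])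
    have u_ends: "u a = lo" "u (a + 2 * l) = hi" using l by (simp_all add: u_eq c_def)
    have W: "ladder_weight T\<^sub>0 \<phi> a l p T t = (\<Prod>r<p. Z_tilde_sq \<phi> ((J ^^ r) (u t)))" for t
      by (simp add: ladder_weight_def ladder_iter_def u_def)
    have dg: "(g has_field_derivative c * ladder_weight T\<^sub>0 \<phi> a l p T t) (at t)" if "t \<in> {a..a + 2 * l}" for t
    proof -
      have "(u has_field_derivative c) (at t)"
        unfolding u_eq[abs_def] by (auto intro!: derivative_eq_intros)
      from DERIV_chain2[OF orbit(5)[OF u_in[OF that]] this]
      have "((\<lambda>t. (J ^^ p) (u t)) has_field_derivative ladder_weight T\<^sub>0 \<phi> a l p T t * c) (at t)"
        unfolding W .
      then show ?thesis
        unfolding g_def[abs_def] by (auto intro!: derivative_eq_intros)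
    qed
    have g_less: "g s < g t" if "s \<in> {a..a + 2 * l}" "t \<in> {a..a + 2 * l}" "s < t" for s t
    proof -
      have "u s < u t" using that(3) c by (simp add: u_eq)
      then show ?thesis using orbit(4)[of "u s" "u t"] u_in[OF that(1)] u_in[OF that(2)] by (simp add: g_def)
    qed
    have g_ends: "g a = a" "g (a + 2 * l) = a + 2 * l"
      using orbit(2,3) by (simp_all add: g_def u_ends)
    have inj: "inj_on g {a..a + 2 * l}"
    proof (rule linorder_inj_onI)
      fix s t assume "s < t" "s \<in> {a..a + 2 * l}" "t \<in> {a..a + 2 * l}"
      then show "g s \<noteq> g t" using g_less[of s t] by simp
    qed (use linear in auto)
    have img: "g ` {a..a + 2 * l} = {a..a + 2 * l}"
    proof (intro equalityI subsetI)
      fix y assume "y \<in> g ` {a..a + 2 * l}"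
      then obtain t where t: "t \<in> {a..a + 2 * l}" "y = g t" by blast
      have "g a \<le> g t" using g_less[of a t] t l by (cases "t = a") auto
      moreover have "g t \<le> g (a + 2 * l)" using g_less[of t "a + 2 * l"] t l by (cases "t = a + 2 * l") auto
      ultimately show "y \<in> {a..a + 2 * l}" using g_ends t by simp
    next
      fix y assume y: "y \<in> {a..a + 2 * l}"
      have "continuous_on {a..a + 2 * l} g"
        by (rule DERIV_continuous_on[OF has_field_derivative_at_within[OF dg]])
      then have "\<exists>t. a \<le> t \<and> t \<le> a + 2 * l \<and> g t = y"
        using y l g_ends by (intro IVT') auto
      then show "y \<in> g ` {a..a + 2 * l}" by auto
    qed
    have "L2_orthogonal_weight (\<lambda>n t. f n (g t)) (ladder_weight T\<^sub>0 \<phi> a l p T) {a..a + 2 * l}"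
    proof (rule L2_orthogonal_change_of_variables[OF orth c _ inj img])
      fix t assume t: "t \<in> {a..a + 2 * l}"
      show "(g has_field_derivative c * ladder_weight T\<^sub>0 \<phi> a l p T t) (at t within {a..a + 2 * l})"
        by (rule has_field_derivative_at_within[OF dg[OF t]])
      show "ladder_weight T\<^sub>0 \<phi> a l p T t \<ge> 0"
        unfolding W by (intro prod_nonneg) (use orbit(6)[OF u_in[OF t]] in \<open>auto intro: divide_nonneg_pos\<close>)
    qed
    then show "L2_orthogonal_weight (\<lambda>n t. f n (ladder_iter \<phi> p (ladder_u T\<^sub>0 \<phi> a l p T t) - T + a))
        (ladder_weight T\<^sub>0 \<phi> a l p T) {a..a + 2 * l}"
      by (simp add: g_def ladder_iter_def u_def)
  qed
qed

text \<open>
  With \<open>x\<^sub>r = \<phi>\<^sub>1^r(u\<^sub>p(t))\<close> the relative error is exactly the product of the factors \<open>ln T / \<omega>(x\<^sub>r)\<close>, less 1.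
  It does not involve the zeta values, so their possible zeros cause no difficulty.
\<close>

lemma ladder_weight_asymp:
  assumes l: "l > 0"
  shows "asymp_eq_uniform {a..a + 2 * l}
     (\<lambda>T t. ladder_weight T\<^sub>0 \<phi> a l p T t)
     (\<lambda>T t. 1 / ln T ^ p * (\<Prod>r<p. zeta_sq (ladder_iter \<phi> r (ladder_u T\<^sub>0 \<phi> a l p T t))))"
proof -
  define S where "S = {a..a + 2 * l}"
  define x where "x r T t = (J ^^ r) (ladder_u T\<^sub>0 \<phi> a l p T t)" for r T t
  define h where "h T t = (\<Prod>r<p. ln T / omega (x r T t)) - 1" for T t
  define G where "G = (uniformly_at_top S :: (real \<times> real) filter)"
  have orbit: "\<forall>\<^sub>F T in at_top. \<forall>t\<in>S. \<forall>r<p. omega (x r T t) > 0 \<and>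
         Z_tilde_sq \<phi> (x r T t) = zeta_sq (x r T t) / omega (x r T t) \<and>
         (R ^^ (p - r)) T \<le> x r T t \<and> x r T t \<le> (R ^^ (p - r)) (T + 2 * l)"
    using eventually_ladder_orbit[OF l, of p]
  proof eventually_elim
    case (elim T)
    show ?case
    proof
      fix t assume "t \<in> S"
      then have "ladder_u T\<^sub>0 \<phi> a l p T t \<in> {(R ^^ p) T..(R ^^ p) (T + 2 * l)}"
        using elim unfolding S_def by (intro ladder_u_image[OF l]) auto
      then show "\<forall>r<p. omega (x r T t) > 0 \<and>
         Z_tilde_sq \<phi> (x r T t) = zeta_sq (x r T t) / omega (x r T t) \<and>
         (R ^^ (p - r)) T \<le> x r T t \<and> x r T t \<le> (R ^^ (p - r)) (T + 2 * l)"
        using elim unfolding x_def by blast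
    qed
  qed
  have fst_top: "filterlim fst at_top G" unfolding G_def by (rule filterlim_fst_uniformly_at_top)
  have factor: "((\<lambda>(T, t). ln T / omega (x r T t)) \<longlongrightarrow> 1) G" if r: "r < p" for r
  proof -
    define i where "i = p - r"
    have bounds: "\<forall>\<^sub>F z in G. (R ^^ i) (fst z) \<le> x r (fst z) (snd z) \<and> x r (fst z) (snd z) \<le> (R ^^ i) (fst z + 2 * l)"
      unfolding G_def eventually_uniformly_at_top i_def using orbit
      by eventually_elim (use r in auto)
    have lo: "filterlim (\<lambda>z. (R ^^ i) (fst z)) at_top G"
      by (rule filterlim_compose[OF filterlim_reverse_iter fst_top])
    have x_top: "filterlim (\<lambda>z. x r (fst z) (snd z)) at_top G"
      by (rule filterlim_at_top_mono[OF lo]) (use bounds in eventually_elim, simp)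
    have shift: "filterlim (\<lambda>T::real. T + 2 * l) at_top at_top" by real_asymp
    have "((\<lambda>T. ln ((R ^^ i) (T + 2 * l)) / ln (T + 2 * l)) \<longlongrightarrow> 1) at_top"
      by (rule filterlim_compose[OF ln_reverse_iter_asymp shift])
    moreover have "((\<lambda>T. ln (T + 2 * l) / ln T) \<longlongrightarrow> 1) at_top" by real_asymp
    ultimately have "((\<lambda>T. ln ((R ^^ i) (T + 2 * l)) / ln (T + 2 * l) * (ln (T + 2 * l) / ln T)) \<longlongrightarrow> 1 * 1) at_top"
      by (rule tendsto_mult)
    moreover have "\<forall>\<^sub>F T in at_top. ln ((R ^^ i) (T + 2 * l)) / ln (T + 2 * l) * (ln (T + 2 * l) / ln T) = ln ((R ^^ i) (T + 2 * l)) / ln T"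
      using eventually_gt_at_top[of 1] by eventually_elim (use l in simp)
    ultimately have "((\<lambda>T. ln ((R ^^ i) (T + 2 * l)) / ln T) \<longlongrightarrow> 1 * 1) at_top"
      by (rule Lim_transform_eventually)
    then have hi: "((\<lambda>z. ln ((R ^^ i) (fst z + 2 * l)) / ln (fst z)) \<longlongrightarrow> 1) G"
      using filterlim_compose[OF _ fst_top, of "\<lambda>T. ln ((R ^^ i) (T + 2 * l)) / ln T"] by simp
    have lo': "((\<lambda>z. ln ((R ^^ i) (fst z)) / ln (fst z)) \<longlongrightarrow> 1) G"
      by (rule filterlim_compose[OF ln_reverse_iter_asymp fst_top])
    have pos: "\<forall>\<^sub>F z in G. fst z > 1 \<and> (R ^^ i) (fst z) > 1"
      using fst_top lo unfolding filterlim_at_top_dense by (intro eventually_conj) blast+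
    have "((\<lambda>z. ln (x r (fst z) (snd z)) / ln (fst z)) \<longlongrightarrow> 1) G"
    proof (rule tendsto_sandwich[OF _ _ lo' hi])
      show "\<forall>\<^sub>F z in G. ln ((R ^^ i) (fst z)) / ln (fst z) \<le> ln (x r (fst z) (snd z)) / ln (fst z)"
        using bounds pos by eventually_elim (auto intro!: divide_right_mono)
      show "\<forall>\<^sub>F z in G. ln (x r (fst z) (snd z)) / ln (fst z) \<le> ln ((R ^^ i) (fst z + 2 * l)) / ln (fst z)"
        using bounds pos by eventually_elim (auto intro!: divide_right_mono)
    qed
    moreover have "((\<lambda>z. omega (x r (fst z) (snd z)) / ln (x r (fst z) (snd z))) \<longlongrightarrow> 1) G"
      by (rule filterlim_compose[OF omega_asymp x_top])
    ultimately have "((\<lambda>z. omega (x r (fst z) (snd z)) / ln (x r (fst z) (snd z)) * (ln (x r (fst z) (snd z)) / ln (fst z))) \<longlongrightarrow> 1 * 1) G"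
      by (intro tendsto_mult)
    from tendsto_inverse[OF this]
    have "((\<lambda>z. inverse (omega (x r (fst z) (snd z)) / ln (x r (fst z) (snd z)) * (ln (x r (fst z) (snd z)) / ln (fst z)))) \<longlongrightarrow> 1) G"
      by simp
    moreover have "\<forall>\<^sub>F z in G. inverse (omega (x r (fst z) (snd z)) / ln (x r (fst z) (snd z)) * (ln (x r (fst z) (snd z)) / ln (fst z)))
        = ln (fst z) / omega (x r (fst z) (snd z))"
      using bounds pos by eventually_elim auto
    ultimately show ?thesis
      unfolding case_prod_beta' by (rule Lim_transform_eventually)
  qed
  have "((\<lambda>z. \<Prod>r<p. ln (fst z) / omega (x r (fst z) (snd z))) \<longlongrightarrow> (\<Prod>r<p. 1)) G"
    using factor unfolding case_prod_beta' by (intro tendsto_prod) auto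
  from tendsto_diff[OF this tendsto_const[of 1]]
  have "((\<lambda>(T, t). h T t) \<longlongrightarrow> 0) G" by (simp add: h_def case_prod_beta')
  then have h: "uniform_limit S h (\<lambda>_. 0) at_top"
    unfolding uniform_limit_at_top_iff G_def .
  have "\<forall>\<^sub>F T in at_top. \<forall>t\<in>S. ladder_weight T\<^sub>0 \<phi> a l p T t
      = (1 + h T t) * (1 / ln T ^ p * (\<Prod>r<p. zeta_sq (x r T t)))"
    using orbit eventually_gt_at_top[of 1]
  proof eventually_elim
    case (elim T)
    show ?case
    proof
      fix t assume t: "t \<in> S"
      have L: "ln T \<noteq> 0" using elim(2) by simp
      have "ladder_weight T\<^sub>0 \<phi> a l p T t = (\<Prod>r<p. Z_tilde_sq \<phi> (x r T t))"
        by (simp add: ladder_weight_def ladder_iter_def x_def)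
      also have "\<dots> = (\<Prod>r<p. (ln T / omega (x r T t)) * (1 / ln T * zeta_sq (x r T t)))"
        using elim(1) t L by (intro prod.cong refl) simp
      also have "\<dots> = (1 + h T t) * (1 / ln T ^ p * (\<Prod>r<p. zeta_sq (x r T t)))"
        unfolding prod.distrib h_def by (simp add: power_divide)
      finally show "ladder_weight T\<^sub>0 \<phi> a l p T t
          = (1 + h T t) * (1 / ln T ^ p * (\<Prod>r<p. zeta_sq (x r T t)))" .
    qed
  qed
  with h show ?thesis
    unfolding asymp_eq_uniform_def S_def x_def ladder_iter_def by blast
qed

end

theorem corollary1:
  fixes \<alpha> T\<^sub>0 a l :: real and \<phi> :: "real \<Rightarrow> real"
    and f :: "nat \<Rightarrow> real \<Rightarrow> real" and k :: nat
  assumes "\<alpha> \<in> {7..8}"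
    and "solves_ladder_equation \<alpha> T\<^sub>0 \<phi>"
    and "l > 0"
    and "L2_orthogonal f {a..a + 2 * l}"
    and "k \<ge> 1"
  shows "(\<forall>\<^sub>F T in at_top. \<forall>p\<in>{1..k}.
            L2_orthogonal_weight
              (\<lambda>n t. f n (ladder_iter \<phi> p (ladder_u T\<^sub>0 \<phi> a l p T t) - T + a))
              (ladder_weight T\<^sub>0 \<phi> a l p T)
              {a..a + 2 * l})
       \<and> (\<forall>p\<in>{1..k}.
            asymp_eq_uniform {a..a + 2 * l}
              (\<lambda>T t. ladder_weight T\<^sub>0 \<phi> a l p T t)
              (\<lambda>T t. 1 / ln T ^ p *
                 (\<Prod>r<p. (cmod (riemann_zeta
                    (Complex (1/2) (ladder_iter \<phi> r (ladder_u T\<^sub>0 \<phi> a l p T t)))))\<^sup>2)))"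
proof -
  interpret ladder_solution \<alpha> T\<^sub>0 \<phi>
    by unfold_locales (fact assms)+
  show ?thesis
    using ladder_system_orthogonal[OF assms(3,4), of k] ladder_weight_asymp[OF assms(3)]
    unfolding zeta_sq_def by blast
qed

end
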